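(* Let $g$, $\bar g$ be projectively equivalent (Riemannian or pseudo-Riemannian) metrics on a surface $M^2$, and suppose that $\bar g\neq \mathrm{const}\cdot g$ for every $\mathrm{const}\in\mathbb{R}$. Then, in a neighbourhood of almost every point there exist coordinates $(x,y)$ such that the metrics $g$ and $\bar g$ have one of the following three forms. (1) Liouville case: $$g=(X(x)-Y(y))(dx^2\pm dy^2),\qquad \bar g=\left(\frac{1}{Y(y)}-\frac{1}{X(x)}\right)\left(\frac{dx^2}{X(x)}\pm\frac{dy^2}{Y(y)}\right),$$ where $X$ is a function of $x$ only, $Y$ is a function of $y$ only, and the sign $\pm$ is the same in both formulas. (2) Complex-Liouville case: $$g=2\,\Im(h)\,dx\,dy,$$ $$\bar g=-\left(\frac{\Im(h)}{\Im(h)^2+\Re(h)^2}\right)^2dx^2+2\,\frac{\Re(h)\,\Im(h)}{(\Im(h)^2+\Re(h)^2)^2}\,dx\,dy+\left(\frac{\Im(h)}{\Im(h)^2+\Re(h)^2}\right)^2dy^2,$$ where $h=\Re(h)+i\cdot\Im(h)$ is a holomorphic function of the variable $z=x+i\cdot y$. (3) Jordan-block case: $$g=(1+xY'(y))\,dx\,dy,\qquad \bar g=\frac{1+xY'(y)}{Y(y)^4}\Bigl(-2Y(y)\,dx\,dy+(1+xY'(y))\,dy^2\Bigr),$$ where $Y$ is a function of $y$ only.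
   Context: A metric $\bar g$ on a surface $M^2$ is called projectively equivalent to a metric $g$ on the same surface if every geodesic of $\bar g$ is a reparametrized geodesic of $g$. Metrics may be Riemannian or pseudo-Riemannian, and they are written as quadratic forms $ds^2$ in the local coordinates $(x,y)$. $\Re$ and $\Im$ denote real and imaginary parts.
   Formalization: In the Liouville case with sign "-" and in the Jordan-block case, ḡ has the stated form only up to an overall factor ±1 (literally false otherwise: g=dx²-dy², ḡ=-dx²/4+dy²/2); "almost every point" means every point of an open dense subset. *)

theory Defs
  imports "HOL-Analysis.Analysis"
begin

section \<open>Smooth functions\<close>

text \<open>All objects are of class \<open>C\<^sup>\<infinity>\<close>. The sets \<open>S\<close> below are always open; the
  derivatives are taken at points of \<open>S\<close>, without restricting to \<open>S\<close>.\<close>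

fun Ck_on :: "nat \<Rightarrow> 'a::real_normed_vector set \<Rightarrow> ('a \<Rightarrow> 'b::real_normed_vector) \<Rightarrow> bool" where
  "Ck_on 0 S f \<longleftrightarrow> continuous_on S f"
| "Ck_on (Suc k) S f \<longleftrightarrow>
     (\<forall>x\<in>S. f differentiable (at x)) \<and> (\<forall>v. Ck_on k S (\<lambda>x. frechet_derivative f (at x) v))"

definition smooth_on :: "'a::real_normed_vector set \<Rightarrow> ('a \<Rightarrow> 'b::real_normed_vector) \<Rightarrow> bool" where
  "smooth_on S f \<longleftrightarrow> (\<forall>k. Ck_on k S f)"


section \<open>Surfaces\<close>

text \<open>A chart is a pair of its domain and its coordinate map; the values of the coordinate map
  outside the domain are irrelevant. The coordinates are \<open>x = u $ 1\<close> and \<open>y = u $ 2\<close>.\<close>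

type_synonym 'a chart = "'a set \<times> ('a \<Rightarrow> real ^ 2)"

definition chart_dom :: "'a chart \<Rightarrow> 'a set" where
  "chart_dom c = fst c"

definition coords :: "'a chart \<Rightarrow> 'a \<Rightarrow> real ^ 2" where
  "coords c = snd c"

definition chart_img :: "'a chart \<Rightarrow> (real ^ 2) set" where
  "chart_img c = coords c ` chart_dom c"

definition chart_inv :: "'a chart \<Rightarrow> real ^ 2 \<Rightarrow> 'a" where
  "chart_inv c = inv_into (chart_dom c) (coords c)"

definition topological_chart :: "'a::topological_space chart \<Rightarrow> bool" where
  "topological_chart c \<longleftrightarrow> open (chart_dom c) \<and> open (chart_img c) \<and>
     homeomorphism (chart_dom c) (chart_img c) (coords c) (chart_inv c)"

definition transition :: "'a chart \<Rightarrow> 'a chart \<Rightarrow> real ^ 2 \<Rightarrow> real ^ 2" where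
  "transition c c' = coords c' \<circ> chart_inv c"

definition smoothly_compatible :: "'a chart \<Rightarrow> 'a chart \<Rightarrow> bool" where
  "smoothly_compatible c c' \<longleftrightarrow>
     smooth_on (coords c ` (chart_dom c \<inter> chart_dom c')) (transition c c') \<and>
     smooth_on (coords c' ` (chart_dom c \<inter> chart_dom c')) (transition c' c)"

text \<open>\<open>A\<close> is a maximal smooth atlas of the connected surface \<open>M\<close>, so that the members of \<open>A\<close>
  are exactly the smooth local coordinate systems on \<open>M\<close>.\<close>

definition smooth_surface :: "'a::{t2_space, second_countable_topology} set \<Rightarrow> 'a chart set \<Rightarrow> bool" where
  "smooth_surface M A \<longleftrightarrow>
     connected M \<and>
     (\<Union>c\<in>A. chart_dom c) = M \<and>
     (\<forall>c\<in>A. topological_chart c) \<and>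
     (\<forall>c\<in>A. \<forall>c'\<in>A. smoothly_compatible c c') \<and>
     (\<forall>c. topological_chart c \<and> chart_dom c \<subseteq> M \<and> (\<forall>c'\<in>A. smoothly_compatible c c') \<longrightarrow> c \<in> A)"


section \<open>Metrics and geodesics\<close>

text \<open>A (Riemannian or pseudo-Riemannian) metric is given by its Gram matrices: \<open>g c u\<close> is the
  matrix of the metric in the chart \<open>c\<close> at the point with coordinates \<open>u\<close>.\<close>

definition surface_metric :: "'a chart set \<Rightarrow> ('a chart \<Rightarrow> real ^ 2 \<Rightarrow> real ^ 2 ^ 2) \<Rightarrow> bool" where
  "surface_metric A g \<longleftrightarrow>
     (\<forall>c\<in>A. smooth_on (chart_img c) (g c) \<and>
        (\<forall>u\<in>chart_img c. transpose (g c u) = g c u \<and> det (g c u) \<noteq> 0)) \<and>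
     (\<forall>c\<in>A. \<forall>c'\<in>A. \<forall>p \<in> chart_dom c \<inter> chart_dom c'.
        (let J = jacobian (transition c c') (at (coords c p))
         in g c (coords c p) = transpose J ** g c' (coords c' p) ** J))"

definition partial_deriv :: "2 \<Rightarrow> (real ^ 2 \<Rightarrow> real) \<Rightarrow> real ^ 2 \<Rightarrow> real" where
  "partial_deriv i f u = frechet_derivative f (at u) (axis i 1)"

definition christoffel :: "(real ^ 2 \<Rightarrow> real ^ 2 ^ 2) \<Rightarrow> real ^ 2 \<Rightarrow> 2 \<Rightarrow> 2 \<Rightarrow> 2 \<Rightarrow> real" where
  "christoffel G u k i j =
     (1/2) * (\<Sum>l\<in>UNIV. matrix_inv (G u) $ k $ l *
       (partial_deriv i (\<lambda>w. G w $ j $ l) u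
        + partial_deriv j (\<lambda>w. G w $ i $ l) u
        - partial_deriv l (\<lambda>w. G w $ i $ j) u))"

definition velocity :: "(real \<Rightarrow> real ^ 2) \<Rightarrow> real \<Rightarrow> real ^ 2" where
  "velocity x t = vector_derivative x (at t)"

text \<open>Affinely parametrized geodesics, defined on an open interval \<open>I\<close>. Light-like geodesics are
  included.\<close>

definition geodesic :: "'a::topological_space chart set \<Rightarrow> ('a chart \<Rightarrow> real ^ 2 \<Rightarrow> real ^ 2 ^ 2) \<Rightarrow>
    real set \<Rightarrow> (real \<Rightarrow> 'a) \<Rightarrow> bool" where
  "geodesic A g I \<gamma> \<longleftrightarrow>
     open I \<and> is_interval I \<and> continuous_on I \<gamma> \<and> \<gamma> ` I \<subseteq> (\<Union>c\<in>A. chart_dom c) \<and>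
     (\<forall>c\<in>A. let T = {t \<in> I. \<gamma> t \<in> chart_dom c}; x = coords c \<circ> \<gamma> in
        smooth_on T x \<and>
        (\<forall>t\<in>T. \<forall>k. velocity (velocity x) t $ k +
           (\<Sum>i\<in>UNIV. \<Sum>j\<in>UNIV.
              christoffel (g c) (x t) k i j * velocity x t $ i * velocity x t $ j) = 0))"

text \<open>\<open>gbar\<close> is projectively equivalent to \<open>g\<close>: every geodesic of \<open>gbar\<close> is a reparametrized
  geodesic of \<open>g\<close>.\<close>

definition projectively_equivalent :: "'a::topological_space chart set \<Rightarrow>
    ('a chart \<Rightarrow> real ^ 2 \<Rightarrow> real ^ 2 ^ 2) \<Rightarrow> ('a chart \<Rightarrow> real ^ 2 \<Rightarrow> real ^ 2 ^ 2) \<Rightarrow> bool" where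
  "projectively_equivalent A g gbar \<longleftrightarrow>
     (\<forall>I \<gamma>. geodesic A gbar I \<gamma> \<longrightarrow>
        (\<exists>J \<tau>. open J \<and> is_interval J \<and> smooth_on J \<tau> \<and> (\<forall>t\<in>J. deriv \<tau> t \<noteq> 0) \<and> \<tau> ` J = I \<and>
           geodesic A g J (\<gamma> \<circ> \<tau>)))"


section \<open>The normal forms\<close>

definition ds2 :: "real ^ 2 ^ 2 \<Rightarrow> real \<Rightarrow> real \<Rightarrow> real" where
  "ds2 G dx dy = (let v = vector [dx, dy] in v \<bullet> (G *v v))"

text \<open>In the following, \<open>D\<close> is the open set of coordinate values of a chart, and \<open>G\<close>, \<open>Gbar\<close> are the
  Gram matrices of two metrics in this chart. Since metrics are nondegenerate, none of the
  denominators below can vanish at a point of \<open>D\<close>.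

  The parameter \<open>s\<close> stands for the sign \<open>\<plusminus>\<close>.

  Pitfall: multiplying \<open>gbar\<close> by \<open>-1\<close> preserves projective equivalence. The Liouville form with
  \<open>s = 1\<close> and the complex-Liouville form are invariant under this up to a change of coordinates
  (and of \<open>X\<close>, \<open>Y\<close>, \<open>h\<close>), but the Liouville form with \<open>s = -1\<close> and the Jordan-block form are not.
  For instance, \<open>g = dx\<^sup>2 - dy\<^sup>2\<close> and \<open>gbar = - dx\<^sup>2 / 4 + dy\<^sup>2 / 2\<close> have the same geodesics, the straight
  lines, but only \<open>- gbar\<close> can be brought into one of the forms together with \<open>g\<close> (take \<open>X = 2\<close>,
  \<open>Y = 1\<close>, \<open>s = -1\<close>). In these two cases \<open>gbar\<close> is therefore determined only up to sign.\<close>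

definition liouville_form ::
    "real \<Rightarrow> (real ^ 2) set \<Rightarrow> (real ^ 2 \<Rightarrow> real ^ 2 ^ 2) \<Rightarrow> (real ^ 2 \<Rightarrow> real ^ 2 ^ 2) \<Rightarrow> bool" where
  "liouville_form s D G Gbar \<longleftrightarrow>
     (\<exists>(X :: real \<Rightarrow> real) (Y :: real \<Rightarrow> real).
        smooth_on ((\<lambda>u. u $ 1) ` D) X \<and> smooth_on ((\<lambda>u. u $ 2) ` D) Y \<and>
        (\<forall>u\<in>D. \<forall>dx dy. let x = u $ 1; y = u $ 2 in
           ds2 (G u) dx dy = (X x - Y y) * (dx\<^sup>2 + s * dy\<^sup>2) \<and>
           ds2 (Gbar u) dx dy = (1 / Y y - 1 / X x) * (dx\<^sup>2 / X x + s * (dy\<^sup>2 / Y y))))"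

definition complex_liouville_form ::
    "(real ^ 2) set \<Rightarrow> (real ^ 2 \<Rightarrow> real ^ 2 ^ 2) \<Rightarrow> (real ^ 2 \<Rightarrow> real ^ 2 ^ 2) \<Rightarrow> bool" where
  "complex_liouville_form D G Gbar \<longleftrightarrow>
     (\<exists>h :: complex \<Rightarrow> complex.
        h holomorphic_on (\<lambda>u. Complex (u $ 1) (u $ 2)) ` D \<and>
        (\<forall>u\<in>D. \<forall>dx dy. let z = Complex (u $ 1) (u $ 2) in
           ds2 (G u) dx dy = 2 * Im (h z) * dx * dy \<and>
           ds2 (Gbar u) dx dy =
             - ((Im (h z) / ((Im (h z))\<^sup>2 + (Re (h z))\<^sup>2))\<^sup>2 * dx\<^sup>2)
             + 2 * (Re (h z) * Im (h z) / ((Im (h z))\<^sup>2 + (Re (h z))\<^sup>2)\<^sup>2) * dx * dy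
             + (Im (h z) / ((Im (h z))\<^sup>2 + (Re (h z))\<^sup>2))\<^sup>2 * dy\<^sup>2))"

definition jordan_block_form ::
    "(real ^ 2) set \<Rightarrow> (real ^ 2 \<Rightarrow> real ^ 2 ^ 2) \<Rightarrow> (real ^ 2 \<Rightarrow> real ^ 2 ^ 2) \<Rightarrow> bool" where
  "jordan_block_form D G Gbar \<longleftrightarrow>
     (\<exists>Y :: real \<Rightarrow> real.
        smooth_on ((\<lambda>u. u $ 2) ` D) Y \<and>
        (\<forall>u\<in>D. \<forall>dx dy. let x = u $ 1; y = u $ 2 in
           ds2 (G u) dx dy = (1 + x * deriv Y y) * dx * dy \<and>
           ds2 (Gbar u) dx dy =
             (1 + x * deriv Y y) / Y y ^ 4 *
               (- 2 * Y y * dx * dy + (1 + x * deriv Y y) * dy\<^sup>2)))"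

end

theory Submission
  imports Defs
begin

text \<open>Evaluating the geodesic equations at all initial velocities shows that the quadratic
  maps \<open>\<Gamma>bar(v, v) - \<Gamma>(v, v)\<close> are multiples of \<open>v\<close>; hence \<open>a = c\<^sup>-\<^sup>2 gbar\<close> with
  \<open>c\<^sup>3 = det gbar / det g\<close> is a Killing tensor of \<open>g\<close>, and \<open>gbar = a / \<delta>\<^sup>2\<close> with
  \<open>\<delta> = det a / det g\<close>. The discriminant of the characteristic polynomial of \<open>g\<^sup>-\<^sup>1 a\<close> decides
  which normal form occurs. In each case a coframe is extracted from \<open>g\<close> and \<open>a\<close> by taking square
  roots of quadratic forms of rank one (such as \<open>X g - a\<close> for an eigenvalue \<open>X\<close>), and the Killing
  equation, read in the dual frame, says that its members are closed (after a correction by the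
  differential of the eigenvalue in the Jordan-block case); their primitives are the coordinates.
  The remaining points, where \<open>a\<close> is a multiple of \<open>g\<close>, have no interior: otherwise the multiple
  would be constant, and the Killing tensor \<open>a - k g\<close> would vanish on an open set and hence, its
  equation being of finite type, on all of the connected surface.\<close>

section \<open>Calculus of smooth functions\<close>

text \<open>The exponents come from traces. If \<open>gbar\<close> and \<open>g\<close> share
  geodesics, their sprays differ by \<open>2 \<phi>(v) v\<close>, and contracting the difference of
  Christoffel symbols gives \<open>3 \<phi>\<close>. The trace of the Christoffel symbols is half of
  d log |det|, so \<open>c ^ 3 = det gbar / det g\<close> means \<open>dc = 2 c \<phi>\<close>.
  Along geodesics of \<open>g\<close> both \<open>gbar(v, v)\<close> and \<open>c ^ 2\<close> then
  grow at the rate \<open>4 \<phi>(v)\<close>, and their quotient is conserved; moreover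
  \<open>\<delta> = 1 / c\<close>, which gives \<open>gbar\<close> back from \<open>a\<close>.
  Passing to \<open>- gbar\<close> leaves the determinants alone and turns \<open>a\<close> into
  \<open>- a\<close>. A rank one form has a real square root for one of its two signs only; this is
  where the sign \<open>\<epsilon>\<close> enters. The metrics are merely smooth, so proportionality
  on an open set cannot be continued by analyticity; this forces the prolongation of the Killing
  equation. Eigenvalues and coframes need not be smooth where the discriminant changes from nonzero
  to zero. Such points are left to the closure: in any open set one looks for a single point near
  which the discriminant is positive, negative or identically zero.\<close>

lemma Ck_on_subset: "Ck_on k S f \<Longrightarrow> T \<subseteq> S \<Longrightarrow> Ck_on k T f"
  by (induction k arbitrary: f) (auto intro: continuous_on_subset)

text \<open>Openness of \<open>S\<close> makes the derivatives at points of \<open>S\<close> depend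
  only on the values on \<open>S\<close>, although \<open>Ck_on\<close> differentiates without
  restricting.\<close>

lemma Ck_on_cong:
  assumes "open S" "\<And>x. x \<in> S \<Longrightarrow> f x = g x" "Ck_on k S f"
  shows "Ck_on k S g"
  using assms(2,3)
proof (induction k arbitrary: f g)
  case 0
  then show ?case using continuous_on_cong by auto
next
  case (Suc k)
  have diff: "f differentiable (at x)" if "x \<in> S" for x using Suc.prems that by simp
  have eq: "frechet_derivative f (at x) = frechet_derivative g (at x)" if "x \<in> S" for x
    by (rule frechet_derivative_transform_within_open[OF diff[OF that] \<open>open S\<close> that])
      (use Suc.prems in auto)
  have "g differentiable (at x)" if "x \<in> S" for x
    using diff[OF that] Suc.prems(1) \<open>open S\<close> that
    by (meson differentiable_def has_derivative_transform_within_open)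
  moreover have "Ck_on k S (\<lambda>x. frechet_derivative g (at x) v)" for v
    by (rule Suc.IH[of "\<lambda>x. frechet_derivative f (at x) v"]) (use Suc.prems eq in auto)
  ultimately show ?case by simp
qed

lemma Ck_on_SucI:
  assumes "open S" "\<And>x. x \<in> S \<Longrightarrow> (f has_derivative f' x) (at x)" "\<And>v. Ck_on k S (\<lambda>x. f' x v)"
  shows "Ck_on (Suc k) S f"
proof -
  have "Ck_on k S (\<lambda>x. frechet_derivative f (at x) v)" for v
    by (rule Ck_on_cong[OF assms(1) _ assms(3)[of v]]) (use assms(2) frechet_derivative_at in metis)
  then show ?thesis using assms(2) by (auto simp: differentiable_def)
qed

lemma Ck_on_has_derivative:
  "Ck_on (Suc k) S f \<Longrightarrow> x \<in> S \<Longrightarrow> (f has_derivative frechet_derivative f (at x)) (at x)"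
  using frechet_derivative_works by auto

lemma Ck_on_imp_continuous_on: "Ck_on k S f \<Longrightarrow> continuous_on S f"
proof (cases k)
  case (Suc n)
  assume "Ck_on k S f"
  then have "continuous (at x) f" if "x \<in> S" for x
    using Suc that differentiable_imp_continuous_within by auto
  then show ?thesis using continuous_at_imp_continuous_on by blast
qed simp

lemma Ck_on_SucD: "Ck_on (Suc k) S f \<Longrightarrow> Ck_on k S f"
proof (induction k arbitrary: f)
  case 0
  then show ?case using Ck_on_imp_continuous_on by fastforce
next
  case (Suc k)
  then show ?case by (metis Ck_on.simps(2))
qed

lemma Ck_on_frechet_derivative:
  "Ck_on (Suc k) S f \<Longrightarrow> Ck_on k S (\<lambda>x. frechet_derivative f (at x) v)"
  by simp

lemma Ck_on_const [simp]: "Ck_on k S (\<lambda>x. c)"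
  by (induction k arbitrary: c) auto

lemma Ck_on_bounded_linear:
  assumes "bounded_linear L" "open S" "Ck_on k S f"
  shows "Ck_on k S (\<lambda>x. L (f x))"
  using assms(3)
proof (induction k arbitrary: f)
  case 0
  then show ?case using bounded_linear.continuous_on[OF assms(1)] by auto
next
  case (Suc k)
  show ?case
    by (rule Ck_on_SucI[OF assms(2), of _ "\<lambda>x v. L (frechet_derivative f (at x) v)"])
      (intro bounded_linear.has_derivative[OF assms(1)] Ck_on_has_derivative[OF Suc.prems],
        assumption, intro Suc.IH Ck_on_frechet_derivative[OF Suc.prems])
qed

lemma Ck_on_ident [simp]: "open S \<Longrightarrow> Ck_on k S (\<lambda>x. x)"
  by (cases k) (auto intro: Ck_on_SucI[where f'="\<lambda>_ v. v"] simp del: Ck_on.simps(2))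

lemma Ck_on_add:
  assumes "open S" "Ck_on k S f" "Ck_on k S g"
  shows "Ck_on k S (\<lambda>x. f x + g x)"
  using assms(2,3)
proof (induction k arbitrary: f g)
  case 0
  then show ?case by (auto intro: continuous_intros)
next
  case (Suc k)
  show ?case
    by (rule Ck_on_SucI[OF assms(1), of _
          "\<lambda>x v. frechet_derivative f (at x) v + frechet_derivative g (at x) v"])
      (intro has_derivative_add Ck_on_has_derivative[OF Suc.prems(1)] Ck_on_has_derivative[OF Suc.prems(2)],
        assumption+, intro Suc.IH Ck_on_frechet_derivative[OF Suc.prems(1)] Ck_on_frechet_derivative[OF Suc.prems(2)])
qed

lemma Ck_on_sum:
  assumes "open S" "\<And>i. i \<in> I \<Longrightarrow> Ck_on k S (f i)"
  shows "Ck_on k S (\<lambda>x. \<Sum>i\<in>I. f i x)"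
  using assms(2) by (induction I rule: infinite_finite_induct) (simp_all add: Ck_on_add[OF assms(1)])

text \<open>In the product rule one factor stays undifferentiated; it has one order to spare, which
  \<open>Ck_on_SucD\<close> gives up so that the induction hypothesis fits.\<close>

lemma Ck_on_bilinear:
  assumes B: "bounded_bilinear B" and "open S" "Ck_on k S f" "Ck_on k S g"
  shows "Ck_on k S (\<lambda>x. B (f x) (g x))"
  using assms(3,4)
proof (induction k arbitrary: f g)
  case 0
  then show ?case by (auto intro: bounded_bilinear.continuous_on[OF B])
next
  case (Suc k)
  show ?case
  proof (rule Ck_on_SucI[OF assms(2), of _
        "\<lambda>x v. B (f x) (frechet_derivative g (at x) v) + B (frechet_derivative f (at x) v) (g x)"])
    show "((\<lambda>x. B (f x) (g x)) has_derivative
        (\<lambda>v. B (f x) (frechet_derivative g (at x) v) + B (frechet_derivative f (at x) v) (g x))) (at x)"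
      if "x \<in> S" for x
      by (rule bounded_bilinear.FDERIV[OF B]) (rule Ck_on_has_derivative[OF _ that], fact)+
    show "Ck_on k S (\<lambda>x. B (f x) (frechet_derivative g (at x) v) + B (frechet_derivative f (at x) v) (g x))" for v
      by (intro Ck_on_add[OF assms(2)] Suc.IH Ck_on_frechet_derivative Ck_on_SucD[OF Suc.prems(1)]
          Ck_on_SucD[OF Suc.prems(2)] Suc.prems)
  qed
qed

lemma Ck_on_inverse:
  fixes f :: "'a::real_normed_vector \<Rightarrow> 'b::real_normed_field"
  assumes "open S" "\<And>x. x \<in> S \<Longrightarrow> f x \<noteq> 0" "Ck_on k S f"
  shows "Ck_on k S (\<lambda>x. inverse (f x))"
  using assms(3)
proof (induction k)
  case 0
  then show ?case using assms(2) by (auto intro: continuous_intros)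
next
  case (Suc k)
  have IH: "Ck_on k S (\<lambda>x. inverse (f x))" using Suc Ck_on_SucD by blast
  show ?case
  proof (rule Ck_on_SucI[OF assms(1)])
    show "((\<lambda>x. inverse (f x)) has_derivative
        (\<lambda>v. - (inverse (f x) * frechet_derivative f (at x) v * inverse (f x)))) (at x)" if "x \<in> S" for x
      by (rule Deriv.has_derivative_inverse[OF assms(2)[OF that] Ck_on_has_derivative[OF Suc.prems that]])
    show "Ck_on k S (\<lambda>x. - (inverse (f x) * frechet_derivative f (at x) v * inverse (f x)))" for v
      by (intro Ck_on_bounded_linear[OF bounded_linear_minus[OF bounded_linear_ident] assms(1)]
          Ck_on_bilinear[OF bounded_bilinear_mult assms(1)] IH Ck_on_frechet_derivative[OF Suc.prems])
  qed
qed

lemma linear_expand_Basis: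
  fixes f :: "'a::euclidean_space \<Rightarrow> 'b::real_vector"
  assumes "linear f"
  shows "f w = (\<Sum>b\<in>Basis. (w \<bullet> b) *\<^sub>R f b)"
proof -
  have "f w = f (\<Sum>b\<in>Basis. (w \<bullet> b) *\<^sub>R b)" unfolding euclidean_representation ..
  also have "\<dots> = (\<Sum>b\<in>Basis. (w \<bullet> b) *\<^sub>R f b)"
    unfolding linear_sum[OF assms] linear_scale[OF assms] ..
  finally show ?thesis .
qed

text \<open>In the chain rule the derivative of \<open>f\<close> is taken at a moving point and
  applied to a moving vector. Expanding the vector in a basis turns this into a sum of products, and
  the induction hypothesis applies to each map \<open>frechet_derivative f (at y) b\<close>. This is
  the reason for the Euclidean type of the intermediate space.\<close>

lemma Ck_on_compose:
  fixes f :: "'b::euclidean_space \<Rightarrow> 'c::real_normed_vector"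
  assumes "open S" "Ck_on k S g" "Ck_on k T f" "g ` S \<subseteq> T"
  shows "Ck_on k S (\<lambda>x. f (g x))"
  using assms(2,3)
proof (induction k arbitrary: f)
  case 0
  then show ?case using assms(4) by (auto intro: continuous_on_compose2)
next
  case (Suc k)
  let ?D = "\<lambda>x v. \<Sum>b\<in>Basis. (frechet_derivative g (at x) v \<bullet> b) *\<^sub>R frechet_derivative f (at (g x)) b"
  show ?case
  proof (rule Ck_on_SucI[OF assms(1), of _ ?D])
    fix x assume x: "x \<in> S"
    have f: "(f has_derivative frechet_derivative f (at (g x))) (at (g x))"
      using Ck_on_has_derivative[OF Suc.prems(2)] x assms(4) by auto
    have lin: "linear (frechet_derivative f (at (g x)))"
      using f has_derivative_linear by blast
    show "((\<lambda>x. f (g x)) has_derivative ?D x) (at x)"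
      by (rule has_derivative_eq_rhs[OF has_derivative_compose[OF Ck_on_has_derivative[OF Suc.prems(1) x] f]])
        (rule ext, rule linear_expand_Basis[OF lin])
  next
    fix v
    show "Ck_on k S (\<lambda>x. ?D x v)"
    proof (intro Ck_on_sum[OF assms(1)] Ck_on_bilinear[OF bounded_bilinear_scaleR assms(1)])
      fix b :: 'b
      show "Ck_on k S (\<lambda>x. frechet_derivative g (at x) v \<bullet> b)"
        by (intro Ck_on_bounded_linear[OF bounded_linear_inner_left assms(1)]
            Ck_on_frechet_derivative[OF Suc.prems(1)])
      show "Ck_on k S (\<lambda>x. frechet_derivative f (at (g x)) b)"
        by (intro Suc.IH Ck_on_SucD[OF Suc.prems(1)] Ck_on_frechet_derivative[OF Suc.prems(2)])
    qed
  qed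
qed

lemma Ck_on_sqrt:
  assumes "open S" "\<And>x. x \<in> S \<Longrightarrow> 0 < f x" "Ck_on k S f"
  shows "Ck_on k S (\<lambda>x. sqrt (f x))"
  using assms(3)
proof (induction k)
  case 0
  then show ?case by (auto intro: continuous_intros)
next
  case (Suc k)
  have IH: "Ck_on k S (\<lambda>x. inverse (sqrt (f x)))"
    using assms(2) by (intro Ck_on_inverse[OF assms(1)] Suc.IH Ck_on_SucD[OF Suc.prems]) force
  show ?case
  proof (rule Ck_on_SucI[OF assms(1)])
    show "((\<lambda>x. sqrt (f x)) has_derivative
        (\<lambda>v. frechet_derivative f (at x) v * (inverse (sqrt (f x)) * (1/2)))) (at x)" if "x \<in> S" for x
      using has_derivative_real_sqrt[OF assms(2)[OF that] Ck_on_has_derivative[OF Suc.prems that]] by simp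
    show "Ck_on k S (\<lambda>x. frechet_derivative f (at x) v * (inverse (sqrt (f x)) * (1/2)))" for v
      by (intro Ck_on_bilinear[OF bounded_bilinear_mult assms(1)] IH Ck_on_const
          Ck_on_frechet_derivative[OF Suc.prems])
  qed
qed

text \<open>The odd root is smooth on both sides of zero. This matters because the quotient of the
  two determinants is negative when the signatures differ in type.\<close>

lemma Ck_on_root3:
  assumes "open S" "\<And>x. x \<in> S \<Longrightarrow> f x \<noteq> 0" "Ck_on k S f"
  shows "Ck_on k S (\<lambda>x. root 3 (f x))"
  using assms(3)
proof (induction k)
  case 0
  then show ?case by (auto intro: continuous_intros)
next
  case (Suc k)
  have IH: "Ck_on k S (\<lambda>x. inverse (root 3 (f x)))"
    using assms(2) by (intro Ck_on_inverse[OF assms(1)] Suc.IH Ck_on_SucD[OF Suc.prems]) auto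
  show ?case
  proof (rule Ck_on_SucI[OF assms(1)])
    show "((\<lambda>x. root 3 (f x)) has_derivative
        (\<lambda>v. frechet_derivative f (at x) v * (inverse (root 3 (f x)) * inverse (root 3 (f x)) * (1/3)))) (at x)"
      if "x \<in> S" for x
    proof -
      have "DERIV (root 3) (f x) :> inverse (real 3 * root 3 (f x) ^ (3 - Suc 0))"
        by (rule DERIV_odd_real_root) (use assms(2)[OF that] in auto)
      then have "DERIV (root 3) (f x) :> inverse (root 3 (f x)) * inverse (root 3 (f x)) * (1/3)"
        by (simp add: field_simps power2_eq_square)
      from has_derivative_compose[OF Ck_on_has_derivative[OF Suc.prems that]
          this[unfolded has_field_derivative_def]]
      show ?thesis by (simp add: mult_ac)
    qed
    show "Ck_on k S (\<lambda>x. frechet_derivative f (at x) v * (inverse (root 3 (f x)) * inverse (root 3 (f x)) * (1/3)))" for v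
      by (intro Ck_on_bilinear[OF bounded_bilinear_mult assms(1)] IH Ck_on_const
          Ck_on_frechet_derivative[OF Suc.prems])
  qed
qed

lemma bounded_linear_axis: "bounded_linear (axis i :: 'b::euclidean_space \<Rightarrow> 'b ^ 'n)"
  unfolding linear_conv_bounded_linear[symmetric]
  by (auto simp: linear_iff vec_eq_iff axis_def)

lemma Ck_on_vec:
  fixes f :: "'a::real_normed_vector \<Rightarrow> 'b::euclidean_space ^ 'n"
  assumes "open S" "\<And>i. Ck_on k S (\<lambda>x. f x $ i)"
  shows "Ck_on k S f"
proof (rule Ck_on_cong[OF assms(1)])
  show "Ck_on k S (\<lambda>x. \<Sum>i\<in>UNIV. axis i (f x $ i))"
    by (intro Ck_on_sum Ck_on_bounded_linear[OF bounded_linear_axis] assms)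
  show "(\<Sum>i\<in>UNIV. axis i (f x $ i)) = f x" for x
    by (simp add: vec_eq_iff axis_def)
qed

section \<open>Smooth functions: the preceding rules for all orders at once\<close>

lemma smooth_on_subset: "smooth_on S f \<Longrightarrow> T \<subseteq> S \<Longrightarrow> smooth_on T f"
  unfolding smooth_on_def using Ck_on_subset by blast

lemma smooth_on_cong: "smooth_on S f \<Longrightarrow> open S \<Longrightarrow> (\<And>x. x \<in> S \<Longrightarrow> f x = g x) \<Longrightarrow> smooth_on S g"
  unfolding smooth_on_def using Ck_on_cong by blast

lemma smooth_on_imp_continuous_on: "smooth_on S f \<Longrightarrow> continuous_on S f"
  unfolding smooth_on_def using Ck_on_imp_continuous_on by blast

lemma smooth_on_has_derivative:
  "smooth_on S f \<Longrightarrow> x \<in> S \<Longrightarrow> (f has_derivative frechet_derivative f (at x)) (at x)"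
  unfolding smooth_on_def using Ck_on_has_derivative by blast

lemma smooth_on_differentiable: "smooth_on S f \<Longrightarrow> x \<in> S \<Longrightarrow> f differentiable (at x)"
  using smooth_on_has_derivative differentiableI by blast

lemma smooth_on_frechet_derivative:
  "smooth_on S f \<Longrightarrow> smooth_on S (\<lambda>x. frechet_derivative f (at x) v)"
  unfolding smooth_on_def by (metis Ck_on.simps(2))

lemma smooth_onI:
  assumes "open S" "\<And>x. x \<in> S \<Longrightarrow> (f has_derivative f' x) (at x)" "\<And>v. smooth_on S (\<lambda>x. f' x v)"
  shows "smooth_on S f"
proof -
  have "Ck_on (Suc k) S f" for k
    by (rule Ck_on_SucI[OF assms(1,2)]) (use assms(3) in \<open>auto simp: smooth_on_def\<close>)
  then show ?thesis unfolding smooth_on_def using Ck_on_SucD by blast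
qed

lemma smooth_on_const [simp]: "smooth_on S (\<lambda>x. c)"
  by (simp add: smooth_on_def)

lemma smooth_on_ident [simp]: "open S \<Longrightarrow> smooth_on S (\<lambda>x. x)"
  by (simp add: smooth_on_def)

lemma smooth_on_bounded_linear:
  "bounded_linear L \<Longrightarrow> open S \<Longrightarrow> smooth_on S f \<Longrightarrow> smooth_on S (\<lambda>x. L (f x))"
  by (simp add: smooth_on_def Ck_on_bounded_linear)

lemma smooth_on_bilinear:
  "bounded_bilinear B \<Longrightarrow> open S \<Longrightarrow> smooth_on S f \<Longrightarrow> smooth_on S g \<Longrightarrow> smooth_on S (\<lambda>x. B (f x) (g x))"
  by (simp add: smooth_on_def Ck_on_bilinear)

lemma smooth_on_add:
  "open S \<Longrightarrow> smooth_on S f \<Longrightarrow> smooth_on S g \<Longrightarrow> smooth_on S (\<lambda>x. f x + g x)"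
  by (simp add: smooth_on_def Ck_on_add)

lemma smooth_on_sum:
  "open S \<Longrightarrow> (\<And>i. i \<in> I \<Longrightarrow> smooth_on S (f i)) \<Longrightarrow> smooth_on S (\<lambda>x. \<Sum>i\<in>I. f i x)"
  by (simp add: smooth_on_def Ck_on_sum)

lemma smooth_on_uminus: "open S \<Longrightarrow> smooth_on S f \<Longrightarrow> smooth_on S (\<lambda>x. - f x)"
  by (rule smooth_on_bounded_linear[OF bounded_linear_minus[OF bounded_linear_ident]])

lemma smooth_on_diff:
  "open S \<Longrightarrow> smooth_on S f \<Longrightarrow> smooth_on S g \<Longrightarrow> smooth_on S (\<lambda>x. f x - g x)"
  using smooth_on_add[of S f "\<lambda>x. - g x"] smooth_on_uminus[of S g] by simp

lemmas smooth_on_scaleR = smooth_on_bilinear[OF bounded_bilinear_scaleR]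

lemma smooth_on_mult:
  fixes f :: "'a::real_normed_vector \<Rightarrow> 'b::real_normed_algebra"
  shows "open S \<Longrightarrow> smooth_on S f \<Longrightarrow> smooth_on S g \<Longrightarrow> smooth_on S (\<lambda>x. f x * g x)"
  using smooth_on_bilinear[OF bounded_bilinear_mult] .

lemma smooth_on_power:
  fixes f :: "'a::real_normed_vector \<Rightarrow> 'b::{real_normed_algebra_1}"
  shows "open S \<Longrightarrow> smooth_on S f \<Longrightarrow> smooth_on S (\<lambda>x. f x ^ n)"
  by (induction n) (simp_all add: smooth_on_mult)

lemma smooth_on_inverse:
  fixes f :: "'a::real_normed_vector \<Rightarrow> 'b::real_normed_field"
  shows "open S \<Longrightarrow> smooth_on S f \<Longrightarrow> (\<And>x. x \<in> S \<Longrightarrow> f x \<noteq> 0) \<Longrightarrow> smooth_on S (\<lambda>x. inverse (f x))"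
  by (simp add: smooth_on_def Ck_on_inverse)

lemma smooth_on_divide:
  fixes f :: "'a::real_normed_vector \<Rightarrow> 'b::real_normed_field"
  shows "open S \<Longrightarrow> smooth_on S f \<Longrightarrow> smooth_on S g \<Longrightarrow> (\<And>x. x \<in> S \<Longrightarrow> g x \<noteq> 0) \<Longrightarrow> smooth_on S (\<lambda>x. f x / g x)"
  unfolding divide_inverse by (intro smooth_on_mult smooth_on_inverse)

lemma smooth_on_sqrt:
  "open S \<Longrightarrow> smooth_on S f \<Longrightarrow> (\<And>x. x \<in> S \<Longrightarrow> 0 < f x) \<Longrightarrow> smooth_on S (\<lambda>x. sqrt (f x))"
  by (simp add: smooth_on_def Ck_on_sqrt)

lemma smooth_on_root3:
  "open S \<Longrightarrow> smooth_on S f \<Longrightarrow> (\<And>x. x \<in> S \<Longrightarrow> f x \<noteq> 0) \<Longrightarrow> smooth_on S (\<lambda>x. root 3 (f x))"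
  by (simp add: smooth_on_def Ck_on_root3)

lemma smooth_on_compose:
  fixes f :: "'b::euclidean_space \<Rightarrow> 'c::real_normed_vector"
  shows "open S \<Longrightarrow> smooth_on S g \<Longrightarrow> smooth_on T f \<Longrightarrow> g ` S \<subseteq> T \<Longrightarrow> smooth_on S (\<lambda>x. f (g x))"
  using Ck_on_compose[of S _ g T f] by (simp add: smooth_on_def)

lemma smooth_on_vec:
  fixes f :: "'a::real_normed_vector \<Rightarrow> 'b::euclidean_space ^ 'n"
  shows "open S \<Longrightarrow> (\<And>i. smooth_on S (\<lambda>x. f x $ i)) \<Longrightarrow> smooth_on S f"
  by (simp add: smooth_on_def Ck_on_vec)

lemma smooth_on_vec_nth:
  fixes f :: "'a::real_normed_vector \<Rightarrow> 'b::real_normed_vector ^ 'n"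
  shows "open S \<Longrightarrow> smooth_on S f \<Longrightarrow> smooth_on S (\<lambda>x. f x $ i)"
  by (rule smooth_on_bounded_linear[OF bounded_linear_vec_nth])

lemma smooth_on_inner:
  "open S \<Longrightarrow> smooth_on S f \<Longrightarrow> smooth_on S g \<Longrightarrow> smooth_on S (\<lambda>x. f x \<bullet> g x)"
  by (rule smooth_on_bilinear[OF bounded_bilinear_inner])

lemmas smooth_intros = smooth_on_const smooth_on_ident smooth_on_add smooth_on_uminus smooth_on_diff
  smooth_on_mult smooth_on_power smooth_on_inverse smooth_on_divide smooth_on_sum smooth_on_scaleR
  smooth_on_vec_nth smooth_on_inner smooth_on_frechet_derivative

text \<open>The mean value theorem is used twice: in \<open>s\<close> on the difference of
  \<open>f\<close> at \<open>t = h\<close> and at \<open>t = 0\<close>, then in \<open>t\<close> on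
  the derivative along \<open>v\<close>. The second difference itself is symmetric in
  \<open>v\<close> and \<open>w\<close>.\<close>

lemma second_difference:
  fixes f :: "'a::real_normed_vector \<Rightarrow> real"
  assumes f: "smooth_on S f" and h: "0 < h"
    and S: "\<And>s t. 0 \<le> s \<Longrightarrow> s \<le> h \<Longrightarrow> 0 \<le> t \<Longrightarrow> t \<le> h \<Longrightarrow> p + s *\<^sub>R v + t *\<^sub>R w \<in> S"
  shows "\<exists>s\<in>{0..h}. \<exists>t\<in>{0..h}. f (p + h *\<^sub>R v + h *\<^sub>R w) - f (p + h *\<^sub>R v) - (f (p + h *\<^sub>R w) - f p)
     = h * (h * frechet_derivative (\<lambda>u. frechet_derivative f (at u) v) (at (p + s *\<^sub>R v + t *\<^sub>R w)) w)"
proof -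
  let ?D = "\<lambda>u. frechet_derivative f (at u) v"
  let ?\<phi> = "\<lambda>s. f (p + s *\<^sub>R v + h *\<^sub>R w) - f (p + s *\<^sub>R v + 0 *\<^sub>R w)"
  have der1: "((\<lambda>s. f (p + s *\<^sub>R v + t *\<^sub>R w)) has_derivative
     (\<lambda>r. r * ?D (p + s *\<^sub>R v + t *\<^sub>R w))) (at s)"
    if "0 \<le> s" "s \<le> h" "0 \<le> t" "t \<le> h" for s t
  proof -
    have d: "(f has_derivative frechet_derivative f (at (p + s *\<^sub>R v + t *\<^sub>R w))) (at (p + s *\<^sub>R v + t *\<^sub>R w))"
      using smooth_on_has_derivative[OF f S[OF that]] .
    have "((\<lambda>s. p + s *\<^sub>R v + t *\<^sub>R w) has_derivative (\<lambda>r. r *\<^sub>R v)) (at s)"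
      by (auto intro!: derivative_eq_intros)
    from has_derivative_compose[OF this d] show ?thesis
      using linear_scale[OF has_derivative_linear[OF d]] by simp
  qed
  have "\<exists>s\<in>{0<..<h}. ?\<phi> h - ?\<phi> 0 = (\<lambda>r. r * ?D (p + s *\<^sub>R v + h *\<^sub>R w) - r * ?D (p + s *\<^sub>R v + 0 *\<^sub>R w)) (h - 0)"
    by (rule mvt_simple[OF h]) (rule has_derivative_at_withinI, rule has_derivative_diff, (rule der1; use h in simp)+)
  then obtain s where s: "0 < s" "s < h"
    and e1: "?\<phi> h - ?\<phi> 0 = h * (?D (p + s *\<^sub>R v + h *\<^sub>R w) - ?D (p + s *\<^sub>R v + 0 *\<^sub>R w))"
    by (auto simp: algebra_simps)
  have der2: "((\<lambda>t. ?D (p + s *\<^sub>R v + t *\<^sub>R w)) has_derivative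
     (\<lambda>r. r * frechet_derivative ?D (at (p + s *\<^sub>R v + t *\<^sub>R w)) w)) (at t)"
    if "0 \<le> t" "t \<le> h" for t
  proof -
    have d: "(?D has_derivative frechet_derivative ?D (at (p + s *\<^sub>R v + t *\<^sub>R w))) (at (p + s *\<^sub>R v + t *\<^sub>R w))"
      by (rule smooth_on_has_derivative[OF smooth_on_frechet_derivative[OF f]]) (use S that s in auto)
    have "((\<lambda>t. p + s *\<^sub>R v + t *\<^sub>R w) has_derivative (\<lambda>r. r *\<^sub>R w)) (at t)"
      by (auto intro!: derivative_eq_intros)
    from has_derivative_compose[OF this d] show ?thesis
      using linear_scale[OF has_derivative_linear[OF d]] by simp
  qed
  have "\<exists>t\<in>{0<..<h}. ?D (p + s *\<^sub>R v + h *\<^sub>R w) - ?D (p + s *\<^sub>R v + 0 *\<^sub>R w)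
      = (\<lambda>r. r * frechet_derivative ?D (at (p + s *\<^sub>R v + t *\<^sub>R w)) w) (h - 0)"
    by (rule mvt_simple[OF h]) (rule has_derivative_at_withinI, rule der2; use h in simp)
  then obtain t where t: "0 < t" "t < h" and "?D (p + s *\<^sub>R v + h *\<^sub>R w) - ?D (p + s *\<^sub>R v + 0 *\<^sub>R w)
      = h * frechet_derivative ?D (at (p + s *\<^sub>R v + t *\<^sub>R w)) w" by auto
  with e1 have "?\<phi> h - ?\<phi> 0 = h * (h * frechet_derivative ?D (at (p + s *\<^sub>R v + t *\<^sub>R w)) w)" by simp
  then show ?thesis using s t by (intro bexI[of _ s] bexI[of _ t]) simp_all
qed

text \<open>The same second difference is expressed through either mixed derivative at some point of
  a small parallelogram; continuity carries the equality to the corner \<open>p\<close>.\<close>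

lemma second_derivative_symmetric_real:
  fixes f :: "'a::real_normed_vector \<Rightarrow> real"
  assumes "open S" and f: "smooth_on S f" and p: "p \<in> S"
  shows "frechet_derivative (\<lambda>u. frechet_derivative f (at u) v) (at p) w =
         frechet_derivative (\<lambda>u. frechet_derivative f (at u) w) (at p) v"
proof -
  let ?A = "\<lambda>u. frechet_derivative (\<lambda>u. frechet_derivative f (at u) v) (at u) w"
  let ?B = "\<lambda>u. frechet_derivative (\<lambda>u. frechet_derivative f (at u) w) (at u) v"
  have cont: "continuous_on S ?A" "continuous_on S ?B"
    by (intro smooth_on_imp_continuous_on smooth_intros f)+
  have "dist (?A p) (?B p) \<le> e" if "0 < e" for e
  proof -
    have "isCont ?A p" "isCont ?B p" using cont p \<open>open S\<close> by (auto simp: continuous_on_eq_continuous_at)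
    then obtain d1 d2 where d: "0 < d1" "\<And>x. dist x p < d1 \<Longrightarrow> dist (?A x) (?A p) < e/2"
        "0 < d2" "\<And>x. dist x p < d2 \<Longrightarrow> dist (?B x) (?B p) < e/2"
      unfolding continuous_at_eps_delta using \<open>0 < e\<close> by (metis half_gt_zero)
    obtain d3 where d3: "0 < d3" "ball p d3 \<subseteq> S" using \<open>open S\<close> p open_contains_ball by blast
    define m where "m = min d1 (min d2 d3)"
    \<comment> \<open>With this step the whole parallelogram stays within \<open>m / 2\<close> of
      \<open>p\<close>; the summand 1 covers the case that \<open>v\<close> and \<open>w\<close> are
      both zero.\<close>
    define h where "h = m / (2 * (norm v + norm w + 1))"
    have m: "0 < m" "m \<le> d1" "m \<le> d2" "m \<le> d3" using d d3 by (auto simp: m_def)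
    have h: "0 < h" using m by (auto simp: h_def divide_pos_pos add_nonneg_pos)
    have close: "dist (p + s *\<^sub>R v + t *\<^sub>R w) p < m" if "0 \<le> s" "s \<le> h" "0 \<le> t" "t \<le> h" for s t
    proof -
      have "norm (s *\<^sub>R v + t *\<^sub>R w) \<le> h * norm v + h * norm w"
        using that by (intro order_trans[OF norm_triangle_ineq] add_mono) (auto intro: mult_right_mono)
      also have "\<dots> \<le> h * (norm v + norm w + 1)" using h by (simp add: algebra_simps)
      also have "h * (norm v + norm w + 1) = m / 2"
        using add_nonneg_pos[of "norm v + norm w" 1] by (simp add: h_def field_simps)
      also have "m / 2 < m" using m by simp
      finally show ?thesis by (simp add: dist_norm add.assoc)
    qed
    have inS: "p + s *\<^sub>R v + t *\<^sub>R w \<in> S" if "0 \<le> s" "s \<le> h" "0 \<le> t" "t \<le> h" for s t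
      using close[OF that] m d3 by (auto simp: dist_commute subset_iff)
    have inS': "p + s *\<^sub>R w + t *\<^sub>R v \<in> S" if "0 \<le> s" "s \<le> h" "0 \<le> t" "t \<le> h" for s t
      using inS[OF that(3,4,1,2)] by (simp add: algebra_simps)
    from second_difference[OF f h inS] obtain s t where st: "s \<in> {0..h}" "t \<in> {0..h}"
      and A: "f (p + h *\<^sub>R v + h *\<^sub>R w) - f (p + h *\<^sub>R v) - (f (p + h *\<^sub>R w) - f p)
         = h * (h * ?A (p + s *\<^sub>R v + t *\<^sub>R w))" by blast
    from second_difference[OF f h inS'] obtain s' t' where st': "s' \<in> {0..h}" "t' \<in> {0..h}"
      and B: "f (p + h *\<^sub>R w + h *\<^sub>R v) - f (p + h *\<^sub>R w) - (f (p + h *\<^sub>R v) - f p)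
         = h * (h * ?B (p + s' *\<^sub>R w + t' *\<^sub>R v))" by blast
    have "p + h *\<^sub>R w + h *\<^sub>R v = p + h *\<^sub>R v + h *\<^sub>R w" by simp
    from B[unfolded this] A have "h * (h * ?A (p + s *\<^sub>R v + t *\<^sub>R w)) = h * (h * ?B (p + s' *\<^sub>R w + t' *\<^sub>R v))"
      by linarith
    then have "?A (p + s *\<^sub>R v + t *\<^sub>R w) = ?B (p + s' *\<^sub>R w + t' *\<^sub>R v)" using h by simp
    moreover have "dist (?A (p + s *\<^sub>R v + t *\<^sub>R w)) (?A p) < e/2"
      by (rule d(2)) (use close[of s t] st m in auto)
    moreover have "dist (?B (p + s' *\<^sub>R w + t' *\<^sub>R v)) (?B p) < e/2"
      by (rule d(4)) (use close[of t' s'] st' m in \<open>auto simp: algebra_simps\<close>)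
    ultimately show ?thesis by (smt (verit) dist_commute dist_triangle field_sum_of_halves)
  qed
  then show ?thesis by (metis dist_eq_0_iff dual_order.refl field_le_epsilon zero_less_dist_iff add.left_neutral not_less)
qed

lemma frechet_derivative_bounded_linear:
  assumes "bounded_linear L" "f differentiable (at x)"
  shows "frechet_derivative (\<lambda>x. L (f x)) (at x) v = L (frechet_derivative f (at x) v)"
  using bounded_linear.has_derivative[OF assms(1)] assms(2) frechet_derivative_at frechet_derivative_works
  by metis

lemma second_derivative_symmetric:
  fixes f :: "'a::real_normed_vector \<Rightarrow> 'b::euclidean_space"
  assumes "open S" and f: "smooth_on S f" and p: "p \<in> S"
  shows "frechet_derivative (\<lambda>u. frechet_derivative f (at u) v) (at p) w =
         frechet_derivative (\<lambda>u. frechet_derivative f (at u) w) (at p) v"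
proof (rule euclidean_eqI)
  fix b :: 'b
  have *: "frechet_derivative (\<lambda>u. frechet_derivative (\<lambda>u. f u \<bullet> b) (at u) v) (at p) w =
     frechet_derivative (\<lambda>u. frechet_derivative f (at u) v) (at p) w \<bullet> b" for v w
  proof -
    have "frechet_derivative (\<lambda>u. frechet_derivative (\<lambda>u. f u \<bullet> b) (at u) v) (at p) =
        frechet_derivative (\<lambda>u. frechet_derivative f (at u) v \<bullet> b) (at p)"
      by (rule frechet_derivative_transform_within_open[OF _ \<open>open S\<close> p])
        (auto intro!: smooth_on_differentiable[OF _ p] smooth_intros smooth_on_differentiable[OF f]
            f \<open>open S\<close> frechet_derivative_bounded_linear[OF bounded_linear_inner_left])
    then have "frechet_derivative (\<lambda>u. frechet_derivative (\<lambda>u. f u \<bullet> b) (at u) v) (at p) w =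
        frechet_derivative (\<lambda>u. frechet_derivative f (at u) v \<bullet> b) (at p) w" by simp
    also have "\<dots> = frechet_derivative (\<lambda>u. frechet_derivative f (at u) v) (at p) w \<bullet> b"
      by (intro frechet_derivative_bounded_linear[OF bounded_linear_inner_left]
          smooth_on_differentiable[OF _ p] smooth_intros f)
    finally show ?thesis .
  qed
  have "smooth_on S (\<lambda>u. f u \<bullet> b)" by (intro smooth_intros f \<open>open S\<close>)
  from second_derivative_symmetric_real[OF \<open>open S\<close> this p]
  show "frechet_derivative (\<lambda>u. frechet_derivative f (at u) v) (at p) w \<bullet> b =
         frechet_derivative (\<lambda>u. frechet_derivative f (at u) w) (at p) v \<bullet> b"
    unfolding * .
qed

section \<open>Ordinary differential equations and the Poincare lemma\<close>

text \<open>The operator norm of the derivative is at most the sum \<open>N\<close> of the norms of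
  its values on the basis, a continuous function on a compact ball.\<close>

lemma smooth_on_imp_lipschitz_cball:
  fixes f :: "'a::euclidean_space \<Rightarrow> 'b::real_normed_vector"
  assumes f: "smooth_on S f" and S: "cball p r \<subseteq> S"
  obtains K where "0 < K"
    "\<And>x y. x \<in> cball p r \<Longrightarrow> y \<in> cball p r \<Longrightarrow> norm (f x - f y) \<le> K * norm (x - y)"
proof -
  define N where "N x = (\<Sum>b\<in>Basis. norm (frechet_derivative f (at x) b))" for x
  have "continuous_on (cball p r) (\<lambda>x. frechet_derivative f (at x) b)" for b
    using smooth_on_imp_continuous_on[OF smooth_on_frechet_derivative[OF f]] S continuous_on_subset by blast
  then have "continuous_on (cball p r) N"
    unfolding N_def by (intro continuous_intros)
  then have "bounded (N ` cball p r)"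
    by (intro compact_imp_bounded compact_continuous_image compact_cball)
  then obtain K where K: "0 < K" "\<And>x. x \<in> cball p r \<Longrightarrow> N x \<le> K"
    unfolding bounded_pos by (auto simp: abs_le_iff)
  have "norm (f x - f y) \<le> K * norm (x - y)" if "x \<in> cball p r" "y \<in> cball p r" for x y
  proof (rule differentiable_bound[OF convex_cball _ _ that])
    fix x assume x: "x \<in> cball p r"
    then have d: "(f has_derivative frechet_derivative f (at x)) (at x)"
      using smooth_on_has_derivative[OF f] S by blast
    then show "(f has_derivative frechet_derivative f (at x)) (at x within cball p r)"
      by (rule has_derivative_at_withinI)
    have lin: "linear (frechet_derivative f (at x))" using d has_derivative_linear by blast
    show "onorm (frechet_derivative f (at x)) \<le> K"
    proof (rule onorm_le)
      fix w
      have "norm (frechet_derivative f (at x) w) = norm (\<Sum>b\<in>Basis. (w \<bullet> b) *\<^sub>R frechet_derivative f (at x) b)"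
        using linear_expand_Basis[OF lin, of w] by (rule arg_cong)
      also have "\<dots> \<le> (\<Sum>b\<in>Basis. norm w * norm (frechet_derivative f (at x) b))"
        by (intro sum_norm_le) (auto intro!: mult_right_mono Basis_le_norm)
      also have "\<dots> = N x * norm w" by (simp add: N_def sum_distrib_left mult.commute)
      also have "\<dots> \<le> K * norm w" using K(2)[OF x] by (intro mult_right_mono) auto
      finally show "norm (frechet_derivative f (at x) w) \<le> K * norm w" .
    qed
  qed
  with K(1) show ?thesis using that by blast
qed

text \<open>Picard's contraction on the bounded continuous curves over the whole line. Composing
  with the nearest-point projection makes the field globally Lipschitz and bounded, and
  \<open>cl\<close> clamps time to the interval; neither change affects the fixed point on
  \<open>{-h<..<h}\<close>, since it stays in the ball.\<close>

lemma ode_solution_exists: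
  fixes f :: "'a::euclidean_space \<Rightarrow> 'a"
  assumes "open S" and z0: "z0 \<in> S" and f: "smooth_on S f"
  obtains h z where "0 < h" "z 0 = z0"
    "\<And>t. t \<in> {-h<..<h} \<Longrightarrow> z t \<in> S"
    "\<And>t. t \<in> {-h<..<h} \<Longrightarrow> (z has_vector_derivative f (z t)) (at t)"
proof -
  obtain r where r: "0 < r" "cball z0 r \<subseteq> S" using \<open>open S\<close> z0 open_contains_cball by blast
  let ?C = "cball z0 r"
  obtain K where K: "0 < K"
    "\<And>x y. x \<in> ?C \<Longrightarrow> y \<in> ?C \<Longrightarrow> norm (f x - f y) \<le> K * norm (x - y)"
    using smooth_on_imp_lipschitz_cball[OF f r(2)] by metis
  define F where "F x = f (closest_point ?C x)" for x
  have C: "convex ?C" "closed ?C" "?C \<noteq> {}" using r by auto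
  have cp: "closest_point ?C x \<in> ?C" for x by (rule closest_point_in_set) (use C in auto)
  have Flip: "norm (F x - F y) \<le> K * norm (x - y)" for x y
  proof -
    have "norm (F x - F y) \<le> K * norm (closest_point ?C x - closest_point ?C y)"
      unfolding F_def by (rule K(2)) (rule cp)+
    also have "\<dots> \<le> K * norm (x - y)"
      using closest_point_lipschitz[OF C, of x y] K(1) by (simp add: dist_norm)
    finally show ?thesis .
  qed
  have contF: "continuous_on UNIV F"
  proof -
    have 1: "continuous_on UNIV (closest_point ?C)" by (rule continuous_on_closest_point) (use C in auto)
    have 2: "continuous_on ?C f" using smooth_on_imp_continuous_on[OF f] r continuous_on_subset by blast
    show ?thesis unfolding F_def by (rule continuous_on_compose2[OF 2 1]) (use cp in auto)
  qed
  have "bounded (f ` ?C)"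
    using smooth_on_imp_continuous_on[OF f] r
    by (intro compact_imp_bounded compact_continuous_image compact_cball) (blast intro: continuous_on_subset)
  then obtain B where B: "0 < B" "\<And>x. x \<in> ?C \<Longrightarrow> norm (f x) \<le> B" unfolding bounded_pos by fastforce
  have FB: "norm (F x) \<le> B" for x unfolding F_def by (rule B(2)[OF cp])
  \<comment> \<open>The iteration uses a difference of two values of \<open>I z\<close>, each with
    Lipschitz bound \<open>2 * h * K\<close> and size at most \<open>2 * h * B\<close>. So
    \<open>4 * h * K \<le> 1/2\<close> gives the contraction and \<open>4 * h * B \<le> r\<close>
    keeps the curve in the ball.\<close>
  define h where "h = min (1 / (8 * K)) (r / (4 * B))"
  have h: "0 < h" "4 * h * K \<le> 1/2" "4 * h * B \<le> r"
    using K(1) B(1) r(1) by (auto simp: h_def min_def field_simps)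
  define cl where "cl t = max (-h) (min h t)" for t :: real
  have cl: "cl t \<in> {-h..h}" for t using h by (auto simp: cl_def)
  have cl_id: "cl t = t" if "t \<in> {-h..h}" for t using that by (auto simp: cl_def)
  have contcl: "continuous_on UNIV cl" unfolding cl_def by (intro continuous_intros)
  \<comment> \<open>Integrating from \<open>- h\<close> avoids reversed limits for negative times;
    subtracting \<open>I z 0\<close> restores the initial condition.\<close>
  define I where "I z t = integral {-h..t} (\<lambda>s. F (apply_bcontfun z s))" for z :: "real \<Rightarrow>\<^sub>C 'a" and t
  have contFz: "continuous_on A (\<lambda>s. F (apply_bcontfun z s))" for z :: "real \<Rightarrow>\<^sub>C 'a" and A
    by (rule continuous_on_compose2[OF contF]) auto
  have intFz: "(\<lambda>s. F (apply_bcontfun z s)) integrable_on {a..b}" for z :: "real \<Rightarrow>\<^sub>C 'a" and a b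
    by (rule integrable_continuous_real[OF contFz])
  have I_deriv: "((I z) has_vector_derivative F (apply_bcontfun z t)) (at t within {-h..h})"
    if "t \<in> {-h..h}" for z t
    unfolding I_def by (rule integral_has_vector_derivative[OF contFz that])
  have contI: "continuous_on {-h..h} (I z)" for z
    using has_vector_derivative_continuous[OF I_deriv] continuous_on_eq_continuous_within by blast
  have I_bound: "norm (I z t) \<le> 2 * h * B" if "t \<in> {-h..h}" for z t
  proof -
    have "norm (I z t) \<le> B * (t - - h)"
      unfolding I_def by (rule integral_bound) (use that contFz FB in auto)
    also have "\<dots> \<le> B * (2 * h)" using that B by (intro mult_left_mono) auto
    finally show ?thesis by (simp add: mult_ac)
  qed
  have I_lip: "norm (I z t - I w t) \<le> 2 * h * K * dist z w" if "t \<in> {-h..h}" for z w t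
  proof -
    have "I z t - I w t = integral {-h..t} (\<lambda>s. F (apply_bcontfun z s) - F (apply_bcontfun w s))"
      unfolding I_def by (rule integral_diff[symmetric]) (rule intFz)+
    also have "norm \<dots> \<le> (K * dist z w) * (t - - h)"
    proof (rule integral_bound)
      fix s
      have "norm (F (apply_bcontfun z s) - F (apply_bcontfun w s)) \<le> K * norm (apply_bcontfun z s - apply_bcontfun w s)"
        by (rule Flip)
      also have "\<dots> \<le> K * dist z w"
        using dist_bounded[of z s w] K(1) by (intro mult_left_mono) (auto simp: dist_norm)
      finally show "norm (F (apply_bcontfun z s) - F (apply_bcontfun w s)) \<le> K * dist z w" .
    qed (use that contFz in \<open>auto intro: continuous_on_diff\<close>)
    also have "\<dots> \<le> (K * dist z w) * (2 * h)" using that K by (intro mult_left_mono) auto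
    finally show ?thesis by (simp add: mult_ac)
  qed
  have 0: "0 \<in> {-h..h}" using h by auto
  define T where "T z = Bcontfun (\<lambda>t. z0 + (I z (cl t) - I z 0))" for z
  have step_bound: "norm (I z (cl t) - I z 0) \<le> r" for z t
    using I_bound[OF cl, of z t] I_bound[OF 0, of z] norm_triangle_ineq4[of "I z (cl t)" "I z 0"] h(3)
    by linarith
  have "(\<lambda>t. z0 + (I z (cl t) - I z 0)) \<in> bcontfun" for z
  proof (rule bcontfun_normI)
    show "continuous_on UNIV (\<lambda>t. z0 + (I z (cl t) - I z 0))"
      by (intro continuous_intros continuous_on_compose2[OF contI contcl]) (use cl in auto)
    show "norm (z0 + (I z (cl t) - I z 0)) \<le> norm z0 + r" for t
      using norm_triangle_ineq[of z0 "I z (cl t) - I z 0"] step_bound[of z t] by linarith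
  qed
  then have T: "apply_bcontfun (T z) = (\<lambda>t. z0 + (I z (cl t) - I z 0))" for z
    unfolding T_def by (rule Bcontfun_inverse)
  have "dist (T z) (T w) \<le> 1/2 * dist z w" for z w
  proof (rule dist_bound)
    fix t
    have "dist (apply_bcontfun (T z) t) (apply_bcontfun (T w) t) = norm ((I z (cl t) - I w (cl t)) - (I z 0 - I w 0))"
      unfolding T dist_norm by (simp add: algebra_simps)
    also have "\<dots> \<le> 2 * h * K * dist z w + 2 * h * K * dist z w"
      using I_lip[OF cl, of z t w] I_lip[OF 0, of z w] norm_triangle_ineq4[of "I z (cl t) - I w (cl t)" "I z 0 - I w 0"]
      by linarith
    also have "\<dots> = (4 * h * K) * dist z w" by simp
    also have "\<dots> \<le> 1/2 * dist z w" using h(2) by (rule mult_right_mono) simp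
    finally show "dist (apply_bcontfun (T z) t) (apply_bcontfun (T w) t) \<le> 1/2 * dist z w" .
  qed
  then have "\<exists>!z. T z = z" by (intro banach_fix_type[of "1/2"]) auto
  then obtain z where z: "T z = z" by blast
  have z_eq: "apply_bcontfun z t = z0 + (I z (cl t) - I z 0)" for t
    using T[of z] z by metis
  show ?thesis
  proof
    show "apply_bcontfun z 0 = z0" using z_eq[of 0] cl_id[OF 0] by simp
    fix t assume t: "t \<in> {-h<..<h}"
    have inC: "apply_bcontfun z t \<in> ?C"
      unfolding z_eq using step_bound[of z t] by (simp add: dist_norm norm_minus_commute)
    then show "apply_bcontfun z t \<in> S" using r by blast
    have "(I z has_vector_derivative F (apply_bcontfun z t)) (at t within {-h<..<h})"
      by (rule has_vector_derivative_within_subset[OF I_deriv]) (use t in auto)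
    then have "(I z has_vector_derivative F (apply_bcontfun z t)) (at t)"
      using at_within_open[OF t] by simp
    then have "((\<lambda>t. z0 + (I z t - I z 0)) has_vector_derivative F (apply_bcontfun z t)) (at t)"
      by (auto intro!: derivative_eq_intros)
    then have "(apply_bcontfun z has_vector_derivative F (apply_bcontfun z t)) (at t)"
      by (rule has_vector_derivative_transform_within_open[OF _ open_greaterThanLessThan t])
        (use z_eq cl_id in auto)
    moreover have "F (apply_bcontfun z t) = f (apply_bcontfun z t)"
      unfolding F_def using closest_point_self[OF inC] by simp
    ultimately show "(apply_bcontfun z has_vector_derivative f (apply_bcontfun z t)) (at t)" by simp
  qed (rule h)
qed

text \<open>Bootstrapping: the derivative of \<open>z\<close> is \<open>f\<close> along
  \<open>z\<close>, hence as regular as \<open>z\<close> itself.\<close>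

lemma ode_solution_smooth:
  fixes f :: "'a::euclidean_space \<Rightarrow> 'a"
  assumes "open T" and f: "smooth_on S f" and S: "\<And>t. t \<in> T \<Longrightarrow> z t \<in> S"
    and der: "\<And>t. t \<in> T \<Longrightarrow> (z has_vector_derivative f (z t)) (at t)"
  shows "smooth_on T z"
proof -
  have "Ck_on k T z" for k
  proof (induction k)
    case 0
    have "continuous (at t) z" if "t \<in> T" for t
      using has_vector_derivative_continuous[OF der[OF that]] .
    then show ?case by (auto intro!: continuous_at_imp_continuous_on)
  next
    case (Suc k)
    show ?case
    proof (rule Ck_on_SucI[OF \<open>open T\<close>, of _ "\<lambda>t r. r *\<^sub>R f (z t)"])
      show "(z has_derivative (\<lambda>r. r *\<^sub>R f (z t))) (at t)" if "t \<in> T" for t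
        using der[OF that] by (simp add: has_vector_derivative_def)
      have "Ck_on k T (\<lambda>t. f (z t))"
        by (rule Ck_on_compose[OF \<open>open T\<close> Suc]) (use f S in \<open>auto simp: smooth_on_def\<close>)
      then show "Ck_on k T (\<lambda>t. v *\<^sub>R f (z t))" for v
        by (rule Ck_on_bounded_linear[OF bounded_linear_scaleR_right \<open>open T\<close>])
    qed
  qed
  then show ?thesis by (simp add: smooth_on_def)
qed

text \<open>Integration along radii, with covectors represented as vectors through the inner
  product. After differentiation under the integral sign, closedness exchanges \<open>v\<close> and
  \<open>u - p\<close>, and the integrand becomes the \<open>t\<close>-derivative of
  \<open>t * (\<theta> (\<gamma> u t) \<bullet> v)\<close>; only its value at \<open>t = 1\<close>
  survives.\<close>

lemma poincare_lemma:
  fixes \<theta> :: "'a::euclidean_space \<Rightarrow> 'a"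
  assumes \<theta>: "smooth_on (ball p r) \<theta>"
    and closed: "\<And>u v w. u \<in> ball p r \<Longrightarrow>
      frechet_derivative \<theta> (at u) v \<bullet> w = frechet_derivative \<theta> (at u) w \<bullet> v"
  obtains f where "smooth_on (ball p r) f" "f p = 0"
    "\<And>u. u \<in> ball p r \<Longrightarrow> (f has_derivative (\<lambda>v. \<theta> u \<bullet> v)) (at u)"
proof -
  let ?B = "ball p r"
  define \<gamma> where "\<gamma> u t = p + t *\<^sub>R (u - p)" for u t
  define f where "f u = integral (cbox 0 1) (\<lambda>t::real. \<theta> (\<gamma> u t) \<bullet> (u - p))" for u
  \<comment> \<open>The derivative of the integrand in the endpoint \<open>u\<close>; the factor
    \<open>t\<close> comes from the inner derivative of \<open>\<gamma> u t\<close>.\<close>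
  define D where "D u t = Blinfun (\<lambda>v. t * (frechet_derivative \<theta> (at (\<gamma> u t)) v \<bullet> (u - p)) + \<theta> (\<gamma> u t) \<bullet> v)" for u t
  have \<gamma>: "\<gamma> u t \<in> ?B" if "u \<in> ?B" "t \<in> cbox 0 1" for u t
  proof -
    have "dist p (\<gamma> u t) = \<bar>t\<bar> * norm (u - p)" by (simp add: \<gamma>_def dist_norm)
    also have "\<dots> \<le> 1 * norm (u - p)" using that by (intro mult_right_mono) auto
    also have "\<dots> < r" using that by (simp add: dist_norm norm_minus_commute)
    finally show ?thesis by simp
  qed
  have der\<theta>: "(\<theta> has_derivative frechet_derivative \<theta> (at u)) (at u)" if "u \<in> ?B" for u
    using smooth_on_has_derivative[OF \<theta> that] .
  have cont\<theta>: "continuous_on ?B \<theta>" "continuous_on ?B (\<lambda>u. frechet_derivative \<theta> (at u) v)" for v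
    by (intro smooth_on_imp_continuous_on smooth_intros \<theta>)+
  have D: "blinfun_apply (D u t) = (\<lambda>v. t * (frechet_derivative \<theta> (at (\<gamma> u t)) v \<bullet> (u - p)) + \<theta> (\<gamma> u t) \<bullet> v)"
    if "u \<in> ?B" "t \<in> cbox 0 1" for u t
    unfolding D_def
  proof (rule bounded_linear_Blinfun_apply)
    show "bounded_linear (\<lambda>v. t * (frechet_derivative \<theta> (at (\<gamma> u t)) v \<bullet> (u - p)) + \<theta> (\<gamma> u t) \<bullet> v)"
      by (intro bounded_linear_add bounded_linear_const_mult bounded_linear_inner_right
          bounded_linear_compose[OF bounded_linear_inner_left] has_derivative_bounded_linear[OF der\<theta>[OF \<gamma>[OF that]]])
  qed
  have cont\<gamma>: "continuous_on (?B \<times> cbox 0 1) (\<lambda>(u, t). \<gamma> u t)"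
    unfolding \<gamma>_def split_beta by (intro continuous_intros)
  have contD: "continuous_on (?B \<times> cbox 0 1) (\<lambda>(u, t). D u t)"
  proof (rule continuous_on_blinfun_componentwise)
    fix i :: 'a assume "i \<in> Basis"
    have "continuous_on (?B \<times> cbox 0 1)
       (\<lambda>x. snd x * (frechet_derivative \<theta> (at (\<gamma> (fst x) (snd x))) i \<bullet> (fst x - p)) + \<theta> (\<gamma> (fst x) (snd x)) \<bullet> i)"
      by (intro continuous_intros continuous_on_compose2[OF cont\<theta>(1)] continuous_on_compose2[OF cont\<theta>(2)]
           cont\<gamma>[unfolded split_beta]) (use \<gamma> in auto)
    then show "continuous_on (?B \<times> cbox 0 1) (\<lambda>x. blinfun_apply (case x of (u, t) \<Rightarrow> D u t) i)"
      by (rule continuous_on_eq) (auto simp: D split_beta simp del: box_real)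
  qed
  have der: "(f has_derivative (\<lambda>v. \<theta> u \<bullet> v)) (at u)" if u: "u \<in> ?B" for u
  proof -
    have "(f has_derivative blinfun_apply (integral (cbox 0 1) (D u))) (at u within ?B)"
      unfolding f_def
    proof (rule leibniz_rule[OF _ _ contD u convex_ball])
      fix x :: 'a and t :: real assume xt: "x \<in> ?B" "t \<in> cbox 0 1"
      have "((\<lambda>x. \<gamma> x t) has_derivative (\<lambda>v. t *\<^sub>R v)) (at x)"
        unfolding \<gamma>_def by (auto intro!: derivative_eq_intros)
      from has_derivative_compose[OF this der\<theta>[OF \<gamma>[OF xt]]]
      have *: "((\<lambda>x. \<theta> (\<gamma> x t)) has_derivative (\<lambda>v. frechet_derivative \<theta> (at (\<gamma> x t)) (t *\<^sub>R v))) (at x)" .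
      have "linear (frechet_derivative \<theta> (at (\<gamma> x t)))" using der\<theta>[OF \<gamma>[OF xt]] has_derivative_linear by blast
      then have "((\<lambda>x. \<theta> (\<gamma> x t) \<bullet> (x - p)) has_derivative blinfun_apply (D x t)) (at x)"
        unfolding D[OF xt]
        by (auto intro!: derivative_eq_intros * simp: linear_scale add.commute)
      then show "((\<lambda>x. \<theta> (\<gamma> x t) \<bullet> (x - p)) has_derivative blinfun_apply (D x t)) (at x within ?B)"
        by (rule has_derivative_at_withinI)
    next
      fix x assume x: "x \<in> ?B"
      have "continuous_on (cbox 0 1) (\<lambda>t. \<gamma> x t)" unfolding \<gamma>_def by (intro continuous_intros)
      then have "continuous_on (cbox 0 1) (\<lambda>t. \<theta> (\<gamma> x t))"
        by (rule continuous_on_compose2[OF cont\<theta>(1)]) (use \<gamma>[OF x] in blast)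
      then show "(\<lambda>t. \<theta> (\<gamma> x t) \<bullet> (x - p)) integrable_on cbox 0 1"
        by (intro integrable_continuous continuous_intros)
    qed
    moreover have "blinfun_apply (integral (cbox 0 1) (D u)) v = \<theta> u \<bullet> v" for v
    proof -
      have "continuous_on (cbox 0 1) (\<lambda>t::real. (u, t))" by (intro continuous_intros)
      then have "continuous_on (cbox 0 1) (\<lambda>t. case (u, t) of (u, t) \<Rightarrow> D u t)"
        by (rule continuous_on_compose2[OF contD]) (use u in blast)
      then have "D u integrable_on cbox 0 1" by (intro integrable_continuous) simp
      then have "blinfun_apply (integral (cbox 0 1) (D u)) v = integral (cbox 0 1) (\<lambda>t. blinfun_apply (D u t) v)"
        by (rule blinfun_apply_integral)
      also have "\<dots> = integral {0..1} (\<lambda>t. t * (frechet_derivative \<theta> (at (\<gamma> u t)) v \<bullet> (u - p)) + \<theta> (\<gamma> u t) \<bullet> v)"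
        unfolding box_real[symmetric] by (rule integral_cong) (simp add: D[OF u] del: box_real)
      also have "\<dots> = 1 * (\<theta> (\<gamma> u 1) \<bullet> v) - 0 * (\<theta> (\<gamma> u 0) \<bullet> v)"
      proof (rule integral_unique, rule fundamental_theorem_of_calculus)
        fix t :: real assume "t \<in> {0..1}"
        then have t: "t \<in> cbox 0 1" by simp
        have lin: "linear (frechet_derivative \<theta> (at (\<gamma> u t)))" using der\<theta>[OF \<gamma>[OF u t]] has_derivative_linear by blast
        have "((\<lambda>t. \<gamma> u t) has_derivative (\<lambda>s. s *\<^sub>R (u - p))) (at t)"
          unfolding \<gamma>_def by (auto intro!: derivative_eq_intros)
        from has_derivative_compose[OF this der\<theta>[OF \<gamma>[OF u t]]]
        have "((\<lambda>t. \<theta> (\<gamma> u t)) has_derivative (\<lambda>s. s *\<^sub>R frechet_derivative \<theta> (at (\<gamma> u t)) (u - p))) (at t)"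
          by (simp add: linear_scale[OF lin])
        then have "((\<lambda>t. t * (\<theta> (\<gamma> u t) \<bullet> v)) has_derivative
            (\<lambda>s. s * (t * (frechet_derivative \<theta> (at (\<gamma> u t)) (u - p) \<bullet> v) + \<theta> (\<gamma> u t) \<bullet> v))) (at t)"
          by (auto intro!: derivative_eq_intros simp: algebra_simps)
        then show "((\<lambda>t. t * (\<theta> (\<gamma> u t) \<bullet> v)) has_vector_derivative
            t * (frechet_derivative \<theta> (at (\<gamma> u t)) v \<bullet> (u - p)) + \<theta> (\<gamma> u t) \<bullet> v) (at t within {0..1})"
          unfolding closed[OF \<gamma>[OF u t], of v "u - p"] has_vector_derivative_def real_scaleR_def
          by (rule has_derivative_at_withinI)
      qed simp
      also have "\<dots> = \<theta> u \<bullet> v" by (simp add: \<gamma>_def)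
      finally show ?thesis .
    qed
    ultimately have "(f has_derivative (\<lambda>v. \<theta> u \<bullet> v)) (at u within ?B)"
      by (metis (no_types, lifting) has_derivative_eq_rhs ext)
    then show ?thesis using at_within_open[OF u open_ball] by simp
  qed
  have "smooth_on ?B f"
    by (rule smooth_onI[OF open_ball der]) (auto intro!: smooth_on_inner \<theta>)
  moreover have "f p = 0" by (simp add: f_def \<gamma>_def)
  ultimately show ?thesis using der that by blast
qed

section \<open>Metrics, sprays and Killing tensors in a coordinate domain\<close>

definition form :: "(real^2 \<Rightarrow> real^2^2) \<Rightarrow> real^2 \<Rightarrow> real^2 \<Rightarrow> real^2 \<Rightarrow> real" where
  "form G u v w = v \<bullet> (G u *v w)"

text \<open>The coordinate derivative of the tensor in the direction \<open>k\<close>, with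
  \<open>v\<close> and \<open>w\<close> kept constant; it is not a covariant derivative.\<close>

definition dform :: "(real^2 \<Rightarrow> real^2^2) \<Rightarrow> real^2 \<Rightarrow> real^2 \<Rightarrow> real^2 \<Rightarrow> real^2 \<Rightarrow> real" where
  "dform G u k v w = frechet_derivative (\<lambda>u. form G u v w) (at u) k"

text \<open>With this sign a geodesic \<open>x\<close> satisfies
  \<open>x'' = - spray G x x'\<close>.\<close>

definition spray :: "(real^2 \<Rightarrow> real^2^2) \<Rightarrow> real^2 \<Rightarrow> real^2 \<Rightarrow> real^2" where
  "spray G u v = (\<chi> k. \<Sum>i\<in>UNIV. \<Sum>j\<in>UNIV. christoffel G u k i j * v $ i * v $ j)"

definition symmetric_on :: "(real^2) set \<Rightarrow> (real^2 \<Rightarrow> real^2^2) \<Rightarrow> bool" where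
  "symmetric_on S G \<longleftrightarrow> smooth_on S G \<and> (\<forall>u\<in>S. G u $ 2 $ 1 = G u $ 1 $ 2)"

definition metric_on :: "(real^2) set \<Rightarrow> (real^2 \<Rightarrow> real^2^2) \<Rightarrow> bool" where
  "metric_on S G \<longleftrightarrow> symmetric_on S G \<and> (\<forall>u\<in>S. det (G u) \<noteq> 0)"

text \<open>Along a geodesic of \<open>G\<close> with velocity \<open>v\<close>, the function
  \<open>a(v, v)\<close> has the derivative
  \<open>dform a u v v v - 2 * form a u v (spray G u v)\<close>. So \<open>a\<close> is a quadratic
  first integral of the geodesic flow; equivalently its symmetrized covariant derivative
  vanishes.\<close>

definition killing_on :: "(real^2) set \<Rightarrow> (real^2 \<Rightarrow> real^2^2) \<Rightarrow> (real^2 \<Rightarrow> real^2^2) \<Rightarrow> bool" where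
  "killing_on S G a \<longleftrightarrow> (\<forall>u\<in>S. \<forall>v. dform a u v v v = 2 * form a u v (spray G u v))"

lemma vec2_eq_iff: "(v :: 'b ^ 2) = w \<longleftrightarrow> v $ 1 = w $ 1 \<and> v $ 2 = w $ 2"
  by (simp add: vec_eq_iff forall_2)

lemma vec2_expand: "(v :: real ^ 2) = v $ 1 *\<^sub>R axis 1 1 + v $ 2 *\<^sub>R axis 2 1"
  by (simp add: vec2_eq_iff axis_def)

lemma inner_vec2: "(v :: real ^ 2) \<bullet> w = v $ 1 * w $ 1 + v $ 2 * w $ 2"
  by (simp add: inner_vec_def sum_2)

lemma form_expand:
  "form G u v w = G u $ 1 $ 1 * v $ 1 * w $ 1 + G u $ 1 $ 2 * v $ 1 * w $ 2
     + G u $ 2 $ 1 * v $ 2 * w $ 1 + G u $ 2 $ 2 * v $ 2 * w $ 2"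
  by (simp add: form_def inner_vec2 matrix_vector_mult_def sum_2 algebra_simps)

lemma ds2_form: "ds2 (G u) dx dy = form G u (vector [dx, dy]) (vector [dx, dy])"
  by (simp add: ds2_def form_def Let_def)

lemma symmetric_onD:
  assumes "symmetric_on S G"
  shows "smooth_on S G" "u \<in> S \<Longrightarrow> G u $ 2 $ 1 = G u $ 1 $ 2"
  using assms by (auto simp: symmetric_on_def)

lemma metric_onD:
  assumes "metric_on S G"
  shows "symmetric_on S G" "smooth_on S G" "u \<in> S \<Longrightarrow> G u $ 2 $ 1 = G u $ 1 $ 2"
    "u \<in> S \<Longrightarrow> det (G u) \<noteq> 0" "u \<in> S \<Longrightarrow> G u $ 1 $ 1 * G u $ 2 $ 2 - (G u $ 1 $ 2)\<^sup>2 \<noteq> 0"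
  using assms by (auto simp: metric_on_def symmetric_on_def det_2 power2_eq_square)

lemma symmetric_on_subset: "symmetric_on S G \<Longrightarrow> T \<subseteq> S \<Longrightarrow> symmetric_on T G"
  unfolding symmetric_on_def using smooth_on_subset by blast

lemma metric_on_subset: "metric_on S G \<Longrightarrow> T \<subseteq> S \<Longrightarrow> metric_on T G"
  unfolding metric_on_def using symmetric_on_subset by blast

lemma killing_on_subset: "killing_on S G a \<Longrightarrow> T \<subseteq> S \<Longrightarrow> killing_on T G a"
  unfolding killing_on_def by blast

lemma form_sym: "G u $ 2 $ 1 = G u $ 1 $ 2 \<Longrightarrow> form G u v w = form G u w v"
  by (simp add: form_expand)

lemma smooth_on_entry: "open S \<Longrightarrow> smooth_on S G \<Longrightarrow> smooth_on S (\<lambda>u. G u $ i $ j)"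
  for G :: "real^2 \<Rightarrow> real^2^2"
  by (intro smooth_on_vec_nth)

lemma smooth_on_matrix:
  fixes G :: "real^2 \<Rightarrow> real^2^2"
  assumes "open S" "smooth_on S (\<lambda>u. G u $ 1 $ 1)" "smooth_on S (\<lambda>u. G u $ 1 $ 2)"
    "smooth_on S (\<lambda>u. G u $ 2 $ 1)" "smooth_on S (\<lambda>u. G u $ 2 $ 2)"
  shows "smooth_on S G"
proof -
  have "smooth_on S (\<lambda>u. G u $ i $ j)" for i j
    using assms exhaust_2[of i] exhaust_2[of j] by auto
  then show ?thesis by (intro smooth_on_vec \<open>open S\<close>)
qed

lemma smooth_on_form:
  assumes "open S" "smooth_on S G" "smooth_on S a" "smooth_on S b"
  shows "smooth_on S (\<lambda>u. form G u (a u) (b u))"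
  unfolding form_expand by (intro smooth_on_add smooth_on_mult smooth_on_vec_nth assms)

lemma has_derivative_entry:
  fixes G :: "real^2 \<Rightarrow> real^2^2"
  assumes "open S" "smooth_on S G" "u \<in> S"
  shows "((\<lambda>u. G u $ i $ j) has_derivative frechet_derivative (\<lambda>u. G u $ i $ j) (at u)) (at u)"
  by (rule smooth_on_has_derivative[OF smooth_on_entry[OF assms(1,2)] assms(3)])

lemma has_derivative_form:
  assumes "open S" "smooth_on S G" "u \<in> S"
  shows "((\<lambda>u. form G u v w) has_derivative (\<lambda>k. dform G u k v w)) (at u)"
  unfolding dform_def by (rule smooth_on_has_derivative[OF smooth_on_form[OF assms(1,2)] assms(3)]) simp_all

lemma dform_expand:
  assumes "open S" "smooth_on S G" "u \<in> S"
  shows "dform G u k v w = frechet_derivative (\<lambda>u. G u $ 1 $ 1) (at u) k * v $ 1 * w $ 1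
    + frechet_derivative (\<lambda>u. G u $ 1 $ 2) (at u) k * v $ 1 * w $ 2
    + frechet_derivative (\<lambda>u. G u $ 2 $ 1) (at u) k * v $ 2 * w $ 1
    + frechet_derivative (\<lambda>u. G u $ 2 $ 2) (at u) k * v $ 2 * w $ 2"
proof -
  have "((\<lambda>u. form G u v w) has_derivative (\<lambda>k. frechet_derivative (\<lambda>u. G u $ 1 $ 1) (at u) k * v $ 1 * w $ 1
    + frechet_derivative (\<lambda>u. G u $ 1 $ 2) (at u) k * v $ 1 * w $ 2
    + frechet_derivative (\<lambda>u. G u $ 2 $ 1) (at u) k * v $ 2 * w $ 1
    + frechet_derivative (\<lambda>u. G u $ 2 $ 2) (at u) k * v $ 2 * w $ 2)) (at u)"
    unfolding form_expand
    by (intro has_derivative_add has_derivative_mult_left has_derivative_entry[OF assms])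
  from has_derivative_unique[OF this has_derivative_form[OF assms]] show ?thesis by metis
qed

lemma frechet_derivative_partial:
  fixes f :: "real^2 \<Rightarrow> real"
  assumes "f differentiable (at u)"
  shows "frechet_derivative f (at u) k = k $ 1 * partial_deriv 1 f u + k $ 2 * partial_deriv 2 f u"
proof -
  have lin: "linear (frechet_derivative f (at u))" using linear_frechet_derivative[OF assms] .
  have "frechet_derivative f (at u) k = frechet_derivative f (at u) (k $ 1 *\<^sub>R axis 1 1 + k $ 2 *\<^sub>R axis 2 1)"
    using vec2_expand[of k] by metis
  also have "\<dots> = k $ 1 * partial_deriv 1 f u + k $ 2 * partial_deriv 2 f u"
    unfolding linear_add[OF lin] linear_scale[OF lin] partial_deriv_def by simp
  finally show ?thesis .
qed

lemma dform_partial: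
  assumes "open S" "smooth_on S G" "u \<in> S"
  shows "dform G u k v w = (\<Sum>l\<in>UNIV. \<Sum>i\<in>UNIV. \<Sum>j\<in>UNIV. partial_deriv l (\<lambda>u. G u $ i $ j) u * k $ l * v $ i * w $ j)"
proof -
  have "(\<lambda>u. G u $ i $ j) differentiable (at u)" for i j
    using has_derivative_entry[OF assms] differentiableI by blast
  note d = frechet_derivative_partial[OF this]
  show ?thesis unfolding dform_expand[OF assms] d by (simp add: sum_2 algebra_simps)
qed

lemma dform_linear:
  assumes "open S" "smooth_on S G" "u \<in> S"
  shows "dform G u (k + k') v w = dform G u k v w + dform G u k' v w"
    "dform G u (c *\<^sub>R k) v w = c * dform G u k v w"
    "dform G u k (v + v') w = dform G u k v w + dform G u k v' w"
    "dform G u k (c *\<^sub>R v) w = c * dform G u k v w"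
    "dform G u k v (w + w') = dform G u k v w + dform G u k v w'"
    "dform G u k v (c *\<^sub>R w) = c * dform G u k v w"
  unfolding dform_partial[OF assms] by (simp_all add: sum_2 algebra_simps)

lemma form_linear:
  "form G u (v + v') w = form G u v w + form G u v' w"
  "form G u (c *\<^sub>R v) w = c * form G u v w"
  "form G u v (w + w') = form G u v w + form G u v w'"
  "form G u v (c *\<^sub>R w) = c * form G u v w"
  unfolding form_expand by (simp_all add: algebra_simps)

lemma dform_sym:
  assumes "open S" "symmetric_on S G" "u \<in> S"
  shows "dform G u k v w = dform G u k w v"
proof -
  have "frechet_derivative (\<lambda>u. form G u v w) (at u) = frechet_derivative (\<lambda>u. form G u w v) (at u)"
    by (rule frechet_derivative_transform_within_open[OF _ assms(1,3)])
      (use has_derivative_form[OF assms(1) symmetric_onD(1)[OF assms(2)] assms(3)] differentiableI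
          form_sym symmetric_onD(2)[OF assms(2)] in blast)+
  then show ?thesis by (simp add: dform_def)
qed

lemma partial_deriv_sym:
  assumes "open S" "symmetric_on S G" "u \<in> S"
  shows "partial_deriv i (\<lambda>u. G u $ 2 $ 1) u = partial_deriv i (\<lambda>u. G u $ 1 $ 2) u"
proof -
  have "(\<lambda>u. G u $ 2 $ 1) differentiable (at u)"
    using has_derivative_entry[OF assms(1) symmetric_onD(1)[OF assms(2)] assms(3)] by (rule differentiableI)
  from frechet_derivative_transform_within_open[OF this assms(1,3), of "\<lambda>u. G u $ 1 $ 2"]
  show ?thesis using symmetric_onD(2)[OF assms(2)] by (simp add: partial_deriv_def)
qed

section \<open>Inverse matrices and Christoffel symbols\<close>

lemma matrix_inv_works:
  fixes A :: "real^'n^'n"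
  assumes "det A \<noteq> 0"
  shows matrix_inv_right: "A ** matrix_inv A = mat 1" and matrix_inv_left: "matrix_inv A ** A = mat 1"
proof -
  have "\<exists>B. A ** B = mat 1 \<and> B ** A = mat 1"
    using assms invertible_det_nz unfolding invertible_def by blast
  from someI_ex[OF this] show "A ** matrix_inv A = mat 1" "matrix_inv A ** A = mat 1"
    unfolding matrix_inv_def by auto
qed

lemma matrix_inv_2:
  fixes A :: "real^2^2"
  assumes "det A \<noteq> 0"
  shows "matrix_inv A = (\<chi> i j. (if i = j then A $ (if i = 1 then 2 else 1) $ (if i = 1 then 2 else 1) else - A $ i $ j) / det A)"
    (is "_ = ?B")
proof -
  have 1: "A ** ?B = mat 1"
  proof -
    have "A $ 1 $ 1 * A $ 2 $ 2 = det A + A $ 1 $ 2 * A $ 2 $ 1" by (simp add: det_2)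
    then show ?thesis
      using assms by (simp add: vec_eq_iff forall_2 matrix_matrix_mult_def sum_2 mat_def field_simps)
  qed
  have "matrix_inv A ** A = mat 1" by (rule matrix_inv_left[OF assms])
  then have "matrix_inv A = matrix_inv A ** (A ** ?B)" by (simp add: 1)
  also have "\<dots> = ?B" by (simp add: matrix_mul_assoc \<open>matrix_inv A ** A = mat 1\<close>)
  finally show ?thesis .
qed

lemma smooth_on_det:
  fixes G :: "real^2 \<Rightarrow> real^2^2"
  assumes "open S" "smooth_on S G"
  shows "smooth_on S (\<lambda>u. det (G u))"
  unfolding det_2 by (intro smooth_on_diff smooth_on_mult smooth_on_entry assms)

lemma smooth_on_partial_deriv:
  "smooth_on S f \<Longrightarrow> smooth_on S (partial_deriv i f)"
  unfolding partial_deriv_def[abs_def] by (rule smooth_on_frechet_derivative)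

lemma smooth_on_matrix_inv:
  fixes G :: "real^2 \<Rightarrow> real^2^2"
  assumes "open S" "smooth_on S G" "\<And>u. u \<in> S \<Longrightarrow> det (G u) \<noteq> 0"
  shows "smooth_on S (\<lambda>u. matrix_inv (G u) $ k $ l)"
proof -
  have "smooth_on S (\<lambda>u. (if k = l then G u $ (if k = 1 then 2 else 1) $ (if k = 1 then 2 else 1) else - G u $ k $ l) / det (G u))"
    by (cases "k = l") (auto intro!: smooth_on_divide smooth_on_uminus smooth_on_entry smooth_on_det assms)
  then show ?thesis
    by (rule smooth_on_cong[OF _ assms(1)]) (simp add: matrix_inv_2 assms(3))
qed

lemma smooth_on_christoffel:
  assumes "open S" "metric_on S G"
  shows "smooth_on S (\<lambda>u. christoffel G u k i j)"
proof -
  note G = metric_onD(2)[OF assms(2)]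
  note inv = smooth_on_matrix_inv[OF assms(1) G metric_onD(4)[OF assms(2)]]
  show ?thesis unfolding christoffel_def
    by (intro smooth_on_mult smooth_on_sum smooth_on_add smooth_on_diff smooth_on_const inv
        smooth_on_partial_deriv smooth_on_entry assms(1) G)
qed

lemma christoffel_lower:
  assumes "det (G u) \<noteq> 0"
  shows "(\<Sum>k\<in>UNIV. G u $ m $ k * christoffel G u k i j) = (1/2) *
    (partial_deriv i (\<lambda>w. G w $ j $ m) u + partial_deriv j (\<lambda>w. G w $ i $ m) u - partial_deriv m (\<lambda>w. G w $ i $ j) u)"
proof -
  define c where "c l = (1/2) * (partial_deriv i (\<lambda>w. G w $ j $ l) u + partial_deriv j (\<lambda>w. G w $ i $ l) u
    - partial_deriv l (\<lambda>w. G w $ i $ j) u)" for l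
  have "G u ** matrix_inv (G u) = mat 1" by (rule matrix_inv_right[OF assms])
  then have e: "(\<Sum>k\<in>UNIV. G u $ m $ k * matrix_inv (G u) $ k $ l) = (if m = l then 1 else 0)" for l
    unfolding vec_eq_iff by (simp add: matrix_matrix_mult_def mat_def)
  have "(\<Sum>k\<in>UNIV. G u $ m $ k * christoffel G u k i j)
      = (\<Sum>k\<in>UNIV. \<Sum>l\<in>UNIV. G u $ m $ k * matrix_inv (G u) $ k $ l * c l)"
    unfolding christoffel_def c_def by (simp add: sum_distrib_left mult_ac)
  also have "\<dots> = (\<Sum>l\<in>UNIV. (\<Sum>k\<in>UNIV. G u $ m $ k * matrix_inv (G u) $ k $ l) * c l)"
    unfolding sum_distrib_right by (rule sum.swap)
  also have "\<dots> = c m" unfolding e by (simp add: if_distrib[of "\<lambda>x. x * _"] cong: if_cong)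
  finally show ?thesis unfolding c_def .
qed

lemma christoffel_sym:
  assumes "open S" "symmetric_on S G" "u \<in> S"
  shows "christoffel G u k 2 1 = christoffel G u k 1 2"
  unfolding christoffel_def by (simp add: partial_deriv_sym[OF assms] algebra_simps)

text \<open>The Euler-Lagrange form of the geodesic equation. Lowering the index eliminates the
  inverse matrix, so that computations in a frame involve only derivatives of the metric.\<close>

lemma form_spray:
  assumes "open S" "metric_on S G" "u \<in> S"
  shows "form G u (spray G u v) z = dform G u v v z - (1/2) * dform G u z v v"
proof -
  note G = metric_onD[OF assms(2)]
  note low = christoffel_lower[of G u, OF G(4)[OF assms(3)], unfolded sum_2]
  note symG = G(3)[OF assms(3)] and symP = partial_deriv_sym[OF assms(1) G(1) assms(3)]
  let ?P = "\<lambda>m i j. G u $ m $ 1 * christoffel G u 1 i j + G u $ m $ 2 * christoffel G u 2 i j"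
  have "form G u (spray G u v) z = z $ 1 * (\<Sum>i\<in>UNIV. \<Sum>j\<in>UNIV. ?P 1 i j * v $ i * v $ j)
     + z $ 2 * (\<Sum>i\<in>UNIV. \<Sum>j\<in>UNIV. ?P 2 i j * v $ i * v $ j)"
    unfolding form_expand spray_def sum_2 by (simp add: symG algebra_simps)
  also have "\<dots> = dform G u v v z - (1/2) * dform G u z v v"
    unfolding low dform_partial[OF assms(1) G(2) assms(3)] sum_2 by (simp add: symP algebra_simps)
  finally show ?thesis .
qed

lemma form_nondegenerate:
  assumes "det (G u) \<noteq> 0" "G u $ 2 $ 1 = G u $ 1 $ 2" "\<And>z. form G u w z = form G u w' z"
  shows "w = w'"
proof -
  have "transpose (G u) = G u" using assms(2) by (simp add: transpose_def vec_eq_iff forall_2)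
  then have "form G u w z = z \<bullet> (G u *v w)" for w z
    using form_sym[of G u, OF assms(2), of w z] by (simp add: form_def)
  then have "G u *v w = G u *v w'" using assms(3) vector_eq_ldot by metis
  then show ?thesis using matrix_inv_left[OF assms(1)]
    by (metis matrix_vector_mul_assoc matrix_vector_mul_lid)
qed

text \<open>After lowering the index, each of the two Christoffel symbols is a combination of three
  derivatives of the metric; the unwanted ones cancel in pairs.\<close>

lemma metric_compatibility:
  assumes "open S" "metric_on S G" "u \<in> S"
  shows "partial_deriv k (\<lambda>u. G u $ i $ j) u =
    (\<Sum>l\<in>UNIV. christoffel G u l k i * G u $ l $ j + christoffel G u l k j * G u $ l $ i)"
proof -
  note G = metric_onD[OF assms(2)]
  note symG = G(3)[OF assms(3)] and symP = partial_deriv_sym[OF assms(1) G(1) assms(3)]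
  have symG': "G u $ i $ j = G u $ j $ i" for i j
    using symG exhaust_2[of i] exhaust_2[of j] by auto
  have symP': "partial_deriv k (\<lambda>u. G u $ i $ j) u = partial_deriv k (\<lambda>u. G u $ j $ i) u" for k i j
    using symP[of k] exhaust_2[of i] exhaust_2[of j] by auto
  have "(\<Sum>l\<in>UNIV. christoffel G u l k i * G u $ l $ j + christoffel G u l k j * G u $ l $ i)
     = (\<Sum>l\<in>UNIV. G u $ j $ l * christoffel G u l k i) + (\<Sum>l\<in>UNIV. G u $ i $ l * christoffel G u l k j)"
    by (simp add: sum.distrib symG'[of _ i] symG'[of _ j] mult.commute)
  also have "\<dots> = partial_deriv k (\<lambda>u. G u $ i $ j) u"
    unfolding christoffel_lower[of G u, OF G(4)[OF assms(3)]]
    using symP'[of i j k] symP'[of k i j] symP'[of k j i] symP'[of j i k] symP'[of i k j] symP'[of j k i] by (simp add: algebra_simps)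
  finally show ?thesis by simp
qed

text \<open>Jacobi's formula: the trace of the Christoffel symbols is half the logarithmic
  derivative of the determinant. It links the covector \<open>\<phi>\<close> of a projective change
  to the quotient of the determinants.\<close>

lemma partial_deriv_det:
  assumes "open S" "metric_on S G" "u \<in> S"
  shows "partial_deriv k (\<lambda>u. det (G u)) u = 2 * (christoffel G u 1 k 1 + christoffel G u 2 k 2) * det (G u)"
proof -
  note G = metric_onD[OF assms(2)]
  have e: "((\<lambda>u. G u $ i $ j) has_derivative frechet_derivative (\<lambda>u. G u $ i $ j) (at u)) (at u)" for i j
    using has_derivative_entry[OF assms(1) G(2) assms(3)] .
  have "((\<lambda>u. det (G u)) has_derivative (\<lambda>h. (G u $ 1 $ 1 * frechet_derivative (\<lambda>u. G u $ 2 $ 2) (at u) h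
     + frechet_derivative (\<lambda>u. G u $ 1 $ 1) (at u) h * G u $ 2 $ 2)
     - (G u $ 1 $ 2 * frechet_derivative (\<lambda>u. G u $ 2 $ 1) (at u) h
     + frechet_derivative (\<lambda>u. G u $ 1 $ 2) (at u) h * G u $ 2 $ 1))) (at u)"
    unfolding det_2 by (intro has_derivative_diff has_derivative_mult e)
  then have "partial_deriv k (\<lambda>u. det (G u)) u = G u $ 1 $ 1 * partial_deriv k (\<lambda>u. G u $ 2 $ 2) u
     + partial_deriv k (\<lambda>u. G u $ 1 $ 1) u * G u $ 2 $ 2
     - (G u $ 1 $ 2 * partial_deriv k (\<lambda>u. G u $ 2 $ 1) u + partial_deriv k (\<lambda>u. G u $ 1 $ 2) u * G u $ 2 $ 1)"
    unfolding partial_deriv_def by (simp add: frechet_derivative_at[symmetric])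
  also have "\<dots> = 2 * (christoffel G u 1 k 1 + christoffel G u 2 k 2) * det (G u)"
    unfolding metric_compatibility[OF assms] det_2 sum_2 G(3)[OF assms(3)] by (simp add: algebra_simps)
  finally show ?thesis .
qed

text \<open>Both sides of \<open>par\<close> are binary cubics in \<open>v\<close>, and four test
  vectors separate their coefficients. The result says \<open>T(v, v) = 2 \<phi>(v) v\<close> for
  the covector \<open>\<phi>\<close> with components \<open>T 2 1 2\<close> and
  \<open>T 1 1 2\<close>.\<close>

lemma parallel_quadratic_map:
  fixes T :: "2 \<Rightarrow> 2 \<Rightarrow> 2 \<Rightarrow> real"
  assumes sym: "\<And>k. T k 2 1 = T k 1 2"
    and par: "\<And>v :: real^2. (\<Sum>i\<in>UNIV. \<Sum>j\<in>UNIV. T 1 i j * v $ i * v $ j) * v $ 2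
      = (\<Sum>i\<in>UNIV. \<Sum>j\<in>UNIV. T 2 i j * v $ i * v $ j) * v $ 1"
  shows "T 1 2 2 = 0" "T 2 1 1 = 0" "T 1 1 1 = 2 * T 2 1 2" "T 2 2 2 = 2 * T 1 1 2"
proof -
  have e: "(T 1 1 1 * x * x + 2 * T 1 1 2 * x * y + T 1 2 2 * y * y) * y
     = (T 2 1 1 * x * x + 2 * T 2 1 2 * x * y + T 2 2 2 * y * y) * x" for x y
    using par[of "vector [x, y]"] by (simp add: sum_2 sym algebra_simps)
  from e[of 1 0] e[of 0 1] show "T 1 2 2 = 0" "T 2 1 1 = 0" by simp_all
  with e[of 1 1] e[of 1 "-1"] show "T 1 1 1 = 2 * T 2 1 2" "T 2 2 2 = 2 * T 1 1 2" by simp_all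
qed

definition parallel :: "real^2 \<Rightarrow> real^2 \<Rightarrow> bool" where
  "parallel v w \<longleftrightarrow> v $ 1 * w $ 2 = v $ 2 * w $ 1"

text \<open>The difference of Christoffel symbols is \<open>\<phi> i\<close> times the identity plus
  its symmetric counterpart in \<open>j\<close>. In the trace over \<open>k = j\<close> the first
  part counts twice (the dimension) and the second once, hence the factor 3.\<close>

lemma spray_difference:
  assumes "open S" "metric_on S G" "metric_on S H" "u \<in> S"
    and par: "\<And>v. parallel (spray H u v - spray G u v) v"
  obtains \<phi> where "\<And>v. spray H u v - spray G u v = (2 * (\<phi> \<bullet> v)) *\<^sub>R v"
    "\<And>i. christoffel H u 1 i 1 + christoffel H u 2 i 2 - (christoffel G u 1 i 1 + christoffel G u 2 i 2) = 3 * \<phi> $ i"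
proof -
  define T where "T k i j = christoffel H u k i j - christoffel G u k i j" for k i j
  have sp: "(spray H u v - spray G u v) $ k = (\<Sum>i\<in>UNIV. \<Sum>j\<in>UNIV. T k i j * v $ i * v $ j)" for v k
    by (simp add: spray_def T_def sum_subtractf algebra_simps)
  have sym: "T k 2 1 = T k 1 2" for k
    unfolding T_def using christoffel_sym assms metric_onD(1) by metis
  have par': "(\<Sum>i\<in>UNIV. \<Sum>j\<in>UNIV. T 1 i j * v $ i * v $ j) * v $ 2
      = (\<Sum>i\<in>UNIV. \<Sum>j\<in>UNIV. T 2 i j * v $ i * v $ j) * v $ 1" for v
    using par[of v] unfolding parallel_def sp .
  have T: "T 1 2 2 = 0" "T 2 1 1 = 0" "T 1 1 1 = 2 * T 2 1 2" "T 2 2 2 = 2 * T 1 1 2"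
    using parallel_quadratic_map[of T, OF sym par'] by blast+
  define \<phi> :: "real^2" where "\<phi> = vector [T 2 1 2, T 1 1 2]"
  show ?thesis
  proof
    show "spray H u v - spray G u v = (2 * (\<phi> \<bullet> v)) *\<^sub>R v" for v
      unfolding vec2_eq_iff sp by (simp add: sum_2 sym T \<phi>_def inner_vec2 algebra_simps)
    have "T 1 i 1 + T 2 i 2 = 3 * \<phi> $ i" for i
      using exhaust_2[of i] by (auto simp: \<phi>_def T sym)
    then show "christoffel H u 1 i 1 + christoffel H u 2 i 2 - (christoffel G u 1 i 1 + christoffel G u 2 i 2) = 3 * \<phi> $ i" for i
      by (simp add: T_def algebra_simps)
  qed
qed

text \<open>The derivative of \<open>gbar(v, v)\<close> along a geodesic of \<open>G\<close> is
  \<open>4 \<phi>(v) gbar(v, v)\<close>, and the logarithmic derivative of \<open>c ^ 2\<close> is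
  \<open>4 \<phi>(v)\<close> as well. Dividing therefore produces a conserved quantity.\<close>

lemma killing_from_projective:
  assumes "open S" "metric_on S G" "metric_on S H"
    and par: "\<And>u v. u \<in> S \<Longrightarrow> parallel (spray H u v - spray G u v) v"
  defines "c \<equiv> \<lambda>u. root 3 (det (H u) / det (G u))"
  defines "a \<equiv> \<lambda>u. inverse ((c u)\<^sup>2) *\<^sub>R H u"
  shows "symmetric_on S a" "killing_on S G a"
    "\<And>u. u \<in> S \<Longrightarrow> det (a u) \<noteq> 0"
    "\<And>u. u \<in> S \<Longrightarrow> H u = inverse ((det (a u) / det (G u))\<^sup>2) *\<^sub>R a u"
proof -
  note G = metric_onD[OF assms(2)] and H = metric_onD[OF assms(3)]
  let ?\<rho> = "\<lambda>u. det (H u) / det (G u)"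
  have c3: "c u ^ 3 = ?\<rho> u" for u unfolding c_def by (rule odd_real_root_pow) simp
  have c0: "c u \<noteq> 0" if "u \<in> S" for u
    using G(4)[OF that] H(4)[OF that] by (auto simp: c_def)
  have smooth_c: "smooth_on S c"
    unfolding c_def
    by (intro smooth_on_root3 smooth_on_divide smooth_on_det assms(1) G(2) H(2)) (use G(4) H(4) in auto)
  have "smooth_on S (\<lambda>u. (inverse ((c u)\<^sup>2) *\<^sub>R H u) $ i $ j)" for i j
    by (intro smooth_on_vec_nth smooth_on_scaleR smooth_on_inverse smooth_on_power smooth_c assms(1) H(2))
      (use c0 in auto)
  from smooth_on_matrix[OF assms(1) this this this this]
  show "symmetric_on S a" unfolding symmetric_on_def a_def by (simp add: H(3))
  have det_a: "det (a u) = det (H u) / c u ^ 4" for u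
    by (simp add: a_def det_2 divide_inverse power2_eq_square power4_eq_xxxx algebra_simps)
  then show da0: "det (a u) \<noteq> 0" if "u \<in> S" for u using H(4)[OF that] c0[OF that] by simp
  \<comment> \<open>Determinants of 2 by 2 matrices scale quadratically: the factor
    \<open>1 / c ^ 2\<close> contributes \<open>1 / c ^ 4\<close>, against \<open>c ^ 3\<close> from
    the quotient of the determinants.\<close>
  have \<delta>: "det (a u) / det (G u) = inverse (c u)" if "u \<in> S" for u
  proof -
    have "det (a u) / det (G u) = ?\<rho> u / c u ^ 4" by (simp add: det_a)
    also have "\<dots> = inverse (c u)" unfolding c3[symmetric] using c0[OF that] by (simp add: field_simps eval_nat_numeral)
    finally show ?thesis .
  qed
  show "H u = inverse ((det (a u) / det (G u))\<^sup>2) *\<^sub>R a u" if "u \<in> S" for u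
  proof -
    have "inverse ((inverse (c u))\<^sup>2) * inverse ((c u)\<^sup>2) = 1" using c0[OF that] by (simp add: field_simps)
    then show ?thesis unfolding \<delta>[OF that] by (simp add: a_def)
  qed
  show "killing_on S G a"
    unfolding killing_on_def
  proof (intro ballI allI)
    fix u v assume u: "u \<in> S"
    obtain \<phi> where \<phi>: "\<And>v. spray H u v - spray G u v = (2 * (\<phi> \<bullet> v)) *\<^sub>R v"
      "\<And>i. christoffel H u 1 i 1 + christoffel H u 2 i 2 - (christoffel G u 1 i 1 + christoffel G u 2 i 2) = 3 * \<phi> $ i"
      using spray_difference[OF assms(1-3) u par[OF u]] by metis
    have dc: "(c has_derivative frechet_derivative c (at u)) (at u)"
      by (rule smooth_on_has_derivative[OF smooth_c u])
    have dG: "((\<lambda>u. det (G u)) has_derivative frechet_derivative (\<lambda>u. det (G u)) (at u)) (at u)"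
      by (rule smooth_on_has_derivative[OF smooth_on_det[OF assms(1) G(2)] u])
    have dH: "((\<lambda>u. det (H u)) has_derivative frechet_derivative (\<lambda>u. det (H u)) (at u)) (at u)"
      by (rule smooth_on_has_derivative[OF smooth_on_det[OF assms(1) H(2)] u])
    \<comment> \<open>The logarithmic derivatives of the determinants differ by twice the trace
      \<open>3 \<phi>\<close>; here cleared of denominators.\<close>
    have det_deriv: "frechet_derivative (\<lambda>u. det (H u)) (at u) v * det (G u)
       = frechet_derivative (\<lambda>u. det (G u)) (at u) v * det (H u) + 6 * (\<phi> \<bullet> v) * det (G u) * det (H u)" for v
    proof -
      have "(\<lambda>u. det (H u)) differentiable (at u)" "(\<lambda>u. det (G u)) differentiable (at u)"
        using dG dH differentiableI by blast+
      note fp = this[THEN frechet_derivative_partial]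
      have h: "christoffel H u 1 i 1 + christoffel H u 2 i 2 = christoffel G u 1 i 1 + christoffel G u 2 i 2 + 3 * \<phi> $ i" for i
        using \<phi>(2)[of i] by simp
      show ?thesis
        unfolding fp partial_deriv_det[OF assms(1,2) u] partial_deriv_det[OF assms(1,3) u] h inner_vec2
        by (simp add: algebra_simps)
    qed
    have "frechet_derivative c (at u) v = 2 * (\<phi> \<bullet> v) * c u"
    proof -
      \<comment> \<open>Differentiating \<open>c ^ 3 * det G = det H\<close> yields the derivative
        of \<open>c\<close> algebraically, without differentiating the cube root.\<close>
      have "((\<lambda>u. c u ^ 3 * det (G u)) has_derivative
         (\<lambda>h. c u ^ 3 * frechet_derivative (\<lambda>u. det (G u)) (at u) h + (3 * c u ^ 2 * frechet_derivative c (at u) h) * det (G u))) (at u)"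
        using has_derivative_mult[OF has_derivative_power[OF dc, of 3] dG] by (simp add: mult_ac)
      then have "((\<lambda>u. det (H u)) has_derivative
         (\<lambda>h. c u ^ 3 * frechet_derivative (\<lambda>u. det (G u)) (at u) h + (3 * c u ^ 2 * frechet_derivative c (at u) h) * det (G u))) (at u)"
        by (rule has_derivative_transform_within_open[OF _ assms(1) u]) (simp add: G(4) c3)
      from fun_cong[OF has_derivative_unique[OF dH this], of v]
      have e: "frechet_derivative (\<lambda>u. det (H u)) (at u) v =
         c u ^ 3 * frechet_derivative (\<lambda>u. det (G u)) (at u) v + (3 * c u ^ 2 * frechet_derivative c (at u) v) * det (G u)" .
      have dHu: "det (H u) = c u ^ 3 * det (G u)" using c3[of u] G(4)[OF u] by simp
      have "(3 * c u ^ 2 * frechet_derivative c (at u) v) * det (G u) * det (G u)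
          = 6 * (\<phi> \<bullet> v) * c u ^ 3 * det (G u) * det (G u)"
        using det_deriv[of v] unfolding e dHu by algebra
      then have "3 * c u ^ 2 * frechet_derivative c (at u) v = 6 * (\<phi> \<bullet> v) * c u ^ 3"
        using G(4)[OF u] by simp
      then have "c u ^ 2 * frechet_derivative c (at u) v = c u ^ 2 * (2 * (\<phi> \<bullet> v) * c u)"
        by algebra
      then show ?thesis using c0[OF u] by simp
    qed
    note dcv = this
    have formH: "form H w x y = (c w)\<^sup>2 * form a w x y" if "w \<in> S" for w x y
      using c0[OF that] by (simp add: form_expand a_def field_simps)
    have "((\<lambda>w. (c w)\<^sup>2 * form a w v v) has_derivative (\<lambda>h. (c u)\<^sup>2 * dform a u h v v
        + (2 * c u * frechet_derivative c (at u) h) * form a u v v)) (at u)"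
      using has_derivative_mult[OF has_derivative_power[OF dc, of 2]
          has_derivative_form[OF assms(1) symmetric_onD(1)[OF \<open>symmetric_on S a\<close>] u, of v v]] by (simp add: mult_ac)
    then have "((\<lambda>w. form H w v v) has_derivative (\<lambda>h. (c u)\<^sup>2 * dform a u h v v
        + (2 * c u * frechet_derivative c (at u) h) * form a u v v)) (at u)"
      by (rule has_derivative_transform_within_open[OF _ assms(1) u]) (simp add: formH)
    from fun_cong[OF has_derivative_unique[OF has_derivative_form[OF assms(1) H(2) u] this], of v]
    have "dform H u v v v = (c u)\<^sup>2 * dform a u v v v + (2 * c u * frechet_derivative c (at u) v) * form a u v v" .
    then have 1: "dform H u v v v = (c u)\<^sup>2 * (dform a u v v v + 4 * (\<phi> \<bullet> v) * form a u v v)"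
      unfolding dcv by (simp add: algebra_simps power2_eq_square)
    \<comment> \<open>The derivative of \<open>H(v, v)\<close> is now computed a second time,
      through the spray of \<open>H\<close> itself; comparison with the product rule cancels the
      terms in \<open>\<phi>\<close>.\<close>
    have "spray H u v = spray G u v + (2 * (\<phi> \<bullet> v)) *\<^sub>R v" using \<phi>(1)[of v] by (simp add: algebra_simps)
    then have "form H u (spray H u v) v = form H u (spray G u v) v + 2 * (\<phi> \<bullet> v) * form H u v v"
      by (simp add: form_linear)
    then have "dform H u v v v = 2 * form H u v (spray G u v) + 4 * (\<phi> \<bullet> v) * form H u v v"
      using form_spray[OF assms(1,3) u, of v v] form_sym[of H u, OF H(3)[OF u], of v "spray G u v"] by simp
    then have "dform H u v v v = (c u)\<^sup>2 * (2 * form a u v (spray G u v) + 4 * (\<phi> \<bullet> v) * form a u v v)"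
      by (simp add: formH[OF u] algebra_simps)
    with 1 have "(c u)\<^sup>2 * dform a u v v v = (c u)\<^sup>2 * (2 * form a u v (spray G u v))" by algebra
    then show "dform a u v v v = 2 * form a u v (spray G u v)" using c0[OF u] by auto
  qed
qed

section \<open>Geodesics and changes of coordinates\<close>

lemma smooth_on_Pair:
  assumes "open S" "smooth_on S f" "smooth_on S g"
  shows "smooth_on S (\<lambda>x. (f x, g x))"
proof -
  have "smooth_on S (\<lambda>x. (f x, 0) + (0, g x))"
    by (intro smooth_on_add assms smooth_on_bounded_linear[OF _ assms(1,2), of "\<lambda>a. (a, 0)"]
        smooth_on_bounded_linear[OF _ assms(1,3), of "\<lambda>b. (0, b)"])
      (intro bounded_linear_Pair bounded_linear_ident bounded_linear_zero)+
  then show ?thesis by simp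
qed

lemma smooth_on_spray:
  assumes "open S" "open U" "metric_on U G" "smooth_on S a" "smooth_on S b" "a ` S \<subseteq> U"
  shows "smooth_on S (\<lambda>x. spray G (a x) (b x))"
proof (rule smooth_on_vec[OF assms(1)])
  fix k
  show "smooth_on S (\<lambda>x. spray G (a x) (b x) $ k)"
    unfolding spray_def vec_lambda_beta
    by (intro smooth_on_sum smooth_on_mult smooth_on_vec_nth assms(1,5)
        smooth_on_compose[OF assms(1,4) smooth_on_christoffel[OF assms(2,3)] assms(6)])
qed

lemma velocity_eqI: "(x has_vector_derivative v) (at t) \<Longrightarrow> velocity x t = v"
  unfolding velocity_def by (rule vector_derivative_at)

lemma velocity_cong:
  assumes "open T" "t \<in> T" "\<And>s. s \<in> T \<Longrightarrow> x s = y s"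
  shows "velocity x t = velocity y t"
proof -
  have "(x has_vector_derivative v) (at t) \<longleftrightarrow> (y has_vector_derivative v) (at t)" for v
    using has_vector_derivative_transform_within_open[OF _ assms(1,2), of x v y]
      has_vector_derivative_transform_within_open[OF _ assms(1,2), of y v x] assms(3) by metis
  then show ?thesis unfolding velocity_def vector_derivative_def by simp
qed

lemma smooth_on_has_velocity:
  assumes "smooth_on T x" "t \<in> T"
  shows "(x has_vector_derivative velocity x t) (at t)"
  using smooth_on_differentiable[OF assms] unfolding velocity_def by (simp add: vector_derivative_works)

lemma smooth_on_velocity:
  assumes "open T" "smooth_on T x"
  shows "smooth_on T (velocity x)"
proof (rule smooth_on_cong[OF smooth_on_frechet_derivative[OF assms(2), of 1] assms(1)])
  show "frechet_derivative x (at t) 1 = velocity x t" if "t \<in> T" for t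
    using frechet_derivative_eq_vector_derivative[OF smooth_on_differentiable[OF assms(2) that]]
    by (simp add: velocity_def)
qed

text \<open>The second order equation is solved as a first order system for pairs of position and
  velocity, over the product of the domain with the plane.\<close>

lemma chart_geodesic_exists:
  assumes "open U" "metric_on U G" "u \<in> U"
  obtains h x where "0 < h" "x 0 = u" "velocity x 0 = v" "smooth_on {-h<..<h} x"
    "\<And>t. t \<in> {-h<..<h} \<Longrightarrow> x t \<in> U"
    "\<And>t. t \<in> {-h<..<h} \<Longrightarrow> velocity (velocity x) t + spray G (x t) (velocity x t) = 0"
proof -
  let ?S = "U \<times> (UNIV :: (real^2) set)"
  let ?f = "\<lambda>p. (snd p, - spray G (fst p) (snd p))"
  have S: "open ?S" using assms(1) by (intro open_Times) auto
  have fst: "smooth_on ?S fst" and snd: "smooth_on ?S snd"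
    using smooth_on_bounded_linear[OF bounded_linear_fst S, of "\<lambda>x. x"]
      smooth_on_bounded_linear[OF bounded_linear_snd S, of "\<lambda>x. x"] S by auto
  have f: "smooth_on ?S ?f"
    by (intro smooth_on_Pair smooth_on_uminus smooth_on_spray[OF S assms(1,2)] fst snd S) auto
  obtain h z where h: "0 < h" "z 0 = (u, v)" and zS: "\<And>t. t \<in> {-h<..<h} \<Longrightarrow> z t \<in> ?S"
    and zd: "\<And>t. t \<in> {-h<..<h} \<Longrightarrow> (z has_vector_derivative ?f (z t)) (at t)"
    using ode_solution_exists[OF S _ f, of "(u, v)"] assms(3) by auto
  let ?T = "{-h<..<h}"
  have smz: "smooth_on ?T z"
    by (rule ode_solution_smooth[OF open_greaterThanLessThan f zS zd])
  define x where "x t = fst (z t)" for t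
  have smx: "smooth_on ?T x"
    unfolding x_def by (rule smooth_on_bounded_linear[OF bounded_linear_fst open_greaterThanLessThan smz])
  have v1: "velocity x t = snd (z t)" if "t \<in> ?T" for t
    unfolding x_def
    using bounded_linear.has_vector_derivative[OF bounded_linear_fst zd[OF that]] by (intro velocity_eqI) simp
  have v2: "velocity (velocity x) t = - spray G (x t) (velocity x t)" if t: "t \<in> ?T" for t
  proof -
    have "velocity (velocity x) t = velocity (\<lambda>t. snd (z t)) t"
      by (rule velocity_cong[OF open_greaterThanLessThan t v1])
    also have "\<dots> = - spray G (x t) (velocity x t)"
      unfolding v1[OF t] x_def
      using bounded_linear.has_vector_derivative[OF bounded_linear_snd zd[OF t]] by (intro velocity_eqI) simp
    finally show ?thesis .
  qed
  show ?thesis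
  proof
    show "0 < h" by fact
    show "x 0 = u" "velocity x 0 = v" using h v1[of 0] by (simp_all add: x_def)
    show "smooth_on ?T x" by fact
    show "x t \<in> U" if "t \<in> ?T" for t using zS[OF that] by (auto simp: x_def)
    show "velocity (velocity x) t + spray G (x t) (velocity x t) = 0" if "t \<in> ?T" for t
      using v2[OF that] by simp
  qed
qed

text \<open>Both the base point \<open>x s\<close> and the vector \<open>w s\<close> depend on the
  parameter. As in \<open>Ck_on_compose\<close>, a basis expansion of the vector separates the two
  dependencies.\<close>

lemma has_derivative_frechet_moving:
  fixes \<phi> :: "'a::euclidean_space \<Rightarrow> 'b::real_normed_vector"
  assumes "open U" "smooth_on U \<phi>" "open T" "t \<in> T" "\<And>s. s \<in> T \<Longrightarrow> x s \<in> U"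
    and x: "(x has_derivative x') (at t)" and w: "(w has_derivative w') (at t)"
  shows "((\<lambda>s. frechet_derivative \<phi> (at (x s)) (w s)) has_derivative
    (\<lambda>h. frechet_derivative (\<lambda>u. frechet_derivative \<phi> (at u) (w t)) (at (x t)) (x' h)
       + frechet_derivative \<phi> (at (x t)) (w' h))) (at t)"
proof -
  let ?D = "\<lambda>u. frechet_derivative \<phi> (at u)"
  have lin: "linear (?D u)" if "u \<in> U" for u
    using linear_frechet_derivative[OF smooth_on_differentiable[OF assms(2) that]] .
  have xt: "x t \<in> U" using assms(4,5) by blast
  have dD: "((\<lambda>u. ?D u v) has_derivative frechet_derivative (\<lambda>u. ?D u v) (at (x t))) (at (x t))" for v
    by (rule smooth_on_has_derivative[OF smooth_on_frechet_derivative[OF assms(2)] xt])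
  have e1: "frechet_derivative (\<lambda>u. ?D u (w t)) (at (x t)) k
    = (\<Sum>b\<in>Basis. (w t \<bullet> b) *\<^sub>R frechet_derivative (\<lambda>u. ?D u b) (at (x t)) k)" for k
  proof -
    have "((\<lambda>u. \<Sum>b\<in>Basis. (w t \<bullet> b) *\<^sub>R ?D u b) has_derivative
       (\<lambda>k. \<Sum>b\<in>Basis. (w t \<bullet> b) *\<^sub>R frechet_derivative (\<lambda>u. ?D u b) (at (x t)) k)) (at (x t))"
      by (intro has_derivative_sum has_derivative_scaleR_right dD)
    then have "((\<lambda>u. ?D u (w t)) has_derivative
       (\<lambda>k. \<Sum>b\<in>Basis. (w t \<bullet> b) *\<^sub>R frechet_derivative (\<lambda>u. ?D u b) (at (x t)) k)) (at (x t))"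
      by (rule has_derivative_transform_within_open[OF _ assms(1) xt]) (rule linear_expand_Basis[OF lin, symmetric])
    from fun_cong[OF has_derivative_unique[OF dD this]] show ?thesis .
  qed
  have "((\<lambda>s. \<Sum>b\<in>Basis. (w s \<bullet> b) *\<^sub>R ?D (x s) b) has_derivative
     (\<lambda>h. \<Sum>b\<in>Basis. (w t \<bullet> b) *\<^sub>R frechet_derivative (\<lambda>u. ?D u b) (at (x t)) (x' h) + (w' h \<bullet> b) *\<^sub>R ?D (x t) b)) (at t)"
    by (intro has_derivative_sum has_derivative_scaleR has_derivative_inner_left w
        has_derivative_compose[OF x dD])
  then have "((\<lambda>s. ?D (x s) (w s)) has_derivative
     (\<lambda>h. \<Sum>b\<in>Basis. (w t \<bullet> b) *\<^sub>R frechet_derivative (\<lambda>u. ?D u b) (at (x t)) (x' h) + (w' h \<bullet> b) *\<^sub>R ?D (x t) b)) (at t)"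
    by (rule has_derivative_transform_within_open[OF _ assms(3,4)])
      (rule linear_expand_Basis[OF lin, symmetric], rule assms(5))
  then show ?thesis
    by (rule has_derivative_eq_rhs) (simp add: e1 sum.distrib linear_expand_Basis[OF lin[OF xt], of "w' _"])
qed

lemma has_derivative_form_moving:
  fixes x a b :: "'c::real_normed_vector \<Rightarrow> real^2"
  assumes "open U" "smooth_on U G" "x t \<in> U"
    and x: "(x has_derivative x') (at t)" and a: "(a has_derivative a') (at t)" and b: "(b has_derivative b') (at t)"
  shows "((\<lambda>s. form G (x s) (a s) (b s)) has_derivative
    (\<lambda>h. dform G (x t) (x' h) (a t) (b t) + form G (x t) (a' h) (b t) + form G (x t) (a t) (b' h))) (at t)"
proof -
  have e: "((\<lambda>s. G (x s) $ i $ j) has_derivative (\<lambda>h. frechet_derivative (\<lambda>u. G u $ i $ j) (at (x t)) (x' h))) (at t)" for i j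
    using has_derivative_compose[OF x has_derivative_entry[OF assms(1-3)]] .
  have ai: "((\<lambda>s. a s $ i) has_derivative (\<lambda>h. a' h $ i)) (at t)"
    and bi: "((\<lambda>s. b s $ i) has_derivative (\<lambda>h. b' h $ i)) (at t)" for i
    using bounded_linear.has_derivative[OF bounded_linear_vec_nth] a b by blast+
  have m: "((\<lambda>s. G (x s) $ i $ j * a s $ i * b s $ j) has_derivative
     (\<lambda>h. (G (x t) $ i $ j * a t $ i) * b' h $ j
        + (G (x t) $ i $ j * a' h $ i + frechet_derivative (\<lambda>u. G u $ i $ j) (at (x t)) (x' h) * a t $ i) * b t $ j)) (at t)" for i j
    by (intro has_derivative_mult e ai bi)
  show ?thesis
    unfolding form_expand dform_expand[OF assms(1-3)]
    by (rule has_derivative_eq_rhs, (rule has_derivative_add m)+) (simp add: algebra_simps)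
qed

text \<open>Differentiating the pullback identity produces second derivatives of
  \<open>\<phi>\<close>. In the combination of \<open>form_spray\<close> their symmetry cancels all
  of them except the one tested against \<open>z\<close>. Surjectivity of the differential turns
  every test vector into some \<open>?D z\<close>, and nondegeneracy concludes.\<close>

lemma spray_transform:
  assumes "open U" "open V" "metric_on U G" "metric_on V H" "smooth_on U \<phi>" "\<phi> ` U \<subseteq> V" "u \<in> U"
    and form: "\<And>u v w. u \<in> U \<Longrightarrow> form G u v w =
      form H (\<phi> u) (frechet_derivative \<phi> (at u) v) (frechet_derivative \<phi> (at u) w)"
    and surj: "surj (frechet_derivative \<phi> (at u))"
  shows "spray H (\<phi> u) (frechet_derivative \<phi> (at u) v) = frechet_derivative \<phi> (at u) (spray G u v)
     - frechet_derivative (\<lambda>u. frechet_derivative \<phi> (at u) v) (at u) v"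
proof -
  let ?D = "frechet_derivative \<phi> (at u)"
  let ?D2 = "\<lambda>k v. frechet_derivative (\<lambda>u. frechet_derivative \<phi> (at u) v) (at u) k"
  have Vu: "\<phi> u \<in> V" using assms(6,7) by blast
  note G = metric_onD[OF assms(3)] and H = metric_onD[OF assms(4)]
  have dG: "dform G u k v w = dform H (\<phi> u) (?D k) (?D v) (?D w)
      + form H (\<phi> u) (?D2 k v) (?D w) + form H (\<phi> u) (?D v) (?D2 k w)" for k v w
  proof -
    have d: "((\<lambda>u. frechet_derivative \<phi> (at u) v) has_derivative (\<lambda>k. ?D2 k v)) (at u)" for v
      by (rule smooth_on_has_derivative[OF smooth_on_frechet_derivative[OF assms(5)] assms(7)])
    have "((\<lambda>u. form H (\<phi> u) (frechet_derivative \<phi> (at u) v) (frechet_derivative \<phi> (at u) w)) has_derivative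
      (\<lambda>k. dform H (\<phi> u) (?D k) (?D v) (?D w) + form H (\<phi> u) (?D2 k v) (?D w) + form H (\<phi> u) (?D v) (?D2 k w))) (at u)"
      by (rule has_derivative_form_moving[OF assms(2) H(2) Vu smooth_on_has_derivative[OF assms(5,7)] d d])
    then have "((\<lambda>u. form G u v w) has_derivative
      (\<lambda>k. dform H (\<phi> u) (?D k) (?D v) (?D w) + form H (\<phi> u) (?D2 k v) (?D w) + form H (\<phi> u) (?D v) (?D2 k w))) (at u)"
      by (rule has_derivative_transform_within_open[OF _ assms(1,7)]) (simp add: form)
    from has_derivative_unique[OF has_derivative_form[OF assms(1) G(2) assms(7)] this] show ?thesis by metis
  qed
  have D2sym: "?D2 k v = ?D2 v k" for k v
    by (rule second_derivative_symmetric[OF assms(1,5,7)])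
  have symH: "form H (\<phi> u) x y = form H (\<phi> u) y x" for x y by (rule form_sym[of H, OF H(3)[OF Vu]])
  have lin: "form H (\<phi> u) (x - y) z = form H (\<phi> u) x z - form H (\<phi> u) y z" for x y z
    by (simp add: form_expand algebra_simps)
  have "form H (\<phi> u) (spray H (\<phi> u) (?D v)) (?D z) = form H (\<phi> u) (?D (spray G u v) - ?D2 v v) (?D z)" for z
  proof -
    have "form H (\<phi> u) (?D (spray G u v)) (?D z) = dform G u v v z - (1/2) * dform G u z v v"
      using form_spray[OF assms(1,3,7), of v z] form[OF assms(7)] by simp
    also have "\<dots> = form H (\<phi> u) (spray H (\<phi> u) (?D v)) (?D z) + form H (\<phi> u) (?D2 v v) (?D z)"
      unfolding dG form_spray[OF assms(2,4) Vu]
      using symH[of "?D2 z v" "?D v"] D2sym[of v z] by (simp add: field_simps)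
    finally show ?thesis unfolding lin by simp
  qed
  then have "form H (\<phi> u) (spray H (\<phi> u) (?D v)) z = form H (\<phi> u) (?D (spray G u v) - ?D2 v v) z" for z
  proof -
    obtain y where "z = ?D y" using surjD[OF surj] by blast
    then show ?thesis using \<open>\<And>z. form H (\<phi> u) (spray H (\<phi> u) (?D v)) (?D z) = form H (\<phi> u) (?D (spray G u v) - ?D2 v v) (?D z)\<close>[of y]
      by simp
  qed
  then show ?thesis by (rule form_nondegenerate[of H, OF H(4)[OF Vu] H(3)[OF Vu]])
qed

lemma geodesic_equation_transform:
  assumes "open U" "open V" "metric_on U G" "metric_on V H" "smooth_on U \<phi>" "\<phi> ` U \<subseteq> V"
    and form: "\<And>u v w. u \<in> U \<Longrightarrow> form G u v w =
      form H (\<phi> u) (frechet_derivative \<phi> (at u) v) (frechet_derivative \<phi> (at u) w)"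
    and surj: "\<And>u. u \<in> U \<Longrightarrow> surj (frechet_derivative \<phi> (at u))"
    and T: "open T" "t \<in> T" "\<And>s. s \<in> T \<Longrightarrow> x s \<in> U" "smooth_on T x"
    and eq: "velocity (velocity x) t + spray G (x t) (velocity x t) = 0"
  shows "velocity (velocity (\<lambda>s. \<phi> (x s))) t + spray H (\<phi> (x t)) (velocity (\<lambda>s. \<phi> (x s)) t) = 0"
proof -
  let ?D = "\<lambda>u. frechet_derivative \<phi> (at u)"
  have lin: "linear (?D u)" if "u \<in> U" for u
    using linear_frechet_derivative[OF smooth_on_differentiable[OF assms(5) that]] .
  have hx: "(x has_derivative (\<lambda>h. h *\<^sub>R velocity x s)) (at s)" if "s \<in> T" for s
    using smooth_on_has_velocity[OF T(4) that] by (simp add: has_vector_derivative_def)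
  have v1: "velocity (\<lambda>s. \<phi> (x s)) s = ?D (x s) (velocity x s)" if "s \<in> T" for s
  proof (rule velocity_eqI)
    show "((\<lambda>s. \<phi> (x s)) has_vector_derivative ?D (x s) (velocity x s)) (at s)"
      using has_derivative_compose[OF hx[OF that] smooth_on_has_derivative[OF assms(5) T(3)[OF that]]]
      by (simp add: has_vector_derivative_def linear_scale[OF lin[OF T(3)[OF that]]])
  qed
  have "velocity (velocity (\<lambda>s. \<phi> (x s))) t = velocity (\<lambda>s. ?D (x s) (velocity x s)) t"
    by (rule velocity_cong[OF T(1,2) v1])
  also have "\<dots> = frechet_derivative (\<lambda>u. ?D u (velocity x t)) (at (x t)) (velocity x t)
      + ?D (x t) (velocity (velocity x) t)"
  proof (rule velocity_eqI)
    have hv: "(velocity x has_derivative (\<lambda>h. h *\<^sub>R velocity (velocity x) t)) (at t)"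
      using smooth_on_has_velocity[OF smooth_on_velocity[OF T(1,4)] T(2)] by (simp add: has_vector_derivative_def)
    have "linear (frechet_derivative (\<lambda>u. ?D u (velocity x t)) (at (x t)))"
      by (intro linear_frechet_derivative smooth_on_differentiable[OF smooth_on_frechet_derivative[OF assms(5)]] T(2,3))
    then show "((\<lambda>s. ?D (x s) (velocity x s)) has_vector_derivative
        frechet_derivative (\<lambda>u. ?D u (velocity x t)) (at (x t)) (velocity x t) + ?D (x t) (velocity (velocity x) t)) (at t)"
      using has_derivative_frechet_moving[OF assms(1,5) T(1,2,3) hx[OF T(2)] hv]
      by (simp add: has_vector_derivative_def linear_scale linear_scale[OF lin[OF T(3)[OF T(2)]]] scaleR_add_right)
  qed
  finally have "velocity (velocity (\<lambda>s. \<phi> (x s))) t = \<dots>" .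
  moreover have "velocity (velocity x) t = - spray G (x t) (velocity x t)" using eq by (simp add: eq_neg_iff_add_eq_0)
  ultimately show ?thesis
    unfolding v1[OF T(2)] spray_transform[OF assms(1-6) T(3)[OF T(2)] form surj[OF T(3)[OF T(2)]], simplified]
    by (simp add: linear_neg[OF lin[OF T(3)[OF T(2)]]])
qed

section \<open>Charts of a surface\<close>

lemma topological_chartD:
  assumes "topological_chart c"
  shows "open (chart_dom c)" "open (chart_img c)"
    "u \<in> chart_img c \<Longrightarrow> chart_inv c u \<in> chart_dom c" "u \<in> chart_img c \<Longrightarrow> coords c (chart_inv c u) = u"
    "p \<in> chart_dom c \<Longrightarrow> coords c p \<in> chart_img c" "p \<in> chart_dom c \<Longrightarrow> chart_inv c (coords c p) = p"
    "continuous_on (chart_dom c) (coords c)" "continuous_on (chart_img c) (chart_inv c)"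
  using assms unfolding topological_chart_def homeomorphism_def by auto

lemma open_coords_image:
  assumes "topological_chart c" "open B"
  shows "open (coords c ` (chart_dom c \<inter> B))"
proof -
  note c = topological_chartD[OF assms(1)]
  have "coords c ` (chart_dom c \<inter> B) = chart_img c \<inter> chart_inv c -` B"
  proof (intro equalityI subsetI)
    fix u assume "u \<in> coords c ` (chart_dom c \<inter> B)"
    then show "u \<in> chart_img c \<inter> chart_inv c -` B" using c(5,6) by auto
  next
    fix u assume "u \<in> chart_img c \<inter> chart_inv c -` B"
    then show "u \<in> coords c ` (chart_dom c \<inter> B)" using c(3,4) by (metis IntE IntI imageI vimageE)
  qed
  then show ?thesis using continuous_open_preimage[OF c(8) c(2) assms(2)] by simp
qed

lemma smooth_surfaceD:
  assumes "smooth_surface M A"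
  shows "connected M" "(\<Union>c\<in>A. chart_dom c) = M" "c \<in> A \<Longrightarrow> topological_chart c"
    "c \<in> A \<Longrightarrow> chart_dom c \<subseteq> M"
    "c \<in> A \<Longrightarrow> c' \<in> A \<Longrightarrow> smooth_on (coords c ` (chart_dom c \<inter> chart_dom c')) (transition c c')"
    "topological_chart c \<Longrightarrow> chart_dom c \<subseteq> M \<Longrightarrow> (\<And>c'. c' \<in> A \<Longrightarrow> smoothly_compatible c c') \<Longrightarrow> c \<in> A"
  using assms unfolding smooth_surface_def smoothly_compatible_def by blast+

lemma surface_metric_on:
  assumes "surface_metric A g" "c \<in> A"
  shows "metric_on (chart_img c) (g c)"
proof -
  have "smooth_on (chart_img c) (g c)" and
    *: "\<And>u. u \<in> chart_img c \<Longrightarrow> transpose (g c u) = g c u \<and> det (g c u) \<noteq> 0"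
    using assms unfolding surface_metric_def by blast+
  moreover have "g c u $ 2 $ 1 = g c u $ 1 $ 2" if "u \<in> chart_img c" for u
  proof -
    have "transpose (g c u) $ 1 $ 2 = g c u $ 1 $ 2" using *[OF that] by simp
    then show ?thesis by (simp add: transpose_def)
  qed
  ultimately show ?thesis unfolding metric_on_def symmetric_on_def by blast
qed

text \<open>Surjectivity follows from the determinant: the Gram matrix in \<open>c\<close> is a
  product containing the Jacobian twice, and it is nondegenerate.\<close>

lemma metric_transform:
  assumes M: "smooth_surface M A" and g: "surface_metric A g" and c: "c \<in> A" "c' \<in> A"
    and u: "u \<in> coords c ` (chart_dom c \<inter> chart_dom c')"
  shows "form (g c) u v w = form (g c') (transition c c' u)
      (frechet_derivative (transition c c') (at u) v) (frechet_derivative (transition c c') (at u) w)"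
    and "surj (frechet_derivative (transition c c') (at u))"
proof -
  obtain p where p: "p \<in> chart_dom c \<inter> chart_dom c'" "u = coords c p" using u by blast
  let ?\<phi> = "transition c c'" let ?J = "jacobian ?\<phi> (at u)"
  note tc = topological_chartD[OF smooth_surfaceD(3)[OF M c(1)]]
  note tc' = topological_chartD[OF smooth_surfaceD(3)[OF M c(2)]]
  have \<phi>u: "?\<phi> u = coords c' p" using p tc(6) by (simp add: transition_def)
  have "(?\<phi> has_derivative frechet_derivative ?\<phi> (at u)) (at u)"
    by (rule smooth_on_has_derivative[OF smooth_surfaceD(5)[OF M c] u])
  then have J: "frechet_derivative ?\<phi> (at u) v = ?J *v v" for v
    unfolding jacobian_def by (simp add: matrix_works has_derivative_linear)
  have "\<forall>p \<in> chart_dom c \<inter> chart_dom c'.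
        (let J = jacobian (transition c c') (at (coords c p))
         in g c (coords c p) = transpose J ** g c' (coords c' p) ** J)"
    using g c unfolding surface_metric_def by blast
  from bspec[OF this p(1)] have e: "g c u = transpose ?J ** g c' (?\<phi> u) ** ?J"
    unfolding \<phi>u Let_def p(2)[symmetric] .
  have "form (g c) u v w = v \<bullet> (transpose ?J *v (g c' (?\<phi> u) *v (?J *v w)))"
    unfolding form_def e by (simp add: matrix_vector_mul_assoc matrix_mul_assoc)
  also have "\<dots> = (?J *v v) \<bullet> (g c' (?\<phi> u) *v (?J *v w))"
    using dot_lmul_matrix[of v "transpose ?J" "g c' (?\<phi> u) *v (?J *v w)"] by (simp add: vector_transpose_matrix)
  finally show "form (g c) u v w = form (g c') (?\<phi> u) (frechet_derivative ?\<phi> (at u) v) (frechet_derivative ?\<phi> (at u) w)"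
    by (simp add: J form_def)
  have "det (g c u) \<noteq> 0" using metric_onD(4)[OF surface_metric_on[OF g c(1)]] p tc(5) by blast
  then have "det ?J \<noteq> 0" unfolding e by (auto simp: det_mul)
  then have "?J *v (matrix_inv ?J *v w) = w" for w
    using matrix_inv_right[of ?J] by (simp add: matrix_vector_mul_assoc)
  then show "surj (frechet_derivative ?\<phi> (at u))" unfolding surj_def J by metis
qed

lemma geodesic_equation_iff:
  "(\<forall>k. velocity (velocity x) t $ k + (\<Sum>i\<in>UNIV. \<Sum>j\<in>UNIV.
      christoffel G (x t) k i j * velocity x t $ i * velocity x t $ j) = 0)
   \<longleftrightarrow> velocity (velocity x) t + spray G (x t) (velocity x t) = 0"
  by (simp add: vec_eq_iff spray_def)

lemma transition_image:
  assumes "topological_chart c" "topological_chart c'"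
  shows "transition c c' ` (coords c ` (chart_dom c \<inter> chart_dom c')) \<subseteq> chart_img c'"
  using topological_chartD(6)[OF assms(1)] topological_chartD(5)[OF assms(2)] by (auto simp: transition_def)

text \<open>\<open>geodesic\<close> asks for the equation in every chart of the maximal atlas; the
  transformation law carries it over from the single chart \<open>c\<close>.\<close>

lemma geodesicI_chart:
  assumes M: "smooth_surface M A" and g: "surface_metric A g" and c: "c \<in> A"
    and I: "open I" "is_interval I" and x: "smooth_on I x" "\<And>t. t \<in> I \<Longrightarrow> x t \<in> chart_img c"
    and eq: "\<And>t. t \<in> I \<Longrightarrow> velocity (velocity x) t + spray (g c) (x t) (velocity x t) = 0"
  shows "geodesic A g I (chart_inv c \<circ> x)"
proof -
  let ?\<gamma> = "chart_inv c \<circ> x"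
  note tc = topological_chartD[OF smooth_surfaceD(3)[OF M c]]
  have cont: "continuous_on I ?\<gamma>"
    by (rule continuous_on_compose[OF smooth_on_imp_continuous_on[OF x(1)]])
      (rule continuous_on_subset[OF tc(8)], use x(2) in blast)
  show ?thesis
    unfolding geodesic_def Let_def
  proof (intro conjI I cont ballI)
    show "?\<gamma> ` I \<subseteq> (\<Union>c\<in>A. chart_dom c)" using x(2) tc(3) c by auto
    fix c' assume c': "c' \<in> A"
    note tc' = topological_chartD[OF smooth_surfaceD(3)[OF M c']]
    let ?T = "{t \<in> I. ?\<gamma> t \<in> chart_dom c'}" and ?U = "coords c ` (chart_dom c \<inter> chart_dom c')"
    let ?\<phi> = "transition c c'"
    have T: "open ?T"
      using continuous_open_preimage[OF cont I(1) tc'(1)] by (simp add: vimage_def Int_def)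
    have U: "open ?U" by (rule open_coords_image[OF smooth_surfaceD(3)[OF M c] tc'(1)])
    have xU: "x t \<in> ?U" if "t \<in> ?T" for t
    proof
      show "x t = coords c (chart_inv c (x t))" using that x(2) tc(4) by simp
      show "chart_inv c (x t) \<in> chart_dom c \<inter> chart_dom c'" using that x(2) tc(3) by simp
    qed
    have sub: "?U \<subseteq> chart_img c" using tc(5) by auto
    have comp: "coords c' \<circ> ?\<gamma> = (\<lambda>s. ?\<phi> (x s))" by (auto simp: transition_def)
    have smx: "smooth_on ?T x" by (rule smooth_on_subset[OF x(1)]) auto
    show "smooth_on ?T (coords c' \<circ> ?\<gamma>)"
      unfolding comp using xU by (intro smooth_on_compose[OF T smx smooth_surfaceD(5)[OF M c c']]) blast
    fix t assume t: "t \<in> ?T"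
    have "velocity (velocity (\<lambda>s. ?\<phi> (x s))) t + spray (g c') (?\<phi> (x t)) (velocity (\<lambda>s. ?\<phi> (x s)) t) = 0"
    proof (rule geodesic_equation_transform[OF U tc'(2) _ surface_metric_on[OF g c'] smooth_surfaceD(5)[OF M c c']
          transition_image[OF smooth_surfaceD(3)[OF M c] smooth_surfaceD(3)[OF M c']] _ _ T t xU smx])
      show "metric_on ?U (g c)" using surface_metric_on[OF g c] sub by (rule metric_on_subset)
      show "velocity (velocity x) t + spray (g c) (x t) (velocity x t) = 0" using eq t by blast
    qed (use metric_transform[OF M g c c'] in auto)
    then show "\<forall>k. velocity (velocity (coords c' \<circ> ?\<gamma>)) t $ k + (\<Sum>i\<in>UNIV. \<Sum>j\<in>UNIV.
      christoffel (g c') ((coords c' \<circ> ?\<gamma>) t) k i j * velocity (coords c' \<circ> ?\<gamma>) t $ i * velocity (coords c' \<circ> ?\<gamma>) t $ j) = 0"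
      unfolding geodesic_equation_iff unfolding comp .
  qed
qed

section \<open>Reparametrized geodesics and the pointwise meaning of projective equivalence\<close>

lemma spray_scale: "spray G u (r *\<^sub>R v) = r\<^sup>2 *\<^sub>R spray G u v"
  by (simp add: spray_def vec_eq_iff sum_distrib_left power2_eq_square mult_ac)

lemma velocity_reparam:
  fixes \<tau> :: "real \<Rightarrow> real"
  assumes "open J" "s \<in> J" "smooth_on J \<tau>" "open I" "smooth_on I x" "\<tau> ` J \<subseteq> I"
  shows "velocity (\<lambda>s. x (\<tau> s)) s = deriv \<tau> s *\<^sub>R velocity x (\<tau> s)"
    "velocity (velocity (\<lambda>s. x (\<tau> s))) s =
      deriv (deriv \<tau>) s *\<^sub>R velocity x (\<tau> s) + (deriv \<tau> s)\<^sup>2 *\<^sub>R velocity (velocity x) (\<tau> s)"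
proof -
  have \<tau>: "(\<tau> has_real_derivative deriv \<tau> t) (at t)" if "t \<in> J" for t
    using smooth_on_differentiable[OF assms(3) that] DERIV_deriv_iff_real_differentiable by blast
  have v: "velocity (\<lambda>s. x (\<tau> s)) t = deriv \<tau> t *\<^sub>R velocity x (\<tau> t)" if "t \<in> J" for t
    by (rule velocity_eqI)
      (use vector_diff_chain_at[of \<tau> "deriv \<tau> t" t x "velocity x (\<tau> t)"] \<tau>[OF that]
        smooth_on_has_velocity[OF assms(5), of "\<tau> t"] assms(6) that
        in \<open>auto simp: o_def has_real_derivative_iff_has_vector_derivative image_subset_iff\<close>)
  then show "velocity (\<lambda>s. x (\<tau> s)) s = deriv \<tau> s *\<^sub>R velocity x (\<tau> s)" using assms(2) by blast
  have "frechet_derivative \<tau> (at t) 1 = deriv \<tau> t" if "t \<in> J" for t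
    using fun_cong[OF frechet_derivative_at[OF \<tau>[OF that, unfolded has_field_derivative_def]], of 1] by simp
  then have "smooth_on J (deriv \<tau>)"
    by (rule smooth_on_cong[OF smooth_on_frechet_derivative[OF assms(3), of 1] assms(1)])
  then have d2: "(deriv \<tau> has_real_derivative deriv (deriv \<tau>) s) (at s)"
    using smooth_on_differentiable[OF _ assms(2)] DERIV_deriv_iff_real_differentiable by blast
  have "((\<lambda>s. velocity x (\<tau> s)) has_vector_derivative deriv \<tau> s *\<^sub>R velocity (velocity x) (\<tau> s)) (at s)"
    using vector_diff_chain_at[of \<tau> "deriv \<tau> s" s "velocity x" "velocity (velocity x) (\<tau> s)"] \<tau>[OF assms(2)]
      smooth_on_has_velocity[OF smooth_on_velocity[OF assms(4,5)], of "\<tau> s"] assms(2,6)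
    by (auto simp: o_def has_real_derivative_iff_has_vector_derivative image_subset_iff)
  from has_vector_derivative_scaleR[OF d2 this]
  have "((\<lambda>s. deriv \<tau> s *\<^sub>R velocity x (\<tau> s)) has_vector_derivative
      deriv \<tau> s *\<^sub>R (deriv \<tau> s *\<^sub>R velocity (velocity x) (\<tau> s)) + deriv (deriv \<tau>) s *\<^sub>R velocity x (\<tau> s)) (at s)" .
  note 1 = velocity_eqI[OF this]
  have "velocity (velocity (\<lambda>s. x (\<tau> s))) s = velocity (\<lambda>s. deriv \<tau> s *\<^sub>R velocity x (\<tau> s)) s"
    by (rule velocity_cong[OF assms(1,2) v])
  then show "velocity (velocity (\<lambda>s. x (\<tau> s))) s =
      deriv (deriv \<tau>) s *\<^sub>R velocity x (\<tau> s) + (deriv \<tau> s)\<^sup>2 *\<^sub>R velocity (velocity x) (\<tau> s)"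
    unfolding 1 by (simp add: power2_eq_square add.commute)
qed

text \<open>Any \<open>u\<close> and \<open>v\<close> are the initial data of a geodesic of
  \<open>gbar\<close>, which after some \<open>\<tau>\<close> becomes a geodesic of
  \<open>g\<close>. At the parameter over time 0 the chain rule gives
  \<open>\<tau>'' v = (\<tau>')\<^sup>2 (spray gbar - spray g)\<close>, and \<open>\<tau>'\<close>
  is nonzero there.\<close>

lemma projectively_equivalent_sprays:
  assumes M: "smooth_surface M A" and g: "surface_metric A g" and h: "surface_metric A gbar"
    and P: "projectively_equivalent A g gbar" and c: "c \<in> A" and u: "u \<in> chart_img c"
  shows "parallel (spray (gbar c) u v - spray (g c) u v) v"
proof -
  note tc = topological_chartD[OF smooth_surfaceD(3)[OF M c]]
  obtain h x where x: "0 < h" "x 0 = u" "velocity x 0 = v" "smooth_on {-h<..<h} x"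
    "\<And>t. t \<in> {-h<..<h} \<Longrightarrow> x t \<in> chart_img c"
    "\<And>t. t \<in> {-h<..<h} \<Longrightarrow> velocity (velocity x) t + spray (gbar c) (x t) (velocity x t) = 0"
    using chart_geodesic_exists[OF tc(2) surface_metric_on[OF h c] u] by metis
  let ?I = "{-h<..<h}"
  have "geodesic A gbar ?I (chart_inv c \<circ> x)"
    by (rule geodesicI_chart[OF M h c _ _ x(4-6)]) (auto simp: is_interval_oo)
  then obtain J \<tau> where J: "open J" "smooth_on J \<tau>" "\<forall>t\<in>J. deriv \<tau> t \<noteq> 0" "\<tau> ` J = ?I"
    and geo: "geodesic A g J (chart_inv c \<circ> x \<circ> \<tau>)"
    using P[unfolded projectively_equivalent_def, rule_format] by metis
  have "0 \<in> \<tau> ` J" using J(4) x(1) by simp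
  then obtain s where s: "s \<in> J" "\<tau> s = 0" by auto
  let ?y = "coords c \<circ> (chart_inv c \<circ> x \<circ> \<tau>)" and ?T = "{t \<in> J. (chart_inv c \<circ> x \<circ> \<tau>) t \<in> chart_dom c}"
  have \<tau>I: "\<tau> t \<in> ?I" if "t \<in> J" for t using J(4) that by blast
  have T: "?T = J" using tc(3)[OF x(5)[OF \<tau>I]] by auto
  have "\<forall>t\<in>?T. \<forall>k. velocity (velocity ?y) t $ k + (\<Sum>i\<in>UNIV. \<Sum>j\<in>UNIV.
              christoffel (g c) (?y t) k i j * velocity ?y t $ i * velocity ?y t $ j) = 0"
    using geo c unfolding geodesic_def Let_def by blast
  then have eq: "velocity (velocity ?y) s + spray (g c) (?y s) (velocity ?y s) = 0"
    unfolding T geodesic_equation_iff using s(1) by blast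
  have yx: "?y t = x (\<tau> t)" if "t \<in> J" for t using tc(4)[OF x(5)[OF \<tau>I[OF that]]] by simp
  have v1: "velocity ?y t = velocity (\<lambda>s. x (\<tau> s)) t" if "t \<in> J" for t
    by (rule velocity_cong[OF J(1) that yx])
  have v2: "velocity (velocity ?y) s = velocity (velocity (\<lambda>s. x (\<tau> s))) s"
    by (rule velocity_cong[OF J(1) s(1) v1])
  have sub: "\<tau> ` J \<subseteq> ?I" using J(4) by simp
  note vr = velocity_reparam[OF J(1) s(1) J(2) open_greaterThanLessThan x(4) sub]
  have a: "velocity (velocity x) 0 = - spray (gbar c) u v"
    using x(6)[of 0] x(1-3) by (simp add: eq_neg_iff_add_eq_0)
  have "deriv (deriv \<tau>) s *\<^sub>R v = (deriv \<tau> s)\<^sup>2 *\<^sub>R (spray (gbar c) u v - spray (g c) u v)"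
    using eq unfolding v2 v1[OF s(1)] vr yx[OF s(1)] s(2) x(2,3) a spray_scale
    by (simp add: algebra_simps)
  moreover have "deriv \<tau> s \<noteq> 0" using J(3) s(1) by blast
  ultimately have "spray (gbar c) u v - spray (g c) u v = (deriv (deriv \<tau>) s / (deriv \<tau> s)\<^sup>2) *\<^sub>R v"
    by (metis (no_types, lifting) divide_inverse_commute power_not_zero scaleR_scaleR left_inverse scaleR_one)
  then show ?thesis by (simp add: parallel_def)
qed

text \<open>The image is a box so that the values of one coordinate form an interval and the level
  sets of a coordinate are convex; \<open>function_of_coordinate\<close> relies on both.\<close>

definition box_diffeo :: "(real^2) set \<Rightarrow> (real^2 \<Rightarrow> real^2) \<Rightarrow> (real^2 \<Rightarrow> real^2) \<Rightarrow> real^2 \<Rightarrow> real^2 \<Rightarrow> bool" where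
  "box_diffeo D \<psi> \<eta> a b \<longleftrightarrow> open D \<and> smooth_on D \<psi> \<and> smooth_on (box a b) \<eta> \<and>
     (\<forall>u\<in>D. \<psi> u \<in> box a b \<and> \<eta> (\<psi> u) = u) \<and> (\<forall>y\<in>box a b. \<eta> y \<in> D \<and> \<psi> (\<eta> y) = y)"

lemma box_diffeoD:
  assumes "box_diffeo D \<psi> \<eta> a b"
  shows "open D" "smooth_on D \<psi>" "smooth_on (box a b) \<eta>"
    "u \<in> D \<Longrightarrow> \<psi> u \<in> box a b" "u \<in> D \<Longrightarrow> \<eta> (\<psi> u) = u" "y \<in> box a b \<Longrightarrow> \<eta> y \<in> D" "y \<in> box a b \<Longrightarrow> \<psi> (\<eta> y) = y"
    "\<psi> ` D = box a b"
  using assms unfolding box_diffeo_def by (auto simp: image_iff) metis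

lemma jacobian_frechet:
  fixes f :: "real^'n \<Rightarrow> real^'m"
  shows "f differentiable (at u) \<Longrightarrow> frechet_derivative f (at u) v = jacobian f (at u) *v v"
  using fun_cong[OF frechet_derivative_at, of f "\<lambda>h. jacobian f (at u) *v h" u v] jacobian_works[of f "at u"] by simp

lemma box_diffeo_inverse_derivative:
  assumes "box_diffeo D \<psi> \<eta> a b" "y \<in> box a b"
  shows "frechet_derivative \<psi> (at (\<eta> y)) (frechet_derivative \<eta> (at y) w) = w"
proof -
  note d = box_diffeoD[OF assms(1)]
  have "((\<lambda>y. \<psi> (\<eta> y)) has_derivative (\<lambda>w. frechet_derivative \<psi> (at (\<eta> y)) (frechet_derivative \<eta> (at y) w))) (at y)"
    by (rule has_derivative_compose[OF smooth_on_has_derivative[OF d(3) assms(2)] smooth_on_has_derivative[OF d(2) d(6)[OF assms(2)]]])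
  then have "((\<lambda>y. y) has_derivative (\<lambda>w. frechet_derivative \<psi> (at (\<eta> y)) (frechet_derivative \<eta> (at y) w))) (at y)"
    by (rule has_derivative_transform_within_open[OF _ open_box assms(2)]) (rule d(7))
  from fun_cong[OF has_derivative_unique[OF this has_derivative_ident]] show ?thesis .
qed

text \<open>The inverse function theorem gives a local inverse \<open>g\<close> whose derivative is
  the inverse of the Jacobian at \<open>g y\<close>. Inverse matrices depend smoothly on nonsingular
  ones, so this identity raises the regularity of \<open>g\<close> one order at a time.\<close>

lemma box_diffeo_exists:
  fixes \<psi> :: "real^2 \<Rightarrow> real^2"
  assumes "open S" "q \<in> S" and \<psi>: "smooth_on S \<psi>" and det: "det (jacobian \<psi> (at q)) \<noteq> 0"
  obtains D \<eta> a b where "D \<subseteq> S" "q \<in> D" "box_diffeo D \<psi> \<eta> a b"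
proof -
  let ?J = "\<lambda>u. jacobian \<psi> (at u)"
  define f' where "f' u = Blinfun (\<lambda>v. ?J u *v v)" for u
  have f': "blinfun_apply (f' u) = (\<lambda>v. ?J u *v v)" for u
    unfolding f'_def by (rule bounded_linear_Blinfun_apply) (rule matrix_vector_mul_bounded_linear)
  have diff: "\<psi> differentiable (at u)" if "u \<in> S" for u using smooth_on_differentiable[OF \<psi> that] .
  have derf: "(\<psi> has_derivative blinfun_apply (f' u)) (at u)" if "u \<in> S" for u
    unfolding f' using diff[OF that] jacobian_works by blast
  have contf: "continuous_on S f'"
  proof (rule continuous_on_blinfun_componentwise)
    fix i :: "real^2"
    have "continuous_on S (\<lambda>u. frechet_derivative \<psi> (at u) i)"
      by (rule smooth_on_imp_continuous_on[OF smooth_on_frechet_derivative[OF \<psi>]])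
    then show "continuous_on S (\<lambda>u. blinfun_apply (f' u) i)"
      by (rule continuous_on_eq) (simp add: f' jacobian_frechet[OF diff])
  qed
  define K where "K = Blinfun (\<lambda>v. matrix_inv (?J q) *v v)"
  have K: "blinfun_apply K = (\<lambda>v. matrix_inv (?J q) *v v)"
    unfolding K_def by (rule bounded_linear_Blinfun_apply) (rule matrix_vector_mul_bounded_linear)
  have inv: "K o\<^sub>L f' q = id_blinfun"
    by (rule blinfun_eqI) (simp add: K f' matrix_vector_mul_assoc matrix_inv_left[OF det])
  obtain U V g g' where U: "open U" "U \<subseteq> S" "q \<in> U" "open V" "\<psi> q \<in> V" "homeomorphism U V \<psi> g"
    and g: "\<And>y. y \<in> V \<Longrightarrow> (g has_derivative (g' y)) (at y)"
    and g': "\<And>y. y \<in> V \<Longrightarrow> g' y = inv (blinfun_apply (f'(g y)))"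
    and bij: "\<And>y. y \<in> V \<Longrightarrow> bij (blinfun_apply (f'(g y)))"
    using inverse_function_theorem[OF \<open>open S\<close> derf contf \<open>q \<in> S\<close> inv] by metis
  obtain e where e: "0 < e" "ball (\<psi> q) e \<subseteq> V" using U(4,5) open_contains_ball by blast
  obtain a b where ab: "\<psi> q \<in> box a b" "box a b \<subseteq> V"
    using rational_boxes[OF e(1), of "\<psi> q"] e(2) by blast
  let ?B = "box a b"
  have hom: "\<And>u. u \<in> U \<Longrightarrow> g (\<psi> u) = u" "\<And>y. y \<in> V \<Longrightarrow> \<psi> (g y) = y" "\<And>y. y \<in> V \<Longrightarrow> g y \<in> U"
    "continuous_on U \<psi>" "continuous_on V g"
    using U(6) unfolding homeomorphism_def by auto
  let ?D = "U \<inter> \<psi> -` ?B"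
  have D: "open ?D" using continuous_open_preimage[OF hom(4) U(1) open_box] .
  have gS: "g y \<in> S" if "y \<in> ?B" for y using hom(3) U(2) ab(2) that by blast
  have detg: "det (?J (g y)) \<noteq> 0" if "y \<in> V" for y
  proof -
    have "inj ((*v) (?J (g y)))" using bij[OF that] unfolding f' by (simp add: bij_def)
    then show ?thesis using det_nz_iff_inj[OF matrix_vector_mul_linear, of "?J (g y)"] by simp
  qed
  have dg: "(g has_derivative (\<lambda>w. matrix_inv (?J (g y)) *v w)) (at y)" if "y \<in> ?B" for y
  proof -
    have V: "y \<in> V" using that ab(2) by blast
    have "inv ((*v) (?J (g y))) = (\<lambda>w. matrix_inv (?J (g y)) *v w)"
      by (rule inv_equality)
        (simp_all add: matrix_vector_mul_assoc matrix_inv_left[OF detg[OF V]] matrix_inv_right[OF detg[OF V]])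
    then show ?thesis using g[OF V] unfolding g'[OF V] f' by simp
  qed
  let ?S' = "{u \<in> S. det (?J u) \<noteq> 0}"
  have J: "smooth_on S (\<lambda>u. ?J u)"
  proof (rule smooth_on_vec[OF \<open>open S\<close>], rule smooth_on_vec[OF \<open>open S\<close>])
    fix i j
    have "smooth_on S (\<lambda>u. frechet_derivative \<psi> (at u) (axis j 1) $ i)"
      by (intro smooth_on_vec_nth smooth_on_frechet_derivative \<psi> \<open>open S\<close>)
    then show "smooth_on S (\<lambda>u. ?J u $ i $ j)" by (simp add: jacobian_def matrix_def)
  qed
  have S': "open ?S'"
  proof -
    have "open (S \<inter> (\<lambda>u. det (?J u)) -` (- {0}))"
      by (rule continuous_open_preimage[OF smooth_on_imp_continuous_on[OF smooth_on_det[OF \<open>open S\<close> J]] \<open>open S\<close>]) auto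
    also have "S \<inter> (\<lambda>u. det (?J u)) -` (- {0}) = ?S'" by auto
    finally show ?thesis .
  qed
  have inv_smooth: "smooth_on ?S' (\<lambda>u. matrix_inv (?J u) $ k $ l)" for k l
    by (rule smooth_on_matrix_inv[OF S' smooth_on_subset[OF J]]) auto
  have gS': "g ` ?B \<subseteq> ?S'" using gS detg ab(2) by blast
  have "Ck_on k ?B g" for k
  proof (induction k)
    case 0
    show ?case using continuous_on_subset[OF hom(5) ab(2)] by simp
  next
    case (Suc k)
    show ?case
    proof (rule Ck_on_SucI[OF open_box dg])
      fix v
      show "Ck_on k ?B (\<lambda>y. matrix_inv (?J (g y)) *v v)"
      proof (rule Ck_on_vec[OF open_box])
        fix i
        have "Ck_on k ?B (\<lambda>y. \<Sum>j\<in>UNIV. matrix_inv (?J (g y)) $ i $ j * v $ j)"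
          by (intro Ck_on_sum[OF open_box] Ck_on_bilinear[OF bounded_bilinear_mult open_box]
              Ck_on_compose[OF open_box Suc _ gS'] Ck_on_const)
            (use inv_smooth in \<open>simp add: smooth_on_def\<close>)
        then show "Ck_on k ?B (\<lambda>y. (matrix_inv (?J (g y)) *v v) $ i)"
          by (simp add: matrix_vector_mult_def)
      qed
    qed
  qed
  then have "smooth_on ?B g" by (simp add: smooth_on_def)
  then have "box_diffeo ?D \<psi> g a b"
    unfolding box_diffeo_def using D smooth_on_subset[OF \<psi>, of ?D] U(2) hom(1-3) ab(2) by auto
  moreover have "?D \<subseteq> S" "q \<in> ?D" using U ab(1) by auto
  ultimately show ?thesis using that by blast
qed

text \<open>Transitions out of \<open>c'\<close> are those out of \<open>c\<close> preceded by
  \<open>\<eta>\<close>, and transitions into \<open>c'\<close> are those into \<open>c\<close>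
  followed by \<open>\<psi>\<close>. Hence \<open>c'\<close> is compatible with all charts and
  belongs to the maximal atlas.\<close>

lemma new_chart:
  assumes M: "smooth_surface M A" and c: "c \<in> A" and D: "D \<subseteq> chart_img c" and bd: "box_diffeo D \<psi> \<eta> a b"
  defines "c' \<equiv> (chart_inv c ` D, \<psi> \<circ> coords c)"
  shows "c' \<in> A" "chart_img c' = box a b" "u \<in> D \<Longrightarrow> chart_inv c u \<in> chart_dom c'"
    "\<And>g u v w. surface_metric A g \<Longrightarrow> u \<in> D \<Longrightarrow> form (g c) u v w =
       form (g c') (\<psi> u) (frechet_derivative \<psi> (at u) v) (frechet_derivative \<psi> (at u) w)"
proof -
  note tc0 = smooth_surfaceD(3)[OF M c]
  note tc = topological_chartD[OF tc0] and d = box_diffeoD[OF bd]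
  have dom: "chart_dom c' = chart_inv c ` D" and co: "coords c' = \<psi> \<circ> coords c"
    by (simp_all add: c'_def chart_dom_def coords_def)
  have co_inv: "coords c (chart_inv c u) = u" if "u \<in> D" for u using tc(4) D that by blast
  have co': "coords c' (chart_inv c u) = \<psi> u" if "u \<in> D" for u by (simp add: co co_inv[OF that])
  show img: "chart_img c' = box a b"
    unfolding chart_img_def dom image_image using co' d(8) by simp
  have inj: "inj_on (coords c') (chart_dom c')"
    unfolding dom by (rule inj_onI) (metis imageE co' d(5))
  have ci: "chart_inv c' y = chart_inv c (\<eta> y)" if "y \<in> box a b" for y
  proof -
    have "chart_inv c (\<eta> y) \<in> chart_dom c'" unfolding dom using d(6)[OF that] by blast
    moreover have "coords c' (chart_inv c (\<eta> y)) = y" using co' d(6,7) that by simp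
    ultimately show ?thesis unfolding chart_inv_def[of c'] by (metis inv_into_f_f inj)
  qed
  have domeq: "chart_dom c' = chart_dom c \<inter> coords c -` D"
  proof (intro equalityI subsetI)
    fix p assume "p \<in> chart_dom c'"
    then show "p \<in> chart_dom c \<inter> coords c -` D" unfolding dom using tc(3) D co_inv by auto
  next
    fix p assume p: "p \<in> chart_dom c \<inter> coords c -` D"
    then have "p = chart_inv c (coords c p)" using tc(6) by simp
    then show "p \<in> chart_dom c'" unfolding dom using p by blast
  qed
  have top: "topological_chart c'"
    unfolding topological_chart_def img
  proof (intro conjI homeomorphismI)
    show "open (chart_dom c')" unfolding domeq by (rule continuous_open_preimage[OF tc(7,1) d(1)])
    show "continuous_on (chart_dom c') (coords c')"
      unfolding co by (rule continuous_on_compose[OF continuous_on_subset[OF tc(7)]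
            continuous_on_subset[OF smooth_on_imp_continuous_on[OF d(2)]]]) (auto simp: domeq)
    have "continuous_on (box a b) (\<lambda>y. chart_inv c (\<eta> y))"
      by (rule continuous_on_compose2[OF tc(8) smooth_on_imp_continuous_on[OF d(3)]]) (use d(6) D in blast)
    then show "continuous_on (box a b) (chart_inv c')" by (rule continuous_on_eq) (simp add: ci)
    show "coords c' ` chart_dom c' \<subseteq> box a b" unfolding dom using co' d(4) by auto
    show "chart_inv c' ` box a b \<subseteq> chart_dom c'" unfolding dom using ci d(6) by auto
    show "chart_inv c' (coords c' p) = p" if "p \<in> chart_dom c'" for p
      unfolding chart_inv_def by (rule inv_into_f_f[OF inj that])
    show "coords c' (chart_inv c' y) = y" if "y \<in> box a b" for y
      unfolding ci[OF that] using co' d(6,7) that by simp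
  qed (rule open_box)
  note tc' = topological_chartD[OF top]
  have subdom: "chart_dom c' \<subseteq> chart_dom c" unfolding domeq by blast
  show cA: "c' \<in> A"
  proof (rule smooth_surfaceD(6)[OF M top])
    show "chart_dom c' \<subseteq> M" using subdom smooth_surfaceD(4)[OF M c] by blast
    fix c'' assume c'': "c'' \<in> A"
    note tc'' = topological_chartD[OF smooth_surfaceD(3)[OF M c'']]
    let ?S1 = "coords c' ` (chart_dom c' \<inter> chart_dom c'')" and ?S2 = "coords c'' ` (chart_dom c' \<inter> chart_dom c'')"
    have S1: "open ?S1" by (rule open_coords_image[OF top tc''(1)])
    have S2: "open ?S2" using open_coords_image[OF smooth_surfaceD(3)[OF M c''] tc'(1)] by (simp add: Int_commute)
    show "smoothly_compatible c' c''"
      unfolding smoothly_compatible_def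
    proof
      have S1b: "?S1 \<subseteq> box a b" using tc'(5) img by blast
      have "\<eta> ` ?S1 \<subseteq> coords c ` (chart_dom c \<inter> chart_dom c'')"
      proof clarify
        fix p assume p: "p \<in> chart_dom c'" "p \<in> chart_dom c''"
        have "coords c p \<in> D" using p(1) domeq by blast
        then have "\<eta> (coords c' p) = coords c p" by (simp add: co d(5))
        then show "\<eta> (coords c' p) \<in> coords c ` (chart_dom c \<inter> chart_dom c'')" using p subdom by auto
      qed
      then have "smooth_on ?S1 (\<lambda>y. transition c c'' (\<eta> y))"
        by (rule smooth_on_compose[OF S1 smooth_on_subset[OF d(3) S1b] smooth_surfaceD(5)[OF M c c'']])
      then show "smooth_on ?S1 (transition c' c'')"
        by (rule smooth_on_cong[OF _ S1]) (use S1b ci in \<open>auto simp: transition_def\<close>)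
      have "?S2 \<subseteq> coords c'' ` (chart_dom c'' \<inter> chart_dom c)" using subdom by blast
      then have "smooth_on ?S2 (transition c'' c)"
        by (rule smooth_on_subset[OF smooth_surfaceD(5)[OF M c'' c]])
      moreover have "transition c'' c ` ?S2 \<subseteq> D" using tc''(6) domeq by (auto simp: transition_def)
      ultimately have "smooth_on ?S2 (\<lambda>y. \<psi> (transition c'' c y))"
        by (intro smooth_on_compose[OF S2 _ d(2)])
      then show "smooth_on ?S2 (transition c'' c')" by (simp add: transition_def co o_def)
    qed
  qed
  show "chart_inv c u \<in> chart_dom c'" if "u \<in> D" unfolding dom using that by blast
  fix g u v w assume g: "surface_metric A g" and u: "u \<in> D"
  have "chart_inv c u \<in> chart_dom c \<inter> chart_dom c'" using u subdom dom by blast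
  then have "u \<in> coords c ` (chart_dom c \<inter> chart_dom c')" by (rule rev_image_eqI) (simp add: co_inv[OF u])
  note mt = metric_transform(1)[OF M g c cA this, of v w]
  have tr: "transition c c' x = \<psi> x" if "x \<in> D" for x using co'[OF that] by (simp add: transition_def)
  have "frechet_derivative \<psi> (at u) = frechet_derivative (transition c c') (at u)"
    by (rule frechet_derivative_transform_within_open[OF smooth_on_differentiable[OF d(2) u] d(1) u]) (simp add: tr)
  then show "form (g c) u v w = form (g c') (\<psi> u) (frechet_derivative \<psi> (at u) v) (frechet_derivative \<psi> (at u) w)"
    using mt tr[OF u] by simp
qed

lemma box_coordinate_image:
  fixes a b :: "real^2"
  assumes "box a b \<noteq> {}"
  shows "(\<lambda>u. u $ i) ` box a b = {a $ i<..<b $ i}"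
proof -
  obtain y where y: "y \<in> box a b" using assms by blast
  show ?thesis
  proof (intro equalityI subsetI)
    fix s assume "s \<in> {a $ i<..<b $ i}"
    then have "(\<chi> j. if j = i then s else y $ j) \<in> box a b" using y by (auto simp: mem_box_cart)
    then show "s \<in> (\<lambda>u. u $ i) ` box a b" by (rule rev_image_eqI) simp
  qed (auto simp: mem_box_cart)
qed

text \<open>The differential of \<open>\<Lambda>\<close> is a multiple of that of the
  \<open>i\<close>-th new coordinate, so \<open>\<Lambda> \<circ> \<eta>\<close> is constant on
  segments where this coordinate is constant; convexity keeps such segments in the box.
  \<open>X\<close> is the restriction to a coordinate line through a chosen point.\<close>

lemma function_of_coordinate:
  assumes bd: "box_diffeo D \<psi> \<eta> a b" and \<Lambda>: "smooth_on D \<Lambda>" and ne: "D \<noteq> {}"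
    and d\<Lambda>: "\<And>u k. u \<in> D \<Longrightarrow> frechet_derivative \<Lambda> (at u) k = m u * frechet_derivative \<psi> (at u) k $ i"
  obtains X :: "real \<Rightarrow> real" where "smooth_on ((\<lambda>u. u $ i) ` box a b) X"
    "\<And>u. u \<in> D \<Longrightarrow> \<Lambda> u = X (\<psi> u $ i)" "\<And>u. u \<in> D \<Longrightarrow> deriv X (\<psi> u $ i) = m u"
proof -
  note d = box_diffeoD[OF bd]
  obtain u0 where u0: "u0 \<in> D" using ne by blast
  define y0 where "y0 = \<psi> u0"
  have y0: "y0 \<in> box a b" using d(4)[OF u0] by (simp add: y0_def)
  have I: "(\<lambda>u. u $ i) ` box a b = {a $ i<..<b $ i}" using box_coordinate_image y0 by blast
  let ?F = "\<lambda>y. \<Lambda> (\<eta> y)"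
  have F: "smooth_on (box a b) ?F" by (rule smooth_on_compose[OF open_box d(3) \<Lambda>]) (use d(6) in blast)
  have dF: "(?F has_derivative (\<lambda>w. m (\<eta> y) * w $ i)) (at y)" if y: "y \<in> box a b" for y
    using has_derivative_compose[OF smooth_on_has_derivative[OF d(3) y] smooth_on_has_derivative[OF \<Lambda> d(6)[OF y]]]
    unfolding d\<Lambda>[OF d(6)[OF y]] box_diffeo_inverse_derivative[OF bd y] .
  have const: "?F y = ?F y'" if y: "y \<in> box a b" "y' \<in> box a b" "y $ i = y' $ i" for y y'
  proof -
    have "(\<lambda>t. ?F (y + t *\<^sub>R (y' - y))) 1 = (\<lambda>t. ?F (y + t *\<^sub>R (y' - y))) (0::real)"
    proof (rule has_derivative_zero_unique[of "{0..1}" "\<lambda>t. ?F (y + t *\<^sub>R (y' - y))"])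
      fix t :: real assume t: "t \<in> {0..1}"
      have "y + t *\<^sub>R (y' - y) = (1 - t) *\<^sub>R y + t *\<^sub>R y'" by (simp add: algebra_simps)
      then have in_box: "y + t *\<^sub>R (y' - y) \<in> box a b"
        using convexD[OF convex_box(2) y(1,2), of "1 - t" t] t by simp
      have "((\<lambda>t. y + t *\<^sub>R (y' - y)) has_derivative (\<lambda>s. s *\<^sub>R (y' - y))) (at t)"
        by (auto intro!: derivative_eq_intros)
      from has_derivative_compose[OF this dF[OF in_box]]
      have "((\<lambda>t. ?F (y + t *\<^sub>R (y' - y))) has_derivative (\<lambda>h. 0)) (at t)" using y(3) by simp
      then show "((\<lambda>t. ?F (y + t *\<^sub>R (y' - y))) has_derivative (\<lambda>h. 0)) (at t within {0..1})"
        by (rule has_derivative_at_withinI)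
    qed auto
    then show ?thesis by simp
  qed
  define l where "l s = (\<chi> j. if j = i then s else y0 $ j)" for s
  define X where "X s = ?F (l s)" for s
  have l: "l s \<in> box a b" if "s \<in> {a $ i<..<b $ i}" for s
    using that y0 by (auto simp: l_def mem_box_cart)
  have "smooth_on {a $ i<..<b $ i} l"
  proof (rule smooth_on_vec[OF open_greaterThanLessThan])
    show "smooth_on {a $ i<..<b $ i} (\<lambda>s. l s $ j)" for j by (cases "j = i") (simp_all add: l_def)
  qed
  then have smX: "smooth_on {a $ i<..<b $ i} X"
    unfolding X_def by (rule smooth_on_compose[OF open_greaterThanLessThan _ F]) (use l in blast)
  have X: "?F y = X (y $ i)" if y: "y \<in> box a b" for y
    unfolding X_def by (rule const[OF y l]) (use y in \<open>auto simp: l_def mem_box_cart\<close>)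
  have \<Lambda>X: "\<Lambda> u = X (\<psi> u $ i)" if u: "u \<in> D" for u using X[OF d(4)[OF u]] d(5)[OF u] by simp
  have "deriv X (\<psi> u $ i) = m u" if u: "u \<in> D" for u
  proof -
    let ?y = "\<psi> u"
    have s: "?y $ i \<in> {a $ i<..<b $ i}" using d(4)[OF u] by (auto simp: mem_box_cart)
    have "X differentiable (at (?y $ i))" by (rule smooth_on_differentiable[OF smX s])
    then have "(X has_real_derivative deriv X (?y $ i)) (at (?y $ i))"
      using DERIV_deriv_iff_real_differentiable by blast
    then have dX: "(X has_derivative (\<lambda>h. deriv X (?y $ i) * h)) (at (?y $ i))" by (simp add: has_field_derivative_def)
    have "((\<lambda>y. X (y $ i)) has_derivative (\<lambda>w. deriv X (?y $ i) * w $ i)) (at ?y)"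
      by (rule has_derivative_compose[OF bounded_linear_imp_has_derivative[OF bounded_linear_vec_nth] dX])
    then have "(?F has_derivative (\<lambda>w. deriv X (?y $ i) * w $ i)) (at ?y)"
      by (rule has_derivative_transform_within_open[OF _ open_box d(4)[OF u]]) (simp add: X)
    from fun_cong[OF has_derivative_unique[OF this dF[OF d(4)[OF u]]], of "axis i 1"]
    show ?thesis by (simp add: d(5)[OF u])
  qed
  then show ?thesis using that[of X] smX \<Lambda>X unfolding I by blast
qed

section \<open>Closed coframes adapted to a Killing tensor\<close>

lemma binary_cubic_zero:
  fixes A B C D :: real
  assumes "\<And>x y. x * x * x * A + x * x * y * B + x * y * y * C + y * y * y * D = 0"
  shows "A = 0" "B = 0" "C = 0" "D = 0"
  using assms[of 1 0] assms[of 0 1] assms[of 1 1] assms[of 1 "-1"] by auto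

text \<open>At \<open>v = x e1 + y e2\<close> the Killing equation is an identity of binary cubics
  in \<open>x, y\<close>, and the conclusions are its four coefficients. The vectors
  \<open>e1\<close>, \<open>e2\<close> are constant, so their derivatives do not occur;
  \<open>A1\<close> and \<open>A2\<close> express \<open>a\<close> through \<open>G\<close> at the
  one point \<open>u\<close>, after which \<open>form_spray\<close> eliminates the spray.\<close>

lemma killing_frame:
  fixes G a :: "real^2 \<Rightarrow> real^2^2" and u e1 e2 :: "real^2"
  assumes S: "open S" "metric_on S G" "symmetric_on S a" "killing_on S G a" "u \<in> S"
    and A1: "\<And>w. form a u e1 w = A11 * form G u e1 w + A12 * form G u e2 w"
    and A2: "\<And>w. form a u e2 w = A21 * form G u e1 w + A22 * form G u e2 w"
  defines "d \<equiv> dform G u" and "D \<equiv> dform a u"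
  shows "D e1 e1 e1 = A11 * d e1 e1 e1 + 2 * A12 * (d e1 e1 e2 - d e2 e1 e1 / 2)"
    "2 * D e1 e1 e2 + D e2 e1 e1 = 2 * (A11 * d e2 e1 e1 + A12 * d e1 e2 e2 + A21 * (d e1 e1 e1 / 2)
        + A22 * (d e1 e1 e2 - d e2 e1 e1 / 2))"
    "2 * D e2 e1 e2 + D e1 e2 e2 = 2 * (A11 * (d e2 e1 e2 - d e1 e2 e2 / 2) + A12 * (d e2 e2 e2 / 2)
        + A21 * d e2 e1 e1 + A22 * d e1 e2 e2)"
    "D e2 e2 e2 = 2 * A21 * (d e2 e1 e2 - d e1 e2 e2 / 2) + A22 * d e2 e2 e2"
proof -
  note G = metric_onD[OF S(2)]
  have symG: "form G u v w = form G u w v" for v w by (rule form_sym[of G, OF G(3)[OF S(5)]])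
  have symd: "d k v w = d k w v" for k v w unfolding d_def by (rule dform_sym[OF S(1) G(1) S(5)])
  have symD: "D k v w = D k w v" for k v w unfolding D_def by (rule dform_sym[OF S(1,3,5)])
  note lind = dform_linear[OF S(1) G(2) S(5), folded d_def]
  note linD = dform_linear[OF S(1) symmetric_onD(1)[OF S(3)] S(5), folded D_def]
  have K: "x * x * x * D e1 e1 e1 + x * x * y * (2 * D e1 e1 e2 + D e2 e1 e1)
      + x * y * y * (2 * D e2 e1 e2 + D e1 e2 e2) + y * y * y * D e2 e2 e2
      = 2 * ((x * A11 + y * A21) * (x * x * d e1 e1 e1 / 2 + x * y * d e2 e1 e1 + y * y * (d e2 e1 e2 - d e1 e2 e2 / 2))
          + (x * A12 + y * A22) * (x * x * (d e1 e1 e2 - d e2 e1 e1 / 2) + x * y * d e1 e2 e2 + y * y * d e2 e2 e2 / 2))" for x y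
  proof -
    let ?v = "x *\<^sub>R e1 + y *\<^sub>R e2"
    have c: "form G u e (spray G u ?v) = d ?v ?v e - (1/2) * d e ?v ?v" for e
      using form_spray[OF S(1,2,5), of ?v e] symG[of e] by (simp add: d_def)
    have "D ?v ?v ?v = 2 * form a u ?v (spray G u ?v)"
      using S(4,5) unfolding killing_on_def D_def by blast
    also have "\<dots> = 2 * ((x * A11 + y * A21) * form G u e1 (spray G u ?v) + (x * A12 + y * A22) * form G u e2 (spray G u ?v))"
      by (simp add: form_linear A1 A2 algebra_simps)
    also have "\<dots> = 2 * ((x * A11 + y * A21) * (x * x * d e1 e1 e1 / 2 + x * y * d e2 e1 e1 + y * y * (d e2 e1 e2 - d e1 e2 e2 / 2))
          + (x * A12 + y * A22) * (x * x * (d e1 e1 e2 - d e2 e1 e1 / 2) + x * y * d e1 e2 e2 + y * y * d e2 e2 e2 / 2))"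
    proof -
      have "form G u e1 (spray G u ?v) = x * x * d e1 e1 e1 / 2 + x * y * d e2 e1 e1 + y * y * (d e2 e1 e2 - d e1 e2 e2 / 2)"
        unfolding c by (simp add: lind symd[of _ e2 e1] algebra_simps)
      moreover have "form G u e2 (spray G u ?v) = x * x * (d e1 e1 e2 - d e2 e1 e1 / 2) + x * y * d e1 e2 e2 + y * y * d e2 e2 e2 / 2"
        unfolding c by (simp add: lind symd[of _ e2 e1] algebra_simps)
      ultimately show ?thesis by simp
    qed
    finally show ?thesis by (simp add: linD symD[of _ e2 e1] algebra_simps)
  qed
  have "x * x * x * (D e1 e1 e1 - (A11 * d e1 e1 e1 + 2 * A12 * (d e1 e1 e2 - d e2 e1 e1 / 2)))
    + x * x * y * (2 * D e1 e1 e2 + D e2 e1 e1 - 2 * (A11 * d e2 e1 e1 + A12 * d e1 e2 e2 + A21 * (d e1 e1 e1 / 2)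
        + A22 * (d e1 e1 e2 - d e2 e1 e1 / 2)))
    + x * y * y * (2 * D e2 e1 e2 + D e1 e2 e2 - 2 * (A11 * (d e2 e1 e2 - d e1 e2 e2 / 2) + A12 * (d e2 e2 e2 / 2)
        + A21 * d e2 e1 e1 + A22 * d e1 e2 e2))
    + y * y * y * (D e2 e2 e2 - (2 * A21 * (d e2 e1 e2 - d e1 e2 e2 / 2) + A22 * d e2 e2 e2)) = 0" for x y
    using K[of x y] by (simp add: field_simps)
  note c = binary_cubic_zero[of _ _ _ _, OF this]
  show "D e1 e1 e1 = A11 * d e1 e1 e1 + 2 * A12 * (d e1 e1 e2 - d e2 e1 e1 / 2)"
    "2 * D e1 e1 e2 + D e2 e1 e1 = 2 * (A11 * d e2 e1 e1 + A12 * d e1 e2 e2 + A21 * (d e1 e1 e1 / 2)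
        + A22 * (d e1 e1 e2 - d e2 e1 e1 / 2))"
    "2 * D e2 e1 e2 + D e1 e2 e2 = 2 * (A11 * (d e2 e1 e2 - d e1 e2 e2 / 2) + A12 * (d e2 e2 e2 / 2)
        + A21 * d e2 e1 e1 + A22 * d e1 e2 e2)"
    "D e2 e2 e2 = 2 * A21 * (d e2 e1 e2 - d e1 e2 e2 / 2) + A22 * d e2 e2 e2"
    using c by simp_all
qed

lemma dual_frame:
  fixes p q :: "real^2"
  assumes "p $ 1 * q $ 2 - p $ 2 * q $ 1 \<noteq> 0"
  obtains e1 e2 where "p \<bullet> e1 = 1" "p \<bullet> e2 = 0" "q \<bullet> e1 = 0" "q \<bullet> e2 = 1"
    "\<And>v. v = (p \<bullet> v) *\<^sub>R e1 + (q \<bullet> v) *\<^sub>R e2"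
proof
  let ?d = "p $ 1 * q $ 2 - p $ 2 * q $ 1"
  let ?e1 = "inverse ?d *\<^sub>R (vector [q $ 2, - (q $ 1)] :: real^2)" and ?e2 = "inverse ?d *\<^sub>R (vector [- (p $ 2), p $ 1] :: real^2)"
  have n: "inverse ?d * ?d = 1" using assms by simp
  have "p \<bullet> ?e1 = inverse ?d * ?d" "q \<bullet> ?e2 = inverse ?d * ?d" by (simp_all add: inner_vec2 algebra_simps)
  then show "p \<bullet> ?e1 = 1" "q \<bullet> ?e2 = 1" unfolding n by simp_all
  show "p \<bullet> ?e2 = 0" "q \<bullet> ?e1 = 0" by (simp_all add: inner_vec2)
  fix v :: "real^2"
  have "(p \<bullet> v) *\<^sub>R ?e1 + (q \<bullet> v) *\<^sub>R ?e2 = (inverse ?d * ?d) *\<^sub>R v"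
    unfolding vec2_eq_iff by (simp add: inner_vec2 algebra_simps)
  then show "v = (p \<bullet> v) *\<^sub>R ?e1 + (q \<bullet> v) *\<^sub>R ?e2" unfolding n by simp
qed

text \<open>Closedness of the one-form that the inner product assigns to
  \<open>\<theta>\<close>.\<close>

definition closed_form_on :: "(real^2) set \<Rightarrow> (real^2 \<Rightarrow> real^2) \<Rightarrow> bool" where
  "closed_form_on S \<theta> \<longleftrightarrow> (\<forall>u\<in>S. \<forall>v w. frechet_derivative \<theta> (at u) v \<bullet> w = frechet_derivative \<theta> (at u) w \<bullet> v)"

text \<open>In dimension two an antisymmetric bilinear form is determined by its value on one frame,
  so closedness has to be tested on one pair of vectors only.\<close>

lemma skew_by_frame:
  fixes P :: "real^2 \<Rightarrow> real^2"
  assumes "linear P" and frame: "\<And>v. v = x v *\<^sub>R e1 + y v *\<^sub>R e2"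
  shows "P v \<bullet> w - P w \<bullet> v = (x v * y w - y v * x w) * (P e1 \<bullet> e2 - P e2 \<bullet> e1)"
proof -
  have Pv: "P v = x v *\<^sub>R P e1 + y v *\<^sub>R P e2" for v
  proof -
    have "P v = P (x v *\<^sub>R e1 + y v *\<^sub>R e2)" by (rule arg_cong[OF frame])
    then show ?thesis unfolding linear_add[OF assms(1)] linear_scale[OF assms(1)] .
  qed
  have inw: "z \<bullet> w = x w * (z \<bullet> e1) + y w * (z \<bullet> e2)" for z w
  proof -
    have "z \<bullet> w = z \<bullet> (x w *\<^sub>R e1 + y w *\<^sub>R e2)" by (rule arg_cong[OF frame])
    then show ?thesis unfolding inner_add_right inner_scaleR_right .
  qed
  have e: "P v \<bullet> w = x v * (x w * (P e1 \<bullet> e1) + y w * (P e1 \<bullet> e2)) + y v * (x w * (P e2 \<bullet> e1) + y w * (P e2 \<bullet> e2))" for v w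
  proof -
    have "P v \<bullet> w = (x v *\<^sub>R P e1 + y v *\<^sub>R P e2) \<bullet> w" by (rule arg_cong[OF Pv])
    also have "\<dots> = x v * (P e1 \<bullet> w) + y v * (P e2 \<bullet> w)" unfolding inner_add_left inner_scaleR_left ..
    finally show ?thesis unfolding inw[of "P e1" w] inw[of "P e2" w] .
  qed
  show ?thesis unfolding e[of v w] e[of w v] by (simp add: algebra_simps)
qed

lemma linear_by_frame:
  assumes "linear (f :: real^2 \<Rightarrow> real)" and frame: "\<And>v. v = x v *\<^sub>R e1 + y v *\<^sub>R e2"
  shows "f v = x v * f e1 + y v * f e2"
proof -
  have "f v = f (x v *\<^sub>R e1 + y v *\<^sub>R e2)" by (rule arg_cong[OF frame])
  then show ?thesis unfolding linear_add[OF assms(1)] linear_scale[OF assms(1)] by simp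
qed

lemma dform_eq_derivative:
  assumes "open S" "smooth_on S G" "u \<in> S" "\<And>u. u \<in> S \<Longrightarrow> form G u v w = F u" "(F has_derivative F') (at u)"
  shows "dform G u k v w = F' k"
proof -
  have "((\<lambda>u. form G u v w) has_derivative F') (at u)"
    by (rule has_derivative_transform_within_open[OF assms(5,1,3)]) (simp add: assms(4))
  from fun_cong[OF has_derivative_unique[OF has_derivative_form[OF assms(1-3)] this]] show ?thesis .
qed

text \<open>In the frame dual to \<open>p, q\<close> the four equations decouple: the pure cubes say
  that \<open>Y\<close> is constant along \<open>e1\<close> and \<open>X\<close> along
  \<open>e2\<close>, and the mixed coefficients then reduce to the closedness of \<open>p\<close>
  and of \<open>q\<close>.\<close>

lemma liouville_closed:
  assumes S: "open S" "metric_on S G" "symmetric_on S a" "killing_on S G a"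
    and sm: "smooth_on S X" "smooth_on S Y" "smooth_on S p" "smooth_on S q" and s: "s \<noteq> 0"
    and XY: "\<And>u. u \<in> S \<Longrightarrow> X u \<noteq> Y u"
    and frame: "\<And>u. u \<in> S \<Longrightarrow> p u $ 1 * q u $ 2 - p u $ 2 * q u $ 1 \<noteq> 0"
    and G: "\<And>u v w. u \<in> S \<Longrightarrow> form G u v w = (X u - Y u) * (p u \<bullet> v * (p u \<bullet> w) + s * (q u \<bullet> v * (q u \<bullet> w)))"
    and a: "\<And>u v w. u \<in> S \<Longrightarrow> form a u v w = (X u - Y u) * (Y u * (p u \<bullet> v * (p u \<bullet> w)) + s * X u * (q u \<bullet> v * (q u \<bullet> w)))"
  shows "closed_form_on S p" "closed_form_on S q"
    "\<forall>u\<in>S. \<exists>m. \<forall>k. frechet_derivative X (at u) k = m * (p u \<bullet> k)"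
    "\<forall>u\<in>S. \<exists>m. \<forall>k. frechet_derivative Y (at u) k = m * (q u \<bullet> k)"
proof -
  have *: "(\<forall>v w. frechet_derivative p (at u) v \<bullet> w = frechet_derivative p (at u) w \<bullet> v) \<and>
     (\<forall>v w. frechet_derivative q (at u) v \<bullet> w = frechet_derivative q (at u) w \<bullet> v) \<and>
     (\<exists>m. \<forall>k. frechet_derivative X (at u) k = m * (p u \<bullet> k)) \<and>
     (\<exists>m. \<forall>k. frechet_derivative Y (at u) k = m * (q u \<bullet> k))" if u: "u \<in> S" for u
  proof -
    obtain e1 e2 where e: "p u \<bullet> e1 = 1" "p u \<bullet> e2 = 0" "q u \<bullet> e1 = 0" "q u \<bullet> e2 = 1"
      and fr: "\<And>v. v = (p u \<bullet> v) *\<^sub>R e1 + (q u \<bullet> v) *\<^sub>R e2"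
      using dual_frame[OF frame[OF u]] by metis
    let ?P = "frechet_derivative p (at u)" and ?Q = "frechet_derivative q (at u)"
    let ?X = "frechet_derivative X (at u)" and ?Y = "frechet_derivative Y (at u)"
    note dX = smooth_on_has_derivative[OF sm(1) u] and dY = smooth_on_has_derivative[OF sm(2) u]
    let ?\<Delta> = "X u - Y u"
    note dp = smooth_on_has_derivative[OF sm(3) u] and dq = smooth_on_has_derivative[OF sm(4) u]
    have dG: "dform G u k v w = ?\<Delta> * (?P k \<bullet> v * (p u \<bullet> w) + p u \<bullet> v * (?P k \<bullet> w)
        + s * (?Q k \<bullet> v * (q u \<bullet> w) + q u \<bullet> v * (?Q k \<bullet> w)))
        + (?X k - ?Y k) * (p u \<bullet> v * (p u \<bullet> w) + s * (q u \<bullet> v * (q u \<bullet> w)))" for k v w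
      by (rule dform_eq_derivative[OF S(1) metric_onD(2)[OF S(2)] u G])
        (auto intro!: derivative_eq_intros dp dq dX dY simp: algebra_simps)
    have da: "dform a u k v w = ?\<Delta> * (Y u * (?P k \<bullet> v * (p u \<bullet> w) + p u \<bullet> v * (?P k \<bullet> w))
        + s * X u * (?Q k \<bullet> v * (q u \<bullet> w) + q u \<bullet> v * (?Q k \<bullet> w))
        + ?Y k * (p u \<bullet> v * (p u \<bullet> w)) + s * ?X k * (q u \<bullet> v * (q u \<bullet> w)))
        + (?X k - ?Y k) * (Y u * (p u \<bullet> v * (p u \<bullet> w)) + s * X u * (q u \<bullet> v * (q u \<bullet> w)))" for k v w
      by (rule dform_eq_derivative[OF S(1) symmetric_onD(1)[OF S(3)] u a])
        (auto intro!: derivative_eq_intros dp dq dX dY simp: algebra_simps)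
    \<comment> \<open>The eigenvalues are crossed: the direction \<open>e1\<close>, dual to
      \<open>p\<close>, has the eigenvalue \<open>Y\<close>, and \<open>e2\<close> has
      \<open>X\<close>.\<close>
    have A1: "form a u e1 w = Y u * form G u e1 w + 0 * form G u e2 w" for w
      by (simp add: a[OF u] G[OF u] e)
    have A2: "form a u e2 w = 0 * form G u e1 w + X u * form G u e2 w" for w
      by (simp add: a[OF u] G[OF u] e)
    note K = killing_frame[OF S u A1 A2, unfolded dG da e]
    have \<Delta>: "?\<Delta> \<noteq> 0" using XY[OF u] by simp
    have Y1: "?Y e1 = 0" using K(1) \<Delta> by (simp add: algebra_simps)
    have X2: "?X e2 = 0"
    proof -
      have "?\<Delta> * s * ?X e2 = 0" using K(4) by (simp add: algebra_simps)
      then show ?thesis using \<Delta> s by simp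
    qed
    have P: "?P e1 \<bullet> e2 - ?P e2 \<bullet> e1 = 0"
    proof -
      have "?\<Delta> * ?\<Delta> * (?P e1 \<bullet> e2 - ?P e2 \<bullet> e1) = 0" using K(2) by (simp add: X2 Y1 field_simps)
      then show ?thesis using \<Delta> by simp
    qed
    have Q: "?Q e1 \<bullet> e2 - ?Q e2 \<bullet> e1 = 0"
    proof -
      have "s * ?\<Delta> * ?\<Delta> * (?Q e1 \<bullet> e2 - ?Q e2 \<bullet> e1) = 0" using K(3) by (simp add: X2 Y1 field_simps)
      then show ?thesis using \<Delta> s by simp
    qed
    have lin: "linear ?P" "linear ?Q" "linear ?X" "linear ?Y"
      using sm u by (auto intro!: linear_frechet_derivative smooth_on_differentiable)
    have "?P v \<bullet> w = ?P w \<bullet> v" for v w using skew_by_frame[OF lin(1) fr, of v w] P by simp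
    moreover have "?Q v \<bullet> w = ?Q w \<bullet> v" for v w using skew_by_frame[OF lin(2) fr, of v w] Q by simp
    moreover have "?X k = ?X e1 * (p u \<bullet> k)" for k using linear_by_frame[OF lin(3) fr, of k] X2 by simp
    moreover have "?Y k = ?Y e2 * (q u \<bullet> k)" for k using linear_by_frame[OF lin(4) fr, of k] Y1 by simp
    ultimately show ?thesis by blast
  qed
  show "closed_form_on S p" "closed_form_on S q" using * unfolding closed_form_on_def by blast+
  show "\<forall>u\<in>S. \<exists>m. \<forall>k. frechet_derivative X (at u) k = m * (p u \<bullet> k)" using * by blast
  show "\<forall>u\<in>S. \<exists>m. \<forall>k. frechet_derivative Y (at u) k = m * (q u \<bullet> k)" using * by blast
qed

text \<open>Here the pure cubes give closedness of \<open>q\<close> and \<open>p\<close>. The mixed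
  coefficients then become the Cauchy-Riemann equations for \<open>R + i I\<close> in coordinates
  with differentials \<open>p\<close> and \<open>q\<close>.\<close>

lemma complex_liouville_closed:
  assumes S: "open S" "metric_on S G" "symmetric_on S a" "killing_on S G a"
    and sm: "smooth_on S R" "smooth_on S I" "smooth_on S p" "smooth_on S q"
    and I: "\<And>u. u \<in> S \<Longrightarrow> I u \<noteq> 0"
    and frame: "\<And>u. u \<in> S \<Longrightarrow> p u $ 1 * q u $ 2 - p u $ 2 * q u $ 1 \<noteq> 0"
    and G: "\<And>u v w. u \<in> S \<Longrightarrow> form G u v w = I u * (p u \<bullet> v * (q u \<bullet> w) + q u \<bullet> v * (p u \<bullet> w))"
    and a: "\<And>u v w. u \<in> S \<Longrightarrow> form a u v w = R u * (I u * (p u \<bullet> v * (q u \<bullet> w) + q u \<bullet> v * (p u \<bullet> w)))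
       - I u * I u * (p u \<bullet> v * (p u \<bullet> w) - q u \<bullet> v * (q u \<bullet> w))"
  shows "closed_form_on S p" "closed_form_on S q"
    "\<forall>u\<in>S. \<exists>m n. \<forall>k. frechet_derivative R (at u) k = m * (p u \<bullet> k) - n * (q u \<bullet> k) \<and>
       frechet_derivative I (at u) k = n * (p u \<bullet> k) + m * (q u \<bullet> k)"
proof -
  have *: "(\<forall>v w. frechet_derivative p (at u) v \<bullet> w = frechet_derivative p (at u) w \<bullet> v) \<and>
     (\<forall>v w. frechet_derivative q (at u) v \<bullet> w = frechet_derivative q (at u) w \<bullet> v) \<and>
     (\<exists>m n. \<forall>k. frechet_derivative R (at u) k = m * (p u \<bullet> k) - n * (q u \<bullet> k) \<and>
       frechet_derivative I (at u) k = n * (p u \<bullet> k) + m * (q u \<bullet> k))" if u: "u \<in> S" for u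
  proof -
    obtain e1 e2 where e: "p u \<bullet> e1 = 1" "p u \<bullet> e2 = 0" "q u \<bullet> e1 = 0" "q u \<bullet> e2 = 1"
      and fr: "\<And>v. v = (p u \<bullet> v) *\<^sub>R e1 + (q u \<bullet> v) *\<^sub>R e2"
      using dual_frame[OF frame[OF u]] by metis
    let ?P = "frechet_derivative p (at u)" and ?Q = "frechet_derivative q (at u)"
    let ?R = "frechet_derivative R (at u)" and ?I = "frechet_derivative I (at u)"
    note dR = smooth_on_has_derivative[OF sm(1) u] and dI = smooth_on_has_derivative[OF sm(2) u]
    note dp = smooth_on_has_derivative[OF sm(3) u] and dq = smooth_on_has_derivative[OF sm(4) u]
    have dG: "dform G u k v w = I u * (?P k \<bullet> v * (q u \<bullet> w) + p u \<bullet> v * (?Q k \<bullet> w)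
        + ?Q k \<bullet> v * (p u \<bullet> w) + q u \<bullet> v * (?P k \<bullet> w))
        + ?I k * (p u \<bullet> v * (q u \<bullet> w) + q u \<bullet> v * (p u \<bullet> w))" for k v w
      by (rule dform_eq_derivative[OF S(1) metric_onD(2)[OF S(2)] u G])
        (auto intro!: derivative_eq_intros dp dq dR dI simp: algebra_simps)
    have da: "dform a u k v w = R u * (I u * (?P k \<bullet> v * (q u \<bullet> w) + p u \<bullet> v * (?Q k \<bullet> w)
        + ?Q k \<bullet> v * (p u \<bullet> w) + q u \<bullet> v * (?P k \<bullet> w))
        + ?I k * (p u \<bullet> v * (q u \<bullet> w) + q u \<bullet> v * (p u \<bullet> w)))
        + ?R k * (I u * (p u \<bullet> v * (q u \<bullet> w) + q u \<bullet> v * (p u \<bullet> w)))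
        - I u * I u * (?P k \<bullet> v * (p u \<bullet> w) + p u \<bullet> v * (?P k \<bullet> w) - ?Q k \<bullet> v * (q u \<bullet> w) - q u \<bullet> v * (?Q k \<bullet> w))
        - 2 * I u * ?I k * (p u \<bullet> v * (p u \<bullet> w) - q u \<bullet> v * (q u \<bullet> w))" for k v w
      by (rule dform_eq_derivative[OF S(1) symmetric_onD(1)[OF S(3)] u a])
        (auto intro!: derivative_eq_intros dp dq dR dI simp: algebra_simps)
    \<comment> \<open>In this frame the endomorphism relating \<open>a\<close> to \<open>G\<close>
      is a rotation with dilation, with eigenvalues \<open>R + i I\<close> and
      \<open>R - i I\<close>.\<close>
    have A1: "form a u e1 w = R u * form G u e1 w + (- I u) * form G u e2 w" for w
      by (simp add: a[OF u] G[OF u] e algebra_simps)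
    have A2: "form a u e2 w = I u * form G u e1 w + R u * form G u e2 w" for w
      by (simp add: a[OF u] G[OF u] e algebra_simps)
    note K = killing_frame[OF S u A1 A2, unfolded dG da e]
    note I0 = I[OF u]
    have Q: "?Q e1 \<bullet> e2 - ?Q e2 \<bullet> e1 = 0"
    proof -
      have "I u * I u * (?Q e1 \<bullet> e2 - ?Q e2 \<bullet> e1) = 0" using K(1) by (simp add: algebra_simps)
      then show ?thesis using I0 by simp
    qed
    have P: "?P e1 \<bullet> e2 - ?P e2 \<bullet> e1 = 0"
    proof -
      have "I u * I u * (?P e1 \<bullet> e2 - ?P e2 \<bullet> e1) = 0" using K(4) by (simp add: algebra_simps)
      then show ?thesis using I0 by simp
    qed
    have CR1: "?R e1 = ?I e2"
    proof -
      have "I u * (?R e1 - ?I e2 + I u * (?P e1 \<bullet> e2 - ?P e2 \<bullet> e1)) = 0" using K(2) by (simp add: algebra_simps)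
      then show ?thesis using I0 P by simp
    qed
    have CR2: "?R e2 = - ?I e1"
    proof -
      \<comment> \<open>The sign of the term in \<open>?Q\<close> is irrelevant, since this term
        vanishes; either alternative suffices.\<close>
      have "I u * (?R e2 + ?I e1 + I u * (?Q e1 \<bullet> e2 - ?Q e2 \<bullet> e1)) = 0 \<or> I u * (?R e2 + ?I e1 - I u * (?Q e1 \<bullet> e2 - ?Q e2 \<bullet> e1)) = 0"
        using K(3) by (simp add: algebra_simps)
      then show ?thesis using I0 Q by auto
    qed
    have lin: "linear ?P" "linear ?Q" "linear ?R" "linear ?I"
      using sm u by (auto intro!: linear_frechet_derivative smooth_on_differentiable)
    have "?P v \<bullet> w = ?P w \<bullet> v" for v w using skew_by_frame[OF lin(1) fr, of v w] P by simp
    moreover have "?Q v \<bullet> w = ?Q w \<bullet> v" for v w using skew_by_frame[OF lin(2) fr, of v w] Q by simp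
    moreover have "?R k = ?R e1 * (p u \<bullet> k) - ?I e1 * (q u \<bullet> k) \<and> ?I k = ?I e1 * (p u \<bullet> k) + ?R e1 * (q u \<bullet> k)" for k
      using linear_by_frame[OF lin(3) fr, of k] linear_by_frame[OF lin(4) fr, of k] CR1 CR2 by simp
    ultimately show ?thesis by blast
  qed
  show "closed_form_on S p" "closed_form_on S q" using * unfolding closed_form_on_def by blast+
  show "\<forall>u\<in>S. \<exists>m n. \<forall>k. frechet_derivative R (at u) k = m * (p u \<bullet> k) - n * (q u \<bullet> k) \<and>
       frechet_derivative I (at u) k = n * (p u \<bullet> k) + m * (q u \<bullet> k)" using * by blast
qed

text \<open>\<open>e1\<close> is an eigenvector and \<open>e2\<close> a generalized one. The Killing
  equation makes \<open>\<beta>\<close> closed and \<open>dY\<close> a multiple of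
  \<open>\<alpha>\<close>, but the exterior derivative of \<open>\<alpha>\<close> is the wedge
  product of \<open>\<beta>\<close> and \<open>dY\<close>. Once \<open>\<beta> = dx\<close>, this is
  the exterior derivative of \<open>x dY\<close>, which tells how to correct
  \<open>\<alpha>\<close>.\<close>

lemma jordan_closed:
  assumes S: "open S" "metric_on S G" "symmetric_on S a" "killing_on S G a"
    and sm: "smooth_on S Y" "smooth_on S \<beta>" "smooth_on S \<alpha>"
    and frame: "\<And>u. u \<in> S \<Longrightarrow> \<beta> u $ 1 * \<alpha> u $ 2 - \<beta> u $ 2 * \<alpha> u $ 1 \<noteq> 0"
    and G: "\<And>u v w. u \<in> S \<Longrightarrow> form G u v w = (\<alpha> u \<bullet> v * (\<beta> u \<bullet> w) + \<beta> u \<bullet> v * (\<alpha> u \<bullet> w)) / 2"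
    and a: "\<And>u v w. u \<in> S \<Longrightarrow> form a u v w = Y u * ((\<alpha> u \<bullet> v * (\<beta> u \<bullet> w) + \<beta> u \<bullet> v * (\<alpha> u \<bullet> w)) / 2)
       - \<alpha> u \<bullet> v * (\<alpha> u \<bullet> w) / 2"
  shows "closed_form_on S \<beta>"
    "\<forall>u\<in>S. \<exists>m. \<forall>k. frechet_derivative Y (at u) k = m * (\<alpha> u \<bullet> k)"
    "\<forall>u\<in>S. \<forall>v w. frechet_derivative \<alpha> (at u) v \<bullet> w - frechet_derivative \<alpha> (at u) w \<bullet> v =
       \<beta> u \<bullet> v * frechet_derivative Y (at u) w - \<beta> u \<bullet> w * frechet_derivative Y (at u) v"
proof -
  have *: "(\<forall>v w. frechet_derivative \<beta> (at u) v \<bullet> w = frechet_derivative \<beta> (at u) w \<bullet> v) \<and>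
     (\<exists>m. \<forall>k. frechet_derivative Y (at u) k = m * (\<alpha> u \<bullet> k)) \<and>
     (\<forall>v w. frechet_derivative \<alpha> (at u) v \<bullet> w - frechet_derivative \<alpha> (at u) w \<bullet> v =
       \<beta> u \<bullet> v * frechet_derivative Y (at u) w - \<beta> u \<bullet> w * frechet_derivative Y (at u) v)" if u: "u \<in> S" for u
  proof -
    obtain e1 e2 where e: "\<beta> u \<bullet> e1 = 1" "\<beta> u \<bullet> e2 = 0" "\<alpha> u \<bullet> e1 = 0" "\<alpha> u \<bullet> e2 = 1"
      and fr: "\<And>v. v = (\<beta> u \<bullet> v) *\<^sub>R e1 + (\<alpha> u \<bullet> v) *\<^sub>R e2"
      using dual_frame[OF frame[OF u]] by metis
    let ?P = "frechet_derivative \<alpha> (at u)" and ?B = "frechet_derivative \<beta> (at u)"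
    let ?Y = "frechet_derivative Y (at u)"
    note dY = smooth_on_has_derivative[OF sm(1) u]
    note db = smooth_on_has_derivative[OF sm(2) u] and dal = smooth_on_has_derivative[OF sm(3) u]
    have dG: "dform G u k v w = (?P k \<bullet> v * (\<beta> u \<bullet> w) + \<alpha> u \<bullet> v * (?B k \<bullet> w)
        + ?B k \<bullet> v * (\<alpha> u \<bullet> w) + \<beta> u \<bullet> v * (?P k \<bullet> w)) / 2" for k v w
      by (rule dform_eq_derivative[OF S(1) metric_onD(2)[OF S(2)] u G])
        (auto intro!: derivative_eq_intros db dal simp: algebra_simps)
    have da: "dform a u k v w = Y u * dform G u k v w + ?Y k * form G u v w
        - (1/2) * (?P k \<bullet> v * (\<alpha> u \<bullet> w) + \<alpha> u \<bullet> v * (?P k \<bullet> w))" for k v w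
    proof (rule dform_eq_derivative[OF S(1) symmetric_onD(1)[OF S(3)] u])
      show "form a u v w = Y u * form G u v w - (1/2) * (\<alpha> u \<bullet> v * (\<alpha> u \<bullet> w))" if "u \<in> S" for u
        using a[OF that] G[OF that] by simp
      have "((\<lambda>u. \<alpha> u \<bullet> v * (\<alpha> u \<bullet> w)) has_derivative
          (\<lambda>k. \<alpha> u \<bullet> v * (?P k \<bullet> w) + ?P k \<bullet> v * (\<alpha> u \<bullet> w))) (at u)"
        by (intro has_derivative_mult has_derivative_inner_left dal)
      from has_derivative_diff[OF has_derivative_mult[OF dY has_derivative_form[OF S(1) metric_onD(2)[OF S(2)] u]]
          has_derivative_mult_right[OF this, of "1/2"]]
      show "((\<lambda>u. Y u * form G u v w - (1/2) * (\<alpha> u \<bullet> v * (\<alpha> u \<bullet> w))) has_derivative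
          (\<lambda>k. Y u * dform G u k v w + ?Y k * form G u v w
        - (1/2) * (?P k \<bullet> v * (\<alpha> u \<bullet> w) + \<alpha> u \<bullet> v * (?P k \<bullet> w)))) (at u)"
        by (simp add: add.commute)
    qed
    have A1: "form a u e1 w = Y u * form G u e1 w + 0 * form G u e2 w" for w
      by (simp add: a[OF u] G[OF u] e)
    have A2: "form a u e2 w = (- 1) * form G u e1 w + Y u * form G u e2 w" for w
      by (simp add: a[OF u] G[OF u] e)
    note K = killing_frame[OF S u A1 A2, unfolded da dG G[OF u] e]
    have Y1: "?Y e1 = 0" using K(2) by (simp add: field_simps)
    have B: "?B e1 \<bullet> e2 - ?B e2 \<bullet> e1 = 0" using K(4) by (simp add: field_simps)
    have P: "?P e1 \<bullet> e2 - ?P e2 \<bullet> e1 = ?Y e2" using K(3) by (simp add: field_simps)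
    have lin: "linear ?P" "linear ?B" "linear ?Y"
      using sm u by (auto intro!: linear_frechet_derivative smooth_on_differentiable)
    have "?B v \<bullet> w = ?B w \<bullet> v" for v w using skew_by_frame[OF lin(2) fr, of v w] B by simp
    moreover have Yk: "?Y k = ?Y e2 * (\<alpha> u \<bullet> k)" for k using linear_by_frame[OF lin(3) fr, of k] Y1 by simp
    moreover have "?P v \<bullet> w - ?P w \<bullet> v = \<beta> u \<bullet> v * ?Y w - \<beta> u \<bullet> w * ?Y v" for v w
      using skew_by_frame[OF lin(1) fr, of v w] unfolding P Yk[of v] Yk[of w] by (simp add: algebra_simps)
    ultimately show ?thesis by blast
  qed
  show "closed_form_on S \<beta>" using * unfolding closed_form_on_def by blast
  show "\<forall>u\<in>S. \<exists>m. \<forall>k. frechet_derivative Y (at u) k = m * (\<alpha> u \<bullet> k)" using * by blast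
  show "\<forall>u\<in>S. \<forall>v w. frechet_derivative \<alpha> (at u) v \<bullet> w - frechet_derivative \<alpha> (at u) w \<bullet> v =
       \<beta> u \<bullet> v * frechet_derivative Y (at u) w - \<beta> u \<bullet> w * frechet_derivative Y (at u) v" using * by blast
qed

section \<open>Normal forms in a coordinate domain\<close>

text \<open>The polarized determinant of symmetric matrices: divided by \<open>det (G u)\<close> it
  is the trace of \<open>g\<^sup>-\<^sup>1 a\<close>. Together with
  \<open>det (a u) / det (G u)\<close> it determines the characteristic polynomial.\<close>

definition mixed_det :: "(real^2 \<Rightarrow> real^2^2) \<Rightarrow> (real^2 \<Rightarrow> real^2^2) \<Rightarrow> real^2 \<Rightarrow> real" where
  "mixed_det G a u = G u $ 1 $ 1 * a u $ 2 $ 2 - 2 * (G u $ 1 $ 2 * a u $ 1 $ 2) + G u $ 2 $ 2 * a u $ 1 $ 1"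

lemma smooth_on_mat_vec:
  fixes G :: "real^2 \<Rightarrow> real^2^2"
  assumes "open S" "smooth_on S G"
  shows "smooth_on S (\<lambda>u. G u *v w)"
proof (rule smooth_on_vec[OF assms(1)])
  show "smooth_on S (\<lambda>u. (G u *v w) $ i)" for i
    unfolding matrix_vector_mult_def vec_lambda_beta
    by (intro smooth_on_sum smooth_on_mult smooth_on_entry smooth_on_const assms)
qed

lemma symmetric_on_combination:
  assumes "open S" "smooth_on S x" "smooth_on S y" "symmetric_on S G" "symmetric_on S a"
  shows "symmetric_on S (\<lambda>u. x u *\<^sub>R G u - y u *\<^sub>R a u)"
  using assms unfolding symmetric_on_def by (auto intro!: smooth_on_diff smooth_on_scaleR)

lemma form_combination:
  "form (\<lambda>u. x u *\<^sub>R G u - y u *\<^sub>R a u) u v w = x u * form G u v w - y u * form a u v w"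
  by (simp add: form_expand algebra_simps)

lemma form_axis: "form G u (axis i 1) (axis j 1) = G u $ i $ j"
  using exhaust_2[of i] exhaust_2[of j] by (auto simp: form_expand axis_def)

lemma det_combination:
  assumes "G u $ 2 $ 1 = G u $ 1 $ 2" "a u $ 2 $ 1 = a u $ 1 $ 2"
  shows "det (x *\<^sub>R G u - y *\<^sub>R a u) = x\<^sup>2 * det (G u) - x * y * mixed_det G a u + y\<^sup>2 * det (a u)"
  by (simp add: det_2 mixed_det_def assms power2_eq_square algebra_simps)

lemma open_positive:
  fixes f :: "real^2 \<Rightarrow> real"
  assumes "open S" "smooth_on S f"
  shows "open {u \<in> S. 0 < f u}"
proof -
  have "open (S \<inter> f -` {0<..})"
    by (rule continuous_open_preimage[OF smooth_on_imp_continuous_on[OF assms(2)] assms(1)]) simp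
  moreover have "S \<inter> f -` {0<..} = {u \<in> S. 0 < f u}" by auto
  ultimately show ?thesis by simp
qed

text \<open>If \<open>H\<close> is the square of a covector \<open>\<theta>\<close>, then
  \<open>H(v, w) = \<theta>(v) \<theta>(w)\<close>, so \<open>\<theta>\<close> is
  \<open>H(-, w)\<close> divided by the square root of \<open>H(w, w)\<close>. A vector
  \<open>w\<close> with a positive value at \<open>q\<close> serves on a whole
  neighbourhood.\<close>

lemma rank_one_root:
  assumes "open S" and H: "symmetric_on S H" and det: "\<And>u. u \<in> S \<Longrightarrow> det (H u) = 0"
    and pos: "q \<in> S" "0 < form H q w w"
  obtains T \<theta> where "open T" "T \<subseteq> S" "q \<in> T" "smooth_on T \<theta>"
    "\<And>u v v'. u \<in> T \<Longrightarrow> form H u v v' = \<theta> u \<bullet> v * (\<theta> u \<bullet> v')"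
proof -
  let ?T = "{u \<in> S. 0 < form H u w w}"
  let ?\<theta> = "\<lambda>u. inverse (sqrt (form H u w w)) *\<^sub>R (H u *v w)"
  note smH = symmetric_onD(1)[OF H]
  have smf: "smooth_on S (\<lambda>u. form H u w w)" by (intro smooth_on_form smH assms(1)) simp_all
  have T: "open ?T" by (rule open_positive[OF assms(1) smf])
  have "smooth_on ?T ?\<theta>"
    by (intro smooth_on_scaleR smooth_on_inverse smooth_on_sqrt T smooth_on_mat_vec
        smooth_on_subset[OF smf] smooth_on_subset[OF smH]) auto
  moreover have "form H u v v' = ?\<theta> u \<bullet> v * (?\<theta> u \<bullet> v')" if u: "u \<in> ?T" for u v v'
  proof -
    let ?f = "form H u w w"
    have sym: "H u $ 2 $ 1 = H u $ 1 $ 2" using symmetric_onD(2)[OF H] u by blast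
    have d: "H u $ 1 $ 1 * H u $ 2 $ 2 = H u $ 1 $ 2 * H u $ 1 $ 2"
      using det[of u] u sym by (simp add: det_2)
    have r: "form H u v v' * ?f = form H u v w * form H u v' w"
      unfolding form_expand sym using d by algebra
    have \<theta>: "?\<theta> u \<bullet> v = inverse (sqrt ?f) * form H u v w" for v
      by (simp add: form_def inner_commute)
    have "inverse (sqrt ?f) * inverse (sqrt ?f) * ?f = 1"
    proof -
      have "sqrt ?f * sqrt ?f = ?f" "sqrt ?f \<noteq> 0" using u by auto
      then show ?thesis by (simp add: field_simps)
    qed
    then have "form H u v v' = (inverse (sqrt ?f) * inverse (sqrt ?f)) * (form H u v v' * ?f)" by simp
    then show ?thesis unfolding r \<theta> by simp
  qed
  ultimately show ?thesis using that[OF T _ _ _] pos by blast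
qed

lemma smooth_on_vector2:
  assumes "open S" "smooth_on S f" "smooth_on S g"
  shows "smooth_on S (\<lambda>u. vector [f u, g u] :: real^2)"
proof (rule smooth_on_vec[OF assms(1)])
  show "smooth_on S (\<lambda>u. (vector [f u, g u] :: real^2) $ i)" for i
    using exhaust_2[of i] assms by auto
qed

lemma coordinates_from_functions:
  fixes f g :: "real^2 \<Rightarrow> real"
  assumes "open S" "q \<in> S" "smooth_on S f" "smooth_on S g"
    and df: "\<And>u v. u \<in> S \<Longrightarrow> frechet_derivative f (at u) v = \<theta> u \<bullet> v"
    and dg: "\<And>u v. u \<in> S \<Longrightarrow> frechet_derivative g (at u) v = \<omega> u \<bullet> v"
    and indep: "\<theta> q $ 1 * \<omega> q $ 2 - \<theta> q $ 2 * \<omega> q $ 1 \<noteq> 0"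
  obtains D \<psi> \<eta> a b where "D \<subseteq> S" "q \<in> D" "box_diffeo D \<psi> \<eta> a b"
    "\<And>u. \<psi> u $ 1 = f u" "\<And>u. \<psi> u $ 2 = g u"
    "\<And>u v. u \<in> D \<Longrightarrow> frechet_derivative \<psi> (at u) v = vector [\<theta> u \<bullet> v, \<omega> u \<bullet> v]"
proof -
  define \<psi> :: "real^2 \<Rightarrow> real^2" where "\<psi> u = vector [f u, g u]" for u
  have sm: "smooth_on S \<psi>" unfolding \<psi>_def by (rule smooth_on_vector2[OF assms(1,3,4)])
  have d\<psi>: "frechet_derivative \<psi> (at u) v = vector [\<theta> u \<bullet> v, \<omega> u \<bullet> v]" if u: "u \<in> S" for u v
  proof -
    have "frechet_derivative (\<lambda>u. \<psi> u $ i) (at u) v = frechet_derivative \<psi> (at u) v $ i" for i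
      by (rule frechet_derivative_bounded_linear[OF bounded_linear_vec_nth smooth_on_differentiable[OF sm u]])
    from this[of 1] this[of 2] show ?thesis unfolding vec2_eq_iff by (simp add: \<psi>_def df[OF u] dg[OF u])
  qed
  have "det (jacobian \<psi> (at q)) \<noteq> 0"
    using indep by (simp add: jacobian_def matrix_def det_2 d\<psi>[OF assms(2)] inner_axis)
      (simp add: algebra_simps)?
  from box_diffeo_exists[OF assms(1,2) sm this]
  obtain D \<eta> a b where D: "D \<subseteq> S" "q \<in> D" "box_diffeo D \<psi> \<eta> a b" .
  show ?thesis by (rule that[OF D]) (use d\<psi> D(1) in \<open>auto simp: \<psi>_def\<close>)
qed

lemma closed_form_exact:
  assumes "open S" "q \<in> S" "smooth_on S \<theta>" "closed_form_on S \<theta>"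
  obtains r f where "0 < r" "ball q r \<subseteq> S" "smooth_on (ball q r) f" "f q = 0"
    "\<And>u v. u \<in> ball q r \<Longrightarrow> frechet_derivative f (at u) v = \<theta> u \<bullet> v"
proof -
  obtain r where r: "0 < r" "ball q r \<subseteq> S" using assms(1,2) open_contains_ball by blast
  have "smooth_on (ball q r) \<theta>" using smooth_on_subset[OF assms(3) r(2)] .
  moreover have "frechet_derivative \<theta> (at u) v \<bullet> w = frechet_derivative \<theta> (at u) w \<bullet> v" if "u \<in> ball q r" for u v w
    using assms(4) r(2) that unfolding closed_form_on_def by blast
  ultimately obtain f where f: "smooth_on (ball q r) f" "f q = 0"
    "\<And>u. u \<in> ball q r \<Longrightarrow> (f has_derivative (\<lambda>v. \<theta> u \<bullet> v)) (at u)"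
    using poincare_lemma[of q r \<theta>] by metis
  show ?thesis
    by (rule that[OF r f(1,2)]) (use fun_cong[OF frechet_derivative_at[OF f(3)]] in metis)
qed

lemma coordinates_from_closed_forms:
  assumes "open S" "q \<in> S" "smooth_on S \<theta>" "closed_form_on S \<theta>" "smooth_on S \<omega>" "closed_form_on S \<omega>"
    and indep: "\<theta> q $ 1 * \<omega> q $ 2 - \<theta> q $ 2 * \<omega> q $ 1 \<noteq> 0"
  obtains D \<psi> \<eta> a b where "D \<subseteq> S" "q \<in> D" "box_diffeo D \<psi> \<eta> a b"
    "\<And>u v. u \<in> D \<Longrightarrow> frechet_derivative \<psi> (at u) v = vector [\<theta> u \<bullet> v, \<omega> u \<bullet> v]"
proof -
  obtain r f where f: "0 < r" "ball q r \<subseteq> S" "smooth_on (ball q r) f"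
    "\<And>u v. u \<in> ball q r \<Longrightarrow> frechet_derivative f (at u) v = \<theta> u \<bullet> v"
    using closed_form_exact[OF assms(1-4)] by metis
  obtain r' g where g: "0 < r'" "ball q r' \<subseteq> S" "smooth_on (ball q r') g"
    "\<And>u v. u \<in> ball q r' \<Longrightarrow> frechet_derivative g (at u) v = \<omega> u \<bullet> v"
    using closed_form_exact[OF assms(1,2,5,6)] by metis
  let ?B = "ball q (min r r')"
  have B: "q \<in> ?B" "?B \<subseteq> ball q r" "?B \<subseteq> ball q r'" using f(1) g(1) by auto
  show ?thesis
  proof (rule coordinates_from_functions[where \<theta>=\<theta> and \<omega>=\<omega>, OF open_ball B(1) smooth_on_subset[OF f(3) B(2)] smooth_on_subset[OF g(3) B(3)] _ _ indep])
    show "frechet_derivative f (at u) v = \<theta> u \<bullet> v" if "u \<in> ?B" for u v using f(4) B(2) that by blast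
    show "frechet_derivative g (at u) v = \<omega> u \<bullet> v" if "u \<in> ?B" for u v using g(4) B(3) that by blast
    fix D \<psi> \<eta> a b
    assume "D \<subseteq> ?B" "q \<in> D" "box_diffeo D \<psi> \<eta> a b"
      "\<And>u v. u \<in> D \<Longrightarrow> frechet_derivative \<psi> (at u) v = vector [\<theta> u \<bullet> v, \<omega> u \<bullet> v]"
    then show thesis using that B(2) f(2) by (meson order_trans)
  qed
qed

lemma killing_on_scale:
  assumes "open S" "symmetric_on S a" "killing_on S G a"
  shows "symmetric_on S (\<lambda>u. k *\<^sub>R a u)" "killing_on S G (\<lambda>u. k *\<^sub>R a u)"
proof -
  note sm = symmetric_onD(1)[OF assms(2)]
  show s: "symmetric_on S (\<lambda>u. k *\<^sub>R a u)"
    using assms(2) by (auto simp: symmetric_on_def intro!: smooth_on_scaleR assms(1))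
  have f: "form (\<lambda>u. k *\<^sub>R a u) u v w = k * form a u v w" for u v w by (simp add: form_expand algebra_simps)
  have "dform (\<lambda>u. k *\<^sub>R a u) u h v w = k * dform a u h v w" if u: "u \<in> S" for u h v w
    by (rule dform_eq_derivative[OF assms(1) symmetric_onD(1)[OF s] u f])
      (intro has_derivative_mult_right has_derivative_form[OF assms(1) sm u])
  then show "killing_on S G (\<lambda>u. k *\<^sub>R a u)"
    using assms(3) unfolding killing_on_def f by (simp add: mult.left_commute)
qed

text \<open>In the form aimed at, \<open>X g - a = (X - Y)\<^sup>2 dx\<^sup>2\<close> and
  \<open>s (a - Y g) = (X - Y)\<^sup>2 dy\<^sup>2\<close>. The equations for trace and determinant
  make both left sides singular, \<open>pos\<close> fixes their signs, and the coframe consists of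
  their square roots divided by \<open>X - Y\<close>.\<close>

lemma liouville_local:
  assumes S: "open S" "metric_on S G" "symmetric_on S a" "killing_on S G a" and q: "q \<in> S"
    and sm: "smooth_on S X" "smooth_on S Y" and s: "s \<in> {1, -1}"
    and XY: "\<And>u. u \<in> S \<Longrightarrow> X u \<noteq> Y u"
      "\<And>u. u \<in> S \<Longrightarrow> mixed_det G a u = (X u + Y u) * det (G u)"
      "\<And>u. u \<in> S \<Longrightarrow> det (a u) = X u * Y u * det (G u)"
    and pos: "0 < X q * form G q w w - form a q w w" "0 < s * (form a q w' w' - Y q * form G q w' w')"
  obtains D \<psi> \<eta> lo hi Xf Yf where "D \<subseteq> S" "q \<in> D" "box_diffeo D \<psi> \<eta> lo hi"
    "smooth_on ((\<lambda>u. u $ 1) ` box lo hi) Xf" "smooth_on ((\<lambda>u. u $ 2) ` box lo hi) Yf"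
    "\<And>u. u \<in> D \<Longrightarrow> X u = Xf (\<psi> u $ 1)" "\<And>u. u \<in> D \<Longrightarrow> Y u = Yf (\<psi> u $ 2)"
    "\<And>u v. u \<in> D \<Longrightarrow> form G u v v = (X u - Y u) *
       ((frechet_derivative \<psi> (at u) v $ 1)\<^sup>2 + s * (frechet_derivative \<psi> (at u) v $ 2)\<^sup>2)"
    "\<And>u v. u \<in> D \<Longrightarrow> form a u v v = (X u - Y u) *
       (Y u * (frechet_derivative \<psi> (at u) v $ 1)\<^sup>2 + s * X u * (frechet_derivative \<psi> (at u) v $ 2)\<^sup>2)"
proof -
  note G = metric_onD[OF S(2)]
  have ss: "s * s = 1" "s \<noteq> 0" using s by auto
  \<comment> \<open>\<open>?H2\<close> is \<open>s (a - Y g)\<close>, written in the shape of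
    \<open>symmetric_on_combination\<close>.\<close>
  let ?H1 = "\<lambda>u. X u *\<^sub>R G u - 1 *\<^sub>R a u" and ?H2 = "\<lambda>u. (- s * Y u) *\<^sub>R G u - (- s) *\<^sub>R a u"
  have sym1: "symmetric_on S ?H1" by (intro symmetric_on_combination S(1,3) G(1) sm(1)) simp
  have sym2: "symmetric_on S ?H2"
    by (intro symmetric_on_combination S(1,3) G(1) smooth_on_mult smooth_on_const sm(2))
  have det1: "det (?H1 u) = 0" if u: "u \<in> S" for u
    unfolding det_combination[of G u a, OF G(3)[OF u] symmetric_onD(2)[OF S(3) u]] XY(2,3)[OF u]
    by (simp add: power2_eq_square algebra_simps)
  have det2: "det (?H2 u) = 0" if u: "u \<in> S" for u
    unfolding det_combination[of G u a, OF G(3)[OF u] symmetric_onD(2)[OF S(3) u]] XY(2,3)[OF u]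
    by (simp add: power2_eq_square algebra_simps)
  have pos1: "0 < form ?H1 q w w" and pos2: "0 < form ?H2 q w' w'"
    using pos unfolding form_combination by (simp_all add: algebra_simps)
  obtain T1 \<theta> where T1: "open T1" "T1 \<subseteq> S" "q \<in> T1" "smooth_on T1 \<theta>"
    "\<And>u v v'. u \<in> T1 \<Longrightarrow> form ?H1 u v v' = \<theta> u \<bullet> v * (\<theta> u \<bullet> v')"
    by (rule rank_one_root[OF S(1) sym1 det1 q pos1]) auto
  obtain T2 \<omega> where T2: "open T2" "T2 \<subseteq> S" "q \<in> T2" "smooth_on T2 \<omega>"
    "\<And>u v v'. u \<in> T2 \<Longrightarrow> form ?H2 u v v' = \<omega> u \<bullet> v * (\<omega> u \<bullet> v')"
    by (rule rank_one_root[OF S(1) sym2 det2 q pos2]) auto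
  let ?T = "T1 \<inter> T2"
  have T: "open ?T" "?T \<subseteq> S" "q \<in> ?T" using T1 T2 by auto
  define p where "p u = inverse (X u - Y u) *\<^sub>R \<theta> u" for u
  define r where "r u = inverse (X u - Y u) *\<^sub>R \<omega> u" for u
  have smXY: "smooth_on ?T X" "smooth_on ?T Y" using sm T(2) smooth_on_subset by blast+
  have XY0: "X u - Y u \<noteq> 0" if "u \<in> ?T" for u using XY(1) T(2) that by auto
  have smi: "smooth_on ?T (\<lambda>u. inverse (X u - Y u))"
    by (intro smooth_on_inverse smooth_on_diff T(1) smXY XY0)
  have smp: "smooth_on ?T p" "smooth_on ?T r"
    unfolding p_def r_def using smi T1(4) T2(4) by (auto intro!: smooth_on_scaleR T(1) intro: smooth_on_subset)
  have pp: "\<theta> u = (X u - Y u) *\<^sub>R p u" "\<omega> u = (X u - Y u) *\<^sub>R r u" if "u \<in> ?T" for u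
    using XY0[OF that] by (simp_all add: p_def r_def)
  have HH: "X u * form G u v v' - form a u v v' = (X u - Y u) * (X u - Y u) * (p u \<bullet> v * (p u \<bullet> v'))"
    "s * (form a u v v' - Y u * form G u v v') = (X u - Y u) * (X u - Y u) * (r u \<bullet> v * (r u \<bullet> v'))" if u: "u \<in> ?T" for u v v'
    using T1(5)[of u v v'] T2(5)[of u v v'] u unfolding form_combination pp[OF u] by (simp_all add: algebra_simps)
  have H2': "form a u v v' - Y u * form G u v v' = (X u - Y u) * (X u - Y u) * (s * (r u \<bullet> v * (r u \<bullet> v')))" if u: "u \<in> ?T" for u v v'
  proof -
    have "form a u v v' - Y u * form G u v v' = s * (s * (form a u v v' - Y u * form G u v v'))"
      using ss(1) by (simp add: mult.assoc[symmetric])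
    then show ?thesis unfolding HH(2)[OF u] by (simp add: algebra_simps)
  qed
  have Gf: "form G u v v' = (X u - Y u) * (p u \<bullet> v * (p u \<bullet> v') + s * (r u \<bullet> v * (r u \<bullet> v')))" if u: "u \<in> ?T" for u v v'
  proof -
    have "(X u - Y u) * form G u v v' = (X u - Y u) * ((X u - Y u) * (p u \<bullet> v * (p u \<bullet> v') + s * (r u \<bullet> v * (r u \<bullet> v'))))"
      using HH(1)[OF u, of v v'] H2'[OF u, of v v'] by (simp add: algebra_simps)
    then show ?thesis using XY0[OF u] by simp
  qed
  have af: "form a u v v' = (X u - Y u) * (Y u * (p u \<bullet> v * (p u \<bullet> v')) + s * X u * (r u \<bullet> v * (r u \<bullet> v')))" if u: "u \<in> ?T" for u v v'
    using HH(1)[OF u, of v v'] unfolding Gf[OF u] by (simp add: algebra_simps)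
  \<comment> \<open>A dependent coframe would make \<open>g\<close> degenerate: the determinant of
    \<open>g\<close> is \<open>s (X - Y)\<^sup>2\<close> times the square of the determinant of the
    coframe.\<close>
  have indep: "p u $ 1 * r u $ 2 - p u $ 2 * r u $ 1 \<noteq> 0" if u: "u \<in> ?T" for u
  proof
    assume 0: "p u $ 1 * r u $ 2 - p u $ 2 * r u $ 1 = 0"
    have e: "G u $ i $ j = (X u - Y u) * (p u $ i * p u $ j + s * (r u $ i * r u $ j))" for i j
      using Gf[OF u, of "axis i 1" "axis j 1"] by (simp add: form_axis inner_axis)
    have "G u $ 1 $ 1 * G u $ 2 $ 2 - (G u $ 1 $ 2)\<^sup>2 = (X u - Y u)\<^sup>2 * s * (p u $ 1 * r u $ 2 - p u $ 2 * r u $ 1)\<^sup>2"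
      unfolding e by algebra
    then show False using G(5)[of u] T(2) u 0 by auto
  qed
  note S' = T(1) metric_on_subset[OF S(2) T(2)] symmetric_on_subset[OF S(3) T(2)] killing_on_subset[OF S(4) T(2)]
  note cl = liouville_closed[OF S' smXY smp ss(2) _ indep Gf af]
  have XYT: "X u \<noteq> Y u" if "u \<in> ?T" for u using XY(1) T(2) that by blast
  note cl = cl[OF XYT]
  obtain D \<psi> \<eta> lo hi where D: "D \<subseteq> ?T" "q \<in> D" "box_diffeo D \<psi> \<eta> lo hi"
    and d\<psi>: "\<And>u v. u \<in> D \<Longrightarrow> frechet_derivative \<psi> (at u) v = vector [p u \<bullet> v, r u \<bullet> v]"
    using coordinates_from_closed_forms[OF T(1,3) smp(1) cl(1) smp(2) cl(2) indep[OF T(3)]] by metis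
  have ne: "D \<noteq> {}" using D(2) by blast
  obtain mX where mX: "\<And>u k. u \<in> ?T \<Longrightarrow> frechet_derivative X (at u) k = mX u * (p u \<bullet> k)" using cl(3) by metis
  obtain mY where mY: "\<And>u k. u \<in> ?T \<Longrightarrow> frechet_derivative Y (at u) k = mY u * (r u \<bullet> k)" using cl(4) by metis
  obtain Xf :: "real \<Rightarrow> real" where Xf: "smooth_on ((\<lambda>u. u $ 1) ` box lo hi) Xf" "\<And>u. u \<in> D \<Longrightarrow> X u = Xf (\<psi> u $ 1)"
  proof (rule function_of_coordinate[OF D(3) smooth_on_subset[OF smXY(1) D(1)] ne])
    show "frechet_derivative X (at u) k = mX u * frechet_derivative \<psi> (at u) k $ 1" if "u \<in> D" for u k
      using mX[OF subsetD[OF D(1) that]] d\<psi>[OF that] by simp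
  qed auto
  obtain Yf :: "real \<Rightarrow> real" where Yf: "smooth_on ((\<lambda>u. u $ 2) ` box lo hi) Yf" "\<And>u. u \<in> D \<Longrightarrow> Y u = Yf (\<psi> u $ 2)"
  proof (rule function_of_coordinate[OF D(3) smooth_on_subset[OF smXY(2) D(1)] ne])
    show "frechet_derivative Y (at u) k = mY u * frechet_derivative \<psi> (at u) k $ 2" if "u \<in> D" for u k
      using mY[OF subsetD[OF D(1) that]] d\<psi>[OF that] by simp
  qed auto
  show ?thesis
  proof (rule that[OF _ D(2,3) Xf(1) Yf(1) Xf(2) Yf(2)])
    show "D \<subseteq> S" using D(1) T(2) by blast
    fix u v assume u: "u \<in> D"
    then have uT: "u \<in> ?T" using D(1) by blast
    show "form G u v v = (X u - Y u) *
       ((frechet_derivative \<psi> (at u) v $ 1)\<^sup>2 + s * (frechet_derivative \<psi> (at u) v $ 2)\<^sup>2)"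
      unfolding Gf[OF uT] d\<psi>[OF u] by (simp add: power2_eq_square)
    show "form a u v v = (X u - Y u) *
       (Y u * (frechet_derivative \<psi> (at u) v $ 1)\<^sup>2 + s * X u * (frechet_derivative \<psi> (at u) v $ 2)\<^sup>2)"
      unfolding af[OF uT] d\<psi>[OF u] by (simp add: power2_eq_square)
  qed auto
qed

lemma form_nonzero_vector:
  assumes "det (G u) \<noteq> 0" "G u $ 2 $ 1 = G u $ 1 $ 2"
  obtains w where "form G u w w \<noteq> 0"
proof -
  have "\<exists>w. form G u w w \<noteq> 0"
  proof (rule ccontr)
    assume "\<nexists>w. form G u w w \<noteq> 0"
    then have 0: "form G u w w = 0" for w by blast
    have "G u $ 1 $ 1 = 0" "G u $ 2 $ 2 = 0" "G u $ 1 $ 2 = 0"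
      using 0[of "vector [1, 0]"] 0[of "vector [0, 1]"] 0[of "vector [1, 1]"] assms(2) by (simp_all add: form_expand)
    then show False using assms by (simp add: det_2)
  qed
  then show ?thesis using that by blast
qed

text \<open>The real and imaginary parts of the rank one identity for the complex matrix \<open>A + i B\<close>.\<close>

lemma complex_rank_one:
  assumes A: "A u $ 2 $ 1 = A u $ 1 $ 2" and B: "B u $ 2 $ 1 = B u $ 1 $ 2"
    and re: "A u $ 1 $ 1 * A u $ 2 $ 2 - B u $ 1 $ 1 * B u $ 2 $ 2 = A u $ 1 $ 2 * A u $ 1 $ 2 - B u $ 1 $ 2 * B u $ 1 $ 2"
    and im: "A u $ 1 $ 1 * B u $ 2 $ 2 + B u $ 1 $ 1 * A u $ 2 $ 2 = 2 * (A u $ 1 $ 2 * B u $ 1 $ 2)"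
  shows "form A u v v' * form A u w w - form B u v v' * form B u w w
      = form A u v w * form A u v' w - form B u v w * form B u v' w"
    "form A u v v' * form B u w w + form B u v v' * form A u w w
      = form A u v w * form B u v' w + form B u v w * form A u v' w"
  unfolding form_expand A B using re im by algebra+

text \<open>\<open>r + i s\<close> is the principal square root of \<open>x + i y\<close>, and
  \<open>n\<close> the modulus. The condition on \<open>y\<close> avoids the branch cut, which makes
  \<open>r\<close> positive and the formula for \<open>s\<close> meaningful.\<close>

lemma complex_sqrt_real:
  fixes x y :: real
  assumes "y \<noteq> 0"
  defines "n \<equiv> sqrt (x\<^sup>2 + y\<^sup>2)"
  defines "r \<equiv> sqrt ((n + x) / 2)"
  defines "s \<equiv> y / (2 * r)"
  shows "0 < n" "0 < (n + x) / 2" "0 < r" "r * r - s * s = x" "2 * (r * s) = y" "n * n = x * x + y * y"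
proof -
  have y2: "0 < y\<^sup>2" using assms(1) by simp
  have nn: "n * n = x * x + y * y" unfolding n_def by (simp add: power2_eq_square)
  then show "n * n = x * x + y * y" .
  show "0 < n" unfolding n_def using y2 by (simp add: add_nonneg_pos)
  have "\<bar>x\<bar> < n" unfolding n_def by (rule real_less_rsqrt) (use y2 in simp)
  then show nx: "0 < (n + x) / 2" by simp
  then show r: "0 < r" unfolding r_def by simp
  have rr: "r * r = (n + x) / 2" unfolding r_def using nx by simp
  show "2 * (r * s) = y" unfolding s_def using r by simp
  have "s * s = y * y / (4 * (r * r))" unfolding s_def by simp
  also have "\<dots> = (n - x) / 2"
    unfolding rr using nn nx by (simp add: field_simps)
  finally show "r * r - s * s = x" unfolding rr by (simp add: field_simps)
qed

text \<open>In the form aimed at, \<open>(R + i I) g - a = I\<^sup>2 (dx + i dy)\<^sup>2\<close>.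
  The left side has the real part \<open>A\<close> and the imaginary part \<open>B\<close>; it is
  singular because \<open>R + i I\<close> is an eigenvalue, and \<open>dx + i dy\<close> is its
  complex square root divided by \<open>I\<close>.\<close>

lemma complex_liouville_local:
  assumes S: "open S" "metric_on S G" "symmetric_on S a" "killing_on S G a" and q: "q \<in> S"
    and sm: "smooth_on S R" "smooth_on S I"
    and I: "\<And>u. u \<in> S \<Longrightarrow> I u \<noteq> 0"
    and mix: "\<And>u. u \<in> S \<Longrightarrow> mixed_det G a u = 2 * R u * det (G u)"
    and det: "\<And>u. u \<in> S \<Longrightarrow> det (a u) = ((R u)\<^sup>2 + (I u)\<^sup>2) * det (G u)"
  obtains D \<psi> \<eta> lo hi h where "D \<subseteq> S" "q \<in> D" "box_diffeo D \<psi> \<eta> lo hi"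
    "h holomorphic_on (\<lambda>u. Complex (u $ 1) (u $ 2)) ` box lo hi"
    "\<And>u. u \<in> D \<Longrightarrow> h (Complex (\<psi> u $ 1) (\<psi> u $ 2)) = Complex (R u) (I u)"
    "\<And>u v. u \<in> D \<Longrightarrow> form G u v v =
       2 * I u * (frechet_derivative \<psi> (at u) v $ 1) * (frechet_derivative \<psi> (at u) v $ 2)"
    "\<And>u v. u \<in> D \<Longrightarrow> form a u v v =
       2 * R u * I u * (frechet_derivative \<psi> (at u) v $ 1) * (frechet_derivative \<psi> (at u) v $ 2)
       - (I u)\<^sup>2 * ((frechet_derivative \<psi> (at u) v $ 1)\<^sup>2 - (frechet_derivative \<psi> (at u) v $ 2)\<^sup>2)"
proof -
  note G = metric_onD[OF S(2)]
  define A where "A u = R u *\<^sub>R G u - 1 *\<^sub>R a u" for u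
  define B where "B u = I u *\<^sub>R G u - 0 *\<^sub>R a u" for u
  have symA: "symmetric_on S A" and symB: "symmetric_on S B"
    unfolding A_def B_def by (intro symmetric_on_combination S(1,3) G(1) sm smooth_on_const)+
  note smA = symmetric_onD(1)[OF symA] and smB = symmetric_onD(1)[OF symB]
  have fA: "form A u v v' = R u * form G u v v' - form a u v v'" for u v v'
    unfolding A_def form_combination by simp
  have fB: "form B u v v' = I u * form G u v v'" for u v v'
    unfolding B_def form_combination by simp
  obtain w where w: "form G q w w \<noteq> 0" using form_nonzero_vector[of G q, OF G(4)[OF q] G(3)[OF q]] .
  define x where "x u = form A u w w" for u
  define y where "y u = form B u w w" for u
  \<comment> \<open>The square root is taken of \<open>x + i y\<close>, so \<open>y\<close> must not
    vanish; the square expresses this as positivity, whatever the sign of \<open>y\<close>.\<close>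
  let ?T = "{u \<in> S. 0 < y u * y u}"
  have smx: "smooth_on S x" and smy: "smooth_on S y"
    unfolding x_def y_def by (intro smooth_on_form smA smB smooth_on_const S(1))+
  have T: "open ?T" by (rule open_positive[OF S(1) smooth_on_mult[OF S(1) smy smy]])
  have "y q \<noteq> 0" using w I[OF q] by (simp add: y_def fB)
  then have "0 < y q * y q" using not_real_square_gt_zero by blast
  then have qT: "q \<in> ?T" using q by simp
  have TS: "?T \<subseteq> S" by blast
  have y0: "y u \<noteq> 0" if "u \<in> ?T" for u using that by auto
  define n where "n u = sqrt ((x u)\<^sup>2 + (y u)\<^sup>2)" for u
  define r where "r u = sqrt ((n u + x u) / 2)" for u
  define s where "s u = y u / (2 * r u)" for u
  have cs: "0 < n u" "0 < (n u + x u) / 2" "0 < r u" "r u * r u - s u * s u = x u" "2 * (r u * s u) = y u"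
    "n u * n u = x u * x u + y u * y u" if "u \<in> ?T" for u
    using complex_sqrt_real[OF y0[OF that], of "x u"] unfolding s_def r_def n_def by blast+
  have smxT: "smooth_on ?T x" "smooth_on ?T y" using smx smy TS smooth_on_subset by blast+
  have smn: "smooth_on ?T n"
    unfolding n_def by (intro smooth_on_sqrt smooth_on_add smooth_on_power smxT T)
      (use y0 in \<open>simp add: add_nonneg_pos\<close>)
  have smr: "smooth_on ?T r"
    unfolding r_def by (intro smooth_on_sqrt smooth_on_divide smooth_on_add smooth_on_const smxT smn T)
      (use cs(2) in auto)
  have sms: "smooth_on ?T s"
    unfolding s_def by (intro smooth_on_divide smooth_on_mult smooth_on_const smxT smr T) (use cs(3) in force)
  \<comment> \<open>\<open>p + i k\<close> is \<open>(A + i B)(-, w)\<close> divided by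
    \<open>I (r + i s)\<close>, where \<open>1 / (r + i s) = (r - i s) / n\<close>.\<close>
  define p where "p u = inverse (n u * I u) *\<^sub>R (r u *\<^sub>R (A u *v w) + s u *\<^sub>R (B u *v w))" for u
  define k where "k u = inverse (n u * I u) *\<^sub>R (r u *\<^sub>R (B u *v w) - s u *\<^sub>R (A u *v w))" for u
  have smI: "smooth_on ?T I" "smooth_on ?T R" using sm TS smooth_on_subset by blast+
  have n0: "n u \<noteq> 0" "I u \<noteq> 0" if "u \<in> ?T" for u using cs(1)[OF that] I TS that by auto
  have smi: "smooth_on ?T (\<lambda>u. inverse (n u * I u))"
    by (intro smooth_on_inverse smooth_on_mult smn smI T) (use n0 in auto)
  have smAB: "smooth_on ?T (\<lambda>u. A u *v w)" "smooth_on ?T (\<lambda>u. B u *v w)"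
    by (rule smooth_on_mat_vec[OF T smooth_on_subset[OF smA TS]], rule smooth_on_mat_vec[OF T smooth_on_subset[OF smB TS]])
  have smp: "smooth_on ?T p" "smooth_on ?T k"
    unfolding p_def k_def by (intro smooth_on_scaleR smooth_on_add smooth_on_diff smi smr sms smAB T)+
  have pk: "n u * I u * (p u \<bullet> v) = r u * form A u v w + s u * form B u v w"
    "n u * I u * (k u \<bullet> v) = r u * form B u v w - s u * form A u v w" if "u \<in> ?T" for u v
  proof -
    have "n u * I u \<noteq> 0" using n0[OF that] by simp
    then have "n u * I u * inverse (n u * I u) = 1" by (rule right_inverse)
    then have e: "n u * I u * (inverse (n u * I u) * z) = z" for z
      by (metis mult.assoc mult_1_left)
    have c: "(A u *v w) \<bullet> v = form A u v w" "(B u *v w) \<bullet> v = form B u v w"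
      by (simp_all add: form_def inner_commute)
    show "n u * I u * (p u \<bullet> v) = r u * form A u v w + s u * form B u v w"
      unfolding p_def inner_scaleR_left e inner_add_left c ..
    show "n u * I u * (k u \<bullet> v) = r u * form B u v w - s u * form A u v w"
      unfolding k_def inner_scaleR_left e inner_diff_left c ..
  qed
  have key: "(I u)\<^sup>2 * (p u \<bullet> v * (p u \<bullet> v') - k u \<bullet> v * (k u \<bullet> v')) = form A u v v'"
    "(I u)\<^sup>2 * (p u \<bullet> v * (k u \<bullet> v') + k u \<bullet> v * (p u \<bullet> v')) = form B u v v'" if u: "u \<in> ?T" for u v v'
  proof -
    have uS: "u \<in> S" using u by blast
    \<comment> \<open>\<open>re\<close> and \<open>im\<close> are the real and imaginary parts of
      \<open>det (A + i B) = 0\<close>.\<close>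
    have re: "A u $ 1 $ 1 * A u $ 2 $ 2 - B u $ 1 $ 1 * B u $ 2 $ 2 = A u $ 1 $ 2 * A u $ 1 $ 2 - B u $ 1 $ 2 * B u $ 1 $ 2"
      using det_combination[of G u a, OF G(3)[OF uS] symmetric_onD(2)[OF S(3) uS], of "R u" 1]
      unfolding mix[OF uS] det[OF uS] unfolding A_def B_def det_2 G(3)[OF uS] symmetric_onD(2)[OF S(3) uS]
      by (simp add: symmetric_onD(2)[OF S(3) uS] G(3)[OF uS] power2_eq_square algebra_simps)
    have im: "A u $ 1 $ 1 * B u $ 2 $ 2 + B u $ 1 $ 1 * A u $ 2 $ 2 = 2 * (A u $ 1 $ 2 * B u $ 1 $ 2)"
    proof -
      have "A u $ 1 $ 1 * B u $ 2 $ 2 + B u $ 1 $ 1 * A u $ 2 $ 2 - 2 * (A u $ 1 $ 2 * B u $ 1 $ 2)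
         = I u * (2 * R u * det (G u) - mixed_det G a u)"
        by (simp add: A_def B_def det_2 mixed_det_def G(3)[OF uS] algebra_simps)
      then show ?thesis using mix[OF uS] by simp
    qed
    note r1 = complex_rank_one[of A u B, OF symmetric_onD(2)[OF symA uS] symmetric_onD(2)[OF symB uS] re im, where w=w, folded x_def y_def]
    note c = cs(4-6)[OF u]
    have "(n u * n u) * ((I u)\<^sup>2 * (p u \<bullet> v * (p u \<bullet> v') - k u \<bullet> v * (k u \<bullet> v')))
       = (n u * I u * (p u \<bullet> v)) * (n u * I u * (p u \<bullet> v')) - (n u * I u * (k u \<bullet> v)) * (n u * I u * (k u \<bullet> v'))"
      by (simp add: power2_eq_square algebra_simps)
    also have "\<dots> = (r u * r u - s u * s u) * (form A u v w * form A u v' w - form B u v w * form B u v' w)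
       + 2 * (r u * s u) * (form A u v w * form B u v' w + form B u v w * form A u v' w)"
      unfolding pk[OF u] by (simp add: algebra_simps)
    also have "\<dots> = (n u * n u) * form A u v v'"
      unfolding c r1[of v v', symmetric] by (simp add: algebra_simps)
    finally show "(I u)\<^sup>2 * (p u \<bullet> v * (p u \<bullet> v') - k u \<bullet> v * (k u \<bullet> v')) = form A u v v'"
      using n0[OF u] by simp
    have "(n u * n u) * ((I u)\<^sup>2 * (p u \<bullet> v * (k u \<bullet> v') + k u \<bullet> v * (p u \<bullet> v')))
       = (n u * I u * (p u \<bullet> v)) * (n u * I u * (k u \<bullet> v')) + (n u * I u * (k u \<bullet> v)) * (n u * I u * (p u \<bullet> v'))"
      by (simp add: power2_eq_square algebra_simps)
    also have "\<dots> = (r u * r u - s u * s u) * (form A u v w * form B u v' w + form B u v w * form A u v' w)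
       - 2 * (r u * s u) * (form A u v w * form A u v' w - form B u v w * form B u v' w)"
      unfolding pk[OF u] by (simp add: algebra_simps)
    also have "\<dots> = (n u * n u) * form B u v v'"
      unfolding c r1[of v v', symmetric] by (simp add: algebra_simps)
    finally show "(I u)\<^sup>2 * (p u \<bullet> v * (k u \<bullet> v') + k u \<bullet> v * (p u \<bullet> v')) = form B u v v'"
      using n0[OF u] by simp
  qed
  have Gf: "form G u v v' = I u * (p u \<bullet> v * (k u \<bullet> v') + k u \<bullet> v * (p u \<bullet> v'))" if u: "u \<in> ?T" for u v v'
  proof -
    have "I u * form G u v v' = I u * (I u * (p u \<bullet> v * (k u \<bullet> v') + k u \<bullet> v * (p u \<bullet> v')))"
      using key(2)[OF u, of v v', symmetric] unfolding fB power2_eq_square mult.assoc .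
    then show ?thesis using mult_left_cancel[OF n0(2)[OF u]] by blast
  qed
  have af: "form a u v v' = R u * (I u * (p u \<bullet> v * (k u \<bullet> v') + k u \<bullet> v * (p u \<bullet> v')))
       - I u * I u * (p u \<bullet> v * (p u \<bullet> v') - k u \<bullet> v * (k u \<bullet> v'))" if u: "u \<in> ?T" for u v v'
    using key(1)[OF u, of v v'] unfolding fA Gf[OF u] by (simp add: power2_eq_square)
  have indep: "p u $ 1 * k u $ 2 - p u $ 2 * k u $ 1 \<noteq> 0" if u: "u \<in> ?T" for u
  proof
    assume 0: "p u $ 1 * k u $ 2 - p u $ 2 * k u $ 1 = 0"
    have e: "G u $ i $ j = I u * (p u $ i * k u $ j + k u $ i * p u $ j)" for i j
      using Gf[OF u, of "axis i 1" "axis j 1"] by (simp add: form_axis inner_axis)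
    have "G u $ 1 $ 1 * G u $ 2 $ 2 - (G u $ 1 $ 2)\<^sup>2 = - (I u)\<^sup>2 * (p u $ 1 * k u $ 2 - p u $ 2 * k u $ 1)\<^sup>2"
      unfolding e by algebra
    then show False using G(5)[of u] TS u 0 by auto
  qed
  note S' = T(1) metric_on_subset[OF S(2) TS] symmetric_on_subset[OF S(3) TS] killing_on_subset[OF S(4) TS]
  note cc = complex_liouville_closed[where p=p and q=k and R=R and I=I, OF S' smI(2,1) smp n0(2) indep Gf af]
  have cl: "closed_form_on ?T p" "closed_form_on ?T k"
    "\<forall>u\<in>?T. \<exists>m n. \<forall>h. frechet_derivative R (at u) h = m * (p u \<bullet> h) - n * (k u \<bullet> h) \<and>
       frechet_derivative I (at u) h = n * (p u \<bullet> h) + m * (k u \<bullet> h)"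
    by (rule cc; assumption)+
  obtain D \<psi> \<eta> lo hi where D: "D \<subseteq> ?T" "q \<in> D" and bd: "box_diffeo D \<psi> \<eta> lo hi"
    and d\<psi>: "\<And>u v. u \<in> D \<Longrightarrow> frechet_derivative \<psi> (at u) v = vector [p u \<bullet> v, k u \<bullet> v]"
    by (rule coordinates_from_closed_forms[OF T(1) qT smp(1) cl(1) smp(2) cl(2) indep[OF qT]]) (rule that)
  note d = box_diffeoD[OF bd]
  define h where "h z = Complex (R (\<eta> (vector [Re z, Im z]))) (I (\<eta> (vector [Re z, Im z])))" for z
  have vec_id: "vector [v $ 1, v $ 2] = v" for v :: "real^2" by (simp add: vec2_eq_iff)
  have holo: "h holomorphic_on (\<lambda>u. Complex (u $ 1) (u $ 2)) ` box lo hi"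
  proof (rule holomorphic_onI)
    fix z assume "z \<in> (\<lambda>u. Complex (u $ 1) (u $ 2)) ` box lo hi"
    then obtain t where t: "t \<in> box lo hi" "z = Complex (t $ 1) (t $ 2)" by blast
    let ?V = "\<lambda>z. vector [Re z, Im z] :: real^2"
    have Vz: "?V z = t" using t(2) by (simp add: vec_id)
    have uD: "\<eta> t \<in> D" using d(6)[OF t(1)] .
    then have uT: "\<eta> t \<in> ?T" using D(1) by blast
    obtain m l where "\<forall>h. frechet_derivative R (at (\<eta> t)) h = m * (p (\<eta> t) \<bullet> h) - l * (k (\<eta> t) \<bullet> h) \<and>
       frechet_derivative I (at (\<eta> t)) h = l * (p (\<eta> t) \<bullet> h) + m * (k (\<eta> t) \<bullet> h)"
      using bspec[OF cl(3) uT] by (elim exE)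
    then have ml: "frechet_derivative R (at (\<eta> t)) h = m * (p (\<eta> t) \<bullet> h) - l * (k (\<eta> t) \<bullet> h)"
      "frechet_derivative I (at (\<eta> t)) h = l * (p (\<eta> t) \<bullet> h) + m * (k (\<eta> t) \<bullet> h)" for h by auto
    have V: "(?V has_derivative ?V) (at z)"
    proof -
      have "bounded_linear ?V"
        unfolding linear_conv_bounded_linear[symmetric] by (auto simp: linear_iff vec2_eq_iff)
      then show ?thesis by (rule bounded_linear_imp_has_derivative)
    qed
    have \<eta>: "(\<eta> has_derivative frechet_derivative \<eta> (at t)) (at (?V z))"
      unfolding Vz using smooth_on_has_derivative[OF d(3) t(1)] .
    have dd: "p (\<eta> t) \<bullet> frechet_derivative \<eta> (at t) v = v $ 1" "k (\<eta> t) \<bullet> frechet_derivative \<eta> (at t) v = v $ 2" for v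
      using box_diffeo_inverse_derivative[OF bd t(1), of v] unfolding d\<psi>[OF uD] vec2_eq_iff by simp_all
    have dR: "((\<lambda>z. R (\<eta> (?V z))) has_derivative (\<lambda>v. m * Re v - l * Im v)) (at z)"
    proof -
      have "(R has_derivative frechet_derivative R (at (\<eta> t))) (at (\<eta> (?V z)))"
        unfolding Vz using smooth_on_has_derivative[OF smI(2) uT] .
      from has_derivative_compose[OF has_derivative_compose[OF V \<eta>] this]
      show ?thesis unfolding ml(1) dd by simp
    qed
    have dI: "((\<lambda>z. I (\<eta> (?V z))) has_derivative (\<lambda>v. l * Re v + m * Im v)) (at z)"
    proof -
      have "(I has_derivative frechet_derivative I (at (\<eta> t))) (at (\<eta> (?V z)))"
        unfolding Vz using smooth_on_has_derivative[OF smI(1) uT] .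
      from has_derivative_compose[OF has_derivative_compose[OF V \<eta>] this]
      show ?thesis unfolding ml(2) dd by simp
    qed
    \<comment> \<open>The Cauchy-Riemann equations make the real derivative the multiplication by
      \<open>m + i l\<close>.\<close>
    have "(h has_derivative (\<lambda>v. Complex (m) (l) * v)) (at z)"
      unfolding h_def Complex_eq
      by (rule has_derivative_eq_rhs[OF has_derivative_add[OF has_derivative_of_real[OF dR]
            has_derivative_mult_right[OF has_derivative_of_real[OF dI], of \<i>]]])
        (auto simp: complex_eq_iff)
    then show "h field_differentiable (at z within (\<lambda>u. Complex (u $ 1) (u $ 2)) ` box lo hi)"
      unfolding field_differentiable_def has_field_derivative_def using has_derivative_at_withinI by blast
  qed
  show ?thesis
  proof (rule that[OF _ D(2) bd holo])
    show "D \<subseteq> S" using D(1) TS by blast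
    show "h (Complex (\<psi> u $ 1) (\<psi> u $ 2)) = Complex (R u) (I u)" if "u \<in> D" for u
      by (simp add: h_def vec_id d(5)[OF that])
    fix u v assume u: "u \<in> D"
    then have uT: "u \<in> ?T" using D(1) by blast
    show "form G u v v = 2 * I u * (frechet_derivative \<psi> (at u) v $ 1) * (frechet_derivative \<psi> (at u) v $ 2)"
      unfolding Gf[OF uT] d\<psi>[OF u] by simp
    show "form a u v v = 2 * R u * I u * (frechet_derivative \<psi> (at u) v $ 1) * (frechet_derivative \<psi> (at u) v $ 2)
       - (I u)\<^sup>2 * ((frechet_derivative \<psi> (at u) v $ 1)\<^sup>2 - (frechet_derivative \<psi> (at u) v $ 2)\<^sup>2)"
      unfolding af[OF uT] d\<psi>[OF u] by (simp add: power2_eq_square)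
  qed
qed

text \<open>In the form aimed at, \<open>2 (Y g - a) = \<alpha>\<^sup>2\<close> with
  \<open>\<alpha> = (1 + x Y') dy\<close>, and \<open>g\<close> is the symmetric product of
  \<open>\<alpha>\<close> and \<open>dx\<close>. So \<open>\<alpha>\<close> is a square root,
  \<open>dx\<close> the complementary factor \<open>\<beta>\<close> of \<open>g\<close>, and
  \<open>dy\<close> the closed form \<open>\<alpha> - x dY\<close>.\<close>

lemma jordan_local:
  assumes S: "open S" "metric_on S G" "symmetric_on S a" "killing_on S G a" and q: "q \<in> S"
    and sm: "smooth_on S Y"
    and mix: "\<And>u. u \<in> S \<Longrightarrow> mixed_det G a u = 2 * Y u * det (G u)"
    and det: "\<And>u. u \<in> S \<Longrightarrow> det (a u) = (Y u)\<^sup>2 * det (G u)"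
    and pos: "0 < Y q * form G q w w - form a q w w"
  obtains D \<psi> \<eta> lo hi Yf where "D \<subseteq> S" "q \<in> D" "box_diffeo D \<psi> \<eta> lo hi"
    "smooth_on ((\<lambda>u. u $ 2) ` box lo hi) Yf" "\<And>u. u \<in> D \<Longrightarrow> Y u = Yf (\<psi> u $ 2)"
    "\<And>u v. u \<in> D \<Longrightarrow> form G u v v = (1 + \<psi> u $ 1 * deriv Yf (\<psi> u $ 2)) *
       (frechet_derivative \<psi> (at u) v $ 1) * (frechet_derivative \<psi> (at u) v $ 2)"
    "\<And>u v. u \<in> D \<Longrightarrow> form a u v v = (1 + \<psi> u $ 1 * deriv Yf (\<psi> u $ 2)) *
       (Y u * ((frechet_derivative \<psi> (at u) v $ 1) * (frechet_derivative \<psi> (at u) v $ 2))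
         - (1 + \<psi> u $ 1 * deriv Yf (\<psi> u $ 2)) / 2 * (frechet_derivative \<psi> (at u) v $ 2)\<^sup>2)"
proof -
  note G = metric_onD[OF S(2)]
  let ?H = "\<lambda>u. (2 * Y u) *\<^sub>R G u - 2 *\<^sub>R a u"
  have symH: "symmetric_on S ?H" by (intro symmetric_on_combination S(1,3) G(1) smooth_on_mult smooth_on_const sm)
  have detH: "det (?H u) = 0" if u: "u \<in> S" for u
    unfolding det_combination[of G u a, OF G(3)[OF u] symmetric_onD(2)[OF S(3) u]] mix[OF u] det[OF u]
    by (simp add: power2_eq_square algebra_simps)
  have posH: "0 < form ?H q w w" using pos unfolding form_combination by simp
  obtain T0 \<alpha> where T0: "open T0" "T0 \<subseteq> S" "q \<in> T0" and sm\<alpha>0: "smooth_on T0 \<alpha>"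
    and H0: "\<And>u v v'. u \<in> T0 \<Longrightarrow> form ?H u v v' = \<alpha> u \<bullet> v * (\<alpha> u \<bullet> v')"
    by (rule rank_one_root[OF S(1) symH detH q posH]) auto
  let ?T = "{u \<in> T0. 0 < (\<alpha> u \<bullet> w) * (\<alpha> u \<bullet> w)}"
  have T: "open ?T"
    by (rule open_positive[OF T0(1)]) (intro smooth_on_mult smooth_on_inner sm\<alpha>0 smooth_on_const T0(1))
  have qT: "q \<in> ?T" using posH H0[OF T0(3), of w w] T0(3) by simp
  have TT0: "?T \<subseteq> T0" by blast
  then have TS: "?T \<subseteq> S" using T0(2) by blast
  have \<alpha>w: "\<alpha> u \<bullet> w \<noteq> 0" if "u \<in> ?T" for u using that by auto
  have sm\<alpha>: "smooth_on ?T \<alpha>" by (rule smooth_on_subset[OF sm\<alpha>0 TT0])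
  have smY: "smooth_on ?T Y" by (rule smooth_on_subset[OF sm TS])
  have smG: "smooth_on ?T G" by (rule smooth_on_subset[OF G(2) TS])
  have sm\<alpha>w: "smooth_on ?T (\<lambda>u. \<alpha> u \<bullet> w)" by (intro smooth_on_inner sm\<alpha> smooth_on_const T)
  have H: "2 * Y u * form G u v v' - 2 * form a u v v' = \<alpha> u \<bullet> v * (\<alpha> u \<bullet> v')" if "u \<in> ?T" for u v v'
    using H0[of u v v'] that unfolding form_combination by auto
  \<comment> \<open>Solution of \<open>g = \<alpha> \<beta>\<close> for \<open>\<beta>\<close>: the
    value \<open>g(w, w)\<close> determines \<open>\<beta>(w)\<close>, and then
    \<open>g(v, w)\<close> determines \<open>\<beta>(v)\<close>.\<close>
  define \<beta> where "\<beta> u = (2 / (\<alpha> u \<bullet> w)) *\<^sub>R (G u *v w) - (form G u w w / (\<alpha> u \<bullet> w)\<^sup>2) *\<^sub>R \<alpha> u" for u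
  have sm\<beta>: "smooth_on ?T \<beta>"
    unfolding \<beta>_def
    by (intro smooth_on_diff smooth_on_scaleR smooth_on_divide smooth_on_power smooth_on_const sm\<alpha>w sm\<alpha>
        smooth_on_mat_vec smooth_on_form smG T) (use \<alpha>w in auto)
  have Gf: "form G u v v' = (\<alpha> u \<bullet> v * (\<beta> u \<bullet> v') + \<beta> u \<bullet> v * (\<alpha> u \<bullet> v')) / 2" if u: "u \<in> ?T" for u v v'
  proof -
    have uS: "u \<in> S" using u TS by blast
    have \<alpha>e: "\<alpha> u $ i * \<alpha> u $ j = 2 * Y u * G u $ i $ j - 2 * a u $ i $ j" for i j
      using H[OF u, of "axis i 1" "axis j 1"] by (simp add: form_axis inner_axis)
    \<comment> \<open>\<open>\<alpha>\<close> is null for the inverse metric, by the trace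
      condition. This makes \<open>g\<close> divisible by \<open>\<alpha>\<close>.\<close>
    have null: "G u $ 1 $ 1 * (\<alpha> u $ 2 * \<alpha> u $ 2) - 2 * G u $ 1 $ 2 * (\<alpha> u $ 1 * \<alpha> u $ 2) + G u $ 2 $ 2 * (\<alpha> u $ 1 * \<alpha> u $ 1) = 0"
    proof -
      have "G u $ 1 $ 1 * (\<alpha> u $ 2 * \<alpha> u $ 2) - 2 * G u $ 1 $ 2 * (\<alpha> u $ 1 * \<alpha> u $ 2) + G u $ 2 $ 2 * (\<alpha> u $ 1 * \<alpha> u $ 1)
         = 2 * (2 * Y u * det (G u) - mixed_det G a u)"
        unfolding \<alpha>e by (simp add: det_2 mixed_det_def G(3)[OF uS] algebra_simps)
      then show ?thesis using mix[OF uS] by simp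
    qed
    have id: "form G u v v' * (\<alpha> u \<bullet> w * (\<alpha> u \<bullet> w)) = \<alpha> u \<bullet> v * (\<alpha> u \<bullet> w) * form G u v' w
       + \<alpha> u \<bullet> v' * (\<alpha> u \<bullet> w) * form G u v w - form G u w w * (\<alpha> u \<bullet> v) * (\<alpha> u \<bullet> v')"
      unfolding form_expand inner_vec2 G(3)[OF uS] using null by algebra
    have \<beta>: "\<beta> u \<bullet> v = 2 * form G u v w / (\<alpha> u \<bullet> w) - form G u w w * (\<alpha> u \<bullet> v) / ((\<alpha> u \<bullet> w) * (\<alpha> u \<bullet> w))" for v
      by (simp add: \<beta>_def inner_diff_left form_def inner_commute[of "G u *v w" v] power2_eq_square)
    have \<beta>L: "(\<beta> u \<bullet> v) * ((\<alpha> u \<bullet> w) * (\<alpha> u \<bullet> w)) = 2 * form G u v w * (\<alpha> u \<bullet> w) - form G u w w * (\<alpha> u \<bullet> v)" for v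
      unfolding \<beta> using \<alpha>w[OF u] by (simp add: field_simps)
    have "((\<alpha> u \<bullet> v * (\<beta> u \<bullet> v') + \<beta> u \<bullet> v * (\<alpha> u \<bullet> v')) / 2) * ((\<alpha> u \<bullet> w) * (\<alpha> u \<bullet> w))
       = (\<alpha> u \<bullet> v * ((\<beta> u \<bullet> v') * ((\<alpha> u \<bullet> w) * (\<alpha> u \<bullet> w))) + ((\<beta> u \<bullet> v) * ((\<alpha> u \<bullet> w) * (\<alpha> u \<bullet> w))) * (\<alpha> u \<bullet> v')) / 2"
      by (simp add: algebra_simps)
    also have "\<dots> = form G u v v' * ((\<alpha> u \<bullet> w) * (\<alpha> u \<bullet> w))"
      unfolding \<beta>L id by (simp add: field_simps)
    finally show ?thesis using \<alpha>w[OF u] by simp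
  qed
  have af: "form a u v v' = Y u * ((\<alpha> u \<bullet> v * (\<beta> u \<bullet> v') + \<beta> u \<bullet> v * (\<alpha> u \<bullet> v')) / 2)
       - \<alpha> u \<bullet> v * (\<alpha> u \<bullet> v') / 2" if u: "u \<in> ?T" for u v v'
    using H[OF u, of v v'] unfolding Gf[OF u, symmetric] by simp
  have indep: "\<beta> u $ 1 * \<alpha> u $ 2 - \<beta> u $ 2 * \<alpha> u $ 1 \<noteq> 0" if u: "u \<in> ?T" for u
  proof
    assume 0: "\<beta> u $ 1 * \<alpha> u $ 2 - \<beta> u $ 2 * \<alpha> u $ 1 = 0"
    have e: "2 * G u $ i $ j = \<alpha> u $ i * \<beta> u $ j + \<beta> u $ i * \<alpha> u $ j" for i j
      using Gf[OF u, of "axis i 1" "axis j 1"] by (simp add: form_axis inner_axis)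
    have "4 * (G u $ 1 $ 1 * G u $ 2 $ 2 - (G u $ 1 $ 2)\<^sup>2) = (2 * G u $ 1 $ 1) * (2 * G u $ 2 $ 2) - (2 * G u $ 1 $ 2)\<^sup>2"
      by (simp add: power2_eq_square)
    also have "\<dots> = - (\<beta> u $ 1 * \<alpha> u $ 2 - \<beta> u $ 2 * \<alpha> u $ 1)\<^sup>2"
      unfolding e by algebra
    finally show False using G(5)[of u] TS u 0 by auto
  qed
  note S' = T metric_on_subset[OF S(2) TS] symmetric_on_subset[OF S(3) TS] killing_on_subset[OF S(4) TS]
  note jc = jordan_closed[where \<alpha>=\<alpha> and \<beta>=\<beta> and Y=Y, OF S' smY sm\<beta> sm\<alpha> indep Gf af]
  have cl: "closed_form_on ?T \<beta>"
    "\<forall>u\<in>?T. \<exists>m. \<forall>k. frechet_derivative Y (at u) k = m * (\<alpha> u \<bullet> k)"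
    "\<forall>u\<in>?T. \<forall>v w. frechet_derivative \<alpha> (at u) v \<bullet> w - frechet_derivative \<alpha> (at u) w \<bullet> v =
       \<beta> u \<bullet> v * frechet_derivative Y (at u) w - \<beta> u \<bullet> w * frechet_derivative Y (at u) v"
    by (rule jc; assumption)+
  let ?DY = "\<lambda>u. frechet_derivative Y (at u)" and ?D\<alpha> = "\<lambda>u. frechet_derivative \<alpha> (at u)"
  define \<mu> where "\<mu> u = ?DY u w / (\<alpha> u \<bullet> w)" for u
  have DY: "?DY u k = \<mu> u * (\<alpha> u \<bullet> k)" if u: "u \<in> ?T" for u k
  proof -
    obtain m where m: "\<forall>k. ?DY u k = m * (\<alpha> u \<bullet> k)" using bspec[OF cl(2) u] by (rule exE)
    show ?thesis using m[rule_format, of k] m[rule_format, of w] \<alpha>w[OF u] by (simp add: \<mu>_def)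
  qed
  obtain r x where r: "0 < r" "ball q r \<subseteq> ?T" and x: "smooth_on (ball q r) x" "x q = 0"
    and dx: "\<And>u v. u \<in> ball q r \<Longrightarrow> frechet_derivative x (at u) v = \<beta> u \<bullet> v"
    by (rule closed_form_exact[OF T qT sm\<beta> cl(1)]) (rule that)
  let ?B = "ball q r"
  have qB: "q \<in> ?B" using r(1) by simp
  \<comment> \<open>\<open>\<alpha> - x dY\<close>, with \<open>dY\<close> written as a vector. The
    exterior derivative of \<open>x dY\<close> is the wedge product of \<open>\<beta>\<close> and
    \<open>dY\<close>, which is that of \<open>\<alpha>\<close>.\<close>
  define \<gamma> where "\<gamma> u = \<alpha> u - x u *\<^sub>R vector [?DY u (axis 1 1), ?DY u (axis 2 1)]" for u
  have smYB: "smooth_on ?B Y" and sm\<alpha>B: "smooth_on ?B \<alpha>" using smY sm\<alpha> r(2) smooth_on_subset by blast+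
  have sm\<gamma>: "smooth_on ?B \<gamma>"
    unfolding \<gamma>_def
    by (intro smooth_on_diff smooth_on_scaleR smooth_on_vector2 smooth_on_frechet_derivative x sm\<alpha>B smYB open_ball)
  have \<gamma>v: "\<gamma> u \<bullet> v = \<alpha> u \<bullet> v - x u * ?DY u v" if u: "u \<in> ?B" for u v
    using frechet_derivative_partial[OF smooth_on_differentiable[OF smYB u], of v]
    by (simp add: \<gamma>_def inner_diff_left inner_vec2 partial_deriv_def algebra_simps)
  have closed\<gamma>: "closed_form_on ?B \<gamma>"
    unfolding closed_form_on_def
  proof (intro ballI allI)
    fix u v k assume u: "u \<in> ?B"
    let ?D2 = "\<lambda>k v. frechet_derivative (\<lambda>u. ?DY u v) (at u) k"
    have d: "frechet_derivative \<gamma> (at u) k \<bullet> v = ?D\<alpha> u k \<bullet> v - (x u * ?D2 k v + (\<beta> u \<bullet> k) * ?DY u v)" for k v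
    proof -
      have 1: "((\<lambda>u. \<gamma> u \<bullet> v) has_derivative (\<lambda>k. frechet_derivative \<gamma> (at u) k \<bullet> v)) (at u)"
        by (rule has_derivative_inner_left[OF smooth_on_has_derivative[OF sm\<gamma> u]])
      have dx': "(x has_derivative (\<lambda>k. \<beta> u \<bullet> k)) (at u)"
        by (rule has_derivative_eq_rhs[OF smooth_on_has_derivative[OF x(1) u]]) (use dx[OF u] in auto)
      have dD: "((\<lambda>u. ?DY u v) has_derivative (\<lambda>k. ?D2 k v)) (at u)"
        by (rule smooth_on_has_derivative[OF smooth_on_frechet_derivative[OF smYB] u])
      have "((\<lambda>u. \<alpha> u \<bullet> v - x u * ?DY u v) has_derivative (\<lambda>k. ?D\<alpha> u k \<bullet> v - (x u * ?D2 k v + (\<beta> u \<bullet> k) * ?DY u v))) (at u)"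
        by (rule has_derivative_diff[OF has_derivative_inner_left[OF smooth_on_has_derivative[OF sm\<alpha>B u]] has_derivative_mult[OF dx' dD]])
      then have "((\<lambda>u. \<gamma> u \<bullet> v) has_derivative (\<lambda>k. ?D\<alpha> u k \<bullet> v - (x u * ?D2 k v + (\<beta> u \<bullet> k) * ?DY u v))) (at u)"
        by (rule has_derivative_transform_within_open[OF _ open_ball u]) (simp add: \<gamma>v)
      from fun_cong[OF has_derivative_unique[OF 1 this]] show ?thesis .
    qed
    have sym2: "?D2 k v = ?D2 v k" by (rule second_derivative_symmetric[OF open_ball smYB u])
    have "?D\<alpha> u k \<bullet> v - ?D\<alpha> u v \<bullet> k = \<beta> u \<bullet> k * ?DY u v - \<beta> u \<bullet> v * ?DY u k"
      using cl(3) u r(2) by blast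
    then show "frechet_derivative \<gamma> (at u) v \<bullet> k = frechet_derivative \<gamma> (at u) k \<bullet> v"
      unfolding d using sym2 by simp
  qed
  obtain r' y where r': "0 < r'" "ball q r' \<subseteq> ?B" and y: "smooth_on (ball q r') y"
    and dy: "\<And>u v. u \<in> ball q r' \<Longrightarrow> frechet_derivative y (at u) v = \<gamma> u \<bullet> v"
    by (rule closed_form_exact[OF open_ball qB sm\<gamma> closed\<gamma>]) (rule that)
  let ?B' = "ball q r'"
  \<comment> \<open>Since \<open>dY = \<mu> \<alpha>\<close>, one has
    \<open>\<gamma> = f \<alpha>\<close>. The normalization \<open>x q = 0\<close> gives
    \<open>f q = 1\<close>, so \<open>f\<close> is positive near \<open>q\<close> and
    \<open>\<gamma>\<close> can replace \<open>\<alpha>\<close> in the coframe. Then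
    \<open>dY = (\<mu> / f) dy\<close>, and \<open>1 + x Y' = 1 / f\<close>.\<close>
  define f where "f u = 1 - x u * \<mu> u" for u
  have smf: "smooth_on ?B' f"
    unfolding f_def \<mu>_def using r(2) r'(2) \<alpha>w
    by (intro smooth_on_diff smooth_on_mult smooth_on_divide smooth_on_const smooth_on_frechet_derivative open_ball
        smooth_on_subset[OF x(1) r'(2)] smooth_on_subset[OF smYB r'(2)] smooth_on_inner smooth_on_subset[OF sm\<alpha>B r'(2)]) blast
  let ?U = "{u \<in> ?B'. 0 < f u}"
  have U: "open ?U" by (rule open_positive[OF open_ball smf])
  have qU: "q \<in> ?U" using r'(1) x(2) by (simp add: f_def)
  have UB': "?U \<subseteq> ?B'" and UB: "?U \<subseteq> ?B" and UT: "?U \<subseteq> ?T" using r'(2) r(2) by blast+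
  have \<gamma>f: "\<gamma> u \<bullet> v = f u * (\<alpha> u \<bullet> v)" if u: "u \<in> ?U" for u v
    using \<gamma>v[of u v] DY[of u v] UB UT u by (simp add: f_def algebra_simps subset_iff)
  have \<gamma>q: "\<gamma> q $ i = \<alpha> q $ i" for i
    using \<gamma>f[OF qU, of "axis i 1"] x(2) by (simp add: inner_axis f_def)
  have indq: "\<beta> q $ 1 * \<gamma> q $ 2 - \<beta> q $ 2 * \<gamma> q $ 1 \<noteq> 0" using indep[OF qT] by (simp add: \<gamma>q)
  obtain D \<psi> \<eta> lo hi where D: "D \<subseteq> ?U" "q \<in> D" and bd: "box_diffeo D \<psi> \<eta> lo hi"
    and \<psi>: "\<And>u. \<psi> u $ 1 = x u" "\<And>u. \<psi> u $ 2 = y u"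
    and d\<psi>: "\<And>u v. u \<in> D \<Longrightarrow> frechet_derivative \<psi> (at u) v = vector [\<beta> u \<bullet> v, \<gamma> u \<bullet> v]"
  proof (rule coordinates_from_functions[where \<theta>=\<beta> and \<omega>=\<gamma>, OF U qU smooth_on_subset[OF x(1) UB] smooth_on_subset[OF y UB'] _ _ indq])
    show "frechet_derivative x (at u) v = \<beta> u \<bullet> v" if "u \<in> ?U" for u v using dx UB that by blast
    show "frechet_derivative y (at u) v = \<gamma> u \<bullet> v" if "u \<in> ?U" for u v using dy UB' that by blast
  qed (rule that)
  have ne: "D \<noteq> {}" using D(2) by blast
  have f0: "f u \<noteq> 0" if "u \<in> D" for u using D(1) that by auto
  have DU: "u \<in> ?U" "u \<in> ?T" if "u \<in> D" for u using D(1) UT that by blast+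
  obtain Yf :: "real \<Rightarrow> real" where Yf: "smooth_on ((\<lambda>u. u $ 2) ` box lo hi) Yf" "\<And>u. u \<in> D \<Longrightarrow> Y u = Yf (\<psi> u $ 2)"
    and dYf: "\<And>u. u \<in> D \<Longrightarrow> deriv Yf (\<psi> u $ 2) = \<mu> u / f u"
  proof (rule function_of_coordinate[OF bd smooth_on_subset[OF smY] ne, of "\<lambda>u. \<mu> u / f u" 2])
    show "D \<subseteq> ?T" using D(1) UT by blast
    show "?DY u k = \<mu> u / f u * frechet_derivative \<psi> (at u) k $ 2" if "u \<in> D" for u k
      using f0[OF that] by (simp add: d\<psi>[OF that] DY[OF DU(2)[OF that]] \<gamma>f[OF DU(1)[OF that]])
  qed (rule that)
  have W: "1 + \<psi> u $ 1 * deriv Yf (\<psi> u $ 2) = 1 / f u" if u: "u \<in> D" for u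
  proof -
    have "1 + x u * (\<mu> u / f u) = (f u + x u * \<mu> u) / f u" using f0[OF u] by (simp add: field_simps)
    then show ?thesis unfolding dYf[OF u] unfolding \<psi> by (simp add: f_def)
  qed
  show ?thesis
  proof (rule that[OF _ D(2) bd Yf])
    show "D \<subseteq> S" using DU(2) TS by blast
    fix u v assume u: "u \<in> D"
    note uT = DU(2)[OF u]
    have \<alpha>v: "\<alpha> u \<bullet> v = (1 / f u) * (\<gamma> u \<bullet> v)" using \<gamma>f[OF DU(1)[OF u], of v] f0[OF u] by simp
    show "form G u v v = (1 + \<psi> u $ 1 * deriv Yf (\<psi> u $ 2)) *
       (frechet_derivative \<psi> (at u) v $ 1) * (frechet_derivative \<psi> (at u) v $ 2)"
      unfolding W[OF u] Gf[OF uT] \<alpha>v d\<psi>[OF u] by simp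
    show "form a u v v = (1 + \<psi> u $ 1 * deriv Yf (\<psi> u $ 2)) *
       (Y u * ((frechet_derivative \<psi> (at u) v $ 1) * (frechet_derivative \<psi> (at u) v $ 2))
         - (1 + \<psi> u $ 1 * deriv Yf (\<psi> u $ 2)) / 2 * (frechet_derivative \<psi> (at u) v $ 2)\<^sup>2)"
      unfolding W[OF u] af[OF uT] \<alpha>v d\<psi>[OF u] by (simp add: power2_eq_square algebra_simps)
  qed
qed

section \<open>Unique continuation of Killing tensors\<close>

text \<open>The module of combinations of \<open>Z\<close> with smooth coefficients, up to values
  outside \<open>S\<close>. Membership records that a derivative is controlled by the unknowns
  without writing out the coefficients.\<close>

inductive smooth_module :: "(real^2) set \<Rightarrow> (real^2 \<Rightarrow> real) set \<Rightarrow> (real^2 \<Rightarrow> real) \<Rightarrow> bool" for S Z where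
  smooth_module_gen: "f \<in> Z \<Longrightarrow> smooth_module S Z f"
| smooth_module_zero: "smooth_module S Z (\<lambda>u. 0)"
| smooth_module_add: "smooth_module S Z f \<Longrightarrow> smooth_module S Z g \<Longrightarrow> smooth_module S Z (\<lambda>u. f u + g u)"
| smooth_module_mult: "smooth_on S c \<Longrightarrow> smooth_module S Z f \<Longrightarrow> smooth_module S Z (\<lambda>u. c u * f u)"
| smooth_module_cong: "smooth_module S Z f \<Longrightarrow> (\<And>u. u \<in> S \<Longrightarrow> f u = g u) \<Longrightarrow> smooth_module S Z g"

lemma smooth_module_scale: "smooth_module S Z f \<Longrightarrow> smooth_module S Z (\<lambda>u. k * f u)"
  by (rule smooth_module_mult) simp_all

lemma smooth_module_diff: "smooth_module S Z f \<Longrightarrow> smooth_module S Z g \<Longrightarrow> smooth_module S Z (\<lambda>u. f u - g u)"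
  using smooth_module_add[OF _ smooth_module_scale[of S Z g "-1"], of f] by simp

lemma smooth_module_smooth:
  assumes "open S" "\<And>z. z \<in> Z \<Longrightarrow> smooth_on S z" "smooth_module S Z f"
  shows "smooth_on S f"
  using assms(3)
proof (induction rule: smooth_module.induct)
  case (smooth_module_cong f g)
  then show ?case using smooth_on_cong[OF _ assms(1)] by blast
qed (auto intro: smooth_on_add smooth_on_mult assms)

lemma smooth_module_mono:
  assumes "smooth_module S Z f" "\<And>z. z \<in> Z \<Longrightarrow> smooth_module S Z' z"
  shows "smooth_module S Z' f"
  using assms(1)
proof (induction rule: smooth_module.induct)
  case (smooth_module_cong f g)
  then show ?case by (intro smooth_module.smooth_module_cong[of S Z' f g])
qed (auto intro: smooth_module_zero smooth_module_add smooth_module_mult assms(2))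

section \<open>Derivatives and bounds of module elements\<close>

lemma partial_deriv_cong:
  assumes "open S" "u \<in> S" "f differentiable (at u)" "\<And>u. u \<in> S \<Longrightarrow> f u = g u"
  shows "partial_deriv i f u = partial_deriv i g u"
  unfolding partial_deriv_def
  by (subst frechet_derivative_transform_within_open[OF assms(3,1,2), of g]) (use assms(4) in auto)

lemma partial_deriv_add:
  assumes "f differentiable (at u)" "g differentiable (at u)"
  shows "partial_deriv i (\<lambda>u. f u + g u) u = partial_deriv i f u + partial_deriv i g u"
proof -
  note d = assms[unfolded frechet_derivative_works]
  show ?thesis unfolding partial_deriv_def frechet_derivative_at[OF has_derivative_add[OF d], symmetric] ..
qed

lemma partial_deriv_mult:
  assumes "f differentiable (at u)" "g differentiable (at u)"
  shows "partial_deriv i (\<lambda>u. f u * g u) u = f u * partial_deriv i g u + partial_deriv i f u * g u"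
proof -
  note d = assms[unfolded frechet_derivative_works]
  show ?thesis unfolding partial_deriv_def frechet_derivative_at[OF has_derivative_mult[OF d], symmetric] ..
qed

lemma partial_deriv_commute:
  fixes f :: "real^2 \<Rightarrow> real"
  assumes "open S" "smooth_on S f" "u \<in> S"
  shows "partial_deriv i (partial_deriv j f) u = partial_deriv j (partial_deriv i f) u"
  unfolding partial_deriv_def by (rule second_derivative_symmetric_real[OF assms])

text \<open>By the Leibniz rule the derivative of a combination involves the generators and their
  derivatives, so the module of \<open>Z'\<close> has to contain both.\<close>

lemma smooth_module_partial_deriv:
  assumes S: "open S" and sm: "\<And>z. z \<in> Z \<Longrightarrow> smooth_on S z"
    and Z: "\<And>z. z \<in> Z \<Longrightarrow> smooth_module S Z' z" "\<And>z. z \<in> Z \<Longrightarrow> smooth_module S Z' (partial_deriv i z)"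
    and f: "smooth_module S Z f"
  shows "smooth_module S Z' (partial_deriv i f)"
  using f
proof (induction rule: smooth_module.induct)
  case (smooth_module_gen f)
  then show ?case by (rule Z(2))
next
  case smooth_module_zero
  have "partial_deriv i (\<lambda>u::real^2. 0::real) = (\<lambda>u. 0)" by (simp add: partial_deriv_def fun_eq_iff)
  then show ?case using smooth_module.smooth_module_zero[of S Z'] by metis
next
  case (smooth_module_add f g)
  have d: "f differentiable (at u)" "g differentiable (at u)" if "u \<in> S" for u
    using smooth_module_smooth[OF S sm] smooth_module_add.hyps smooth_on_differentiable that by blast+
  show ?case
    by (rule smooth_module_cong[OF smooth_module.smooth_module_add[OF smooth_module_add.IH]]) (simp add: partial_deriv_add d)
next
  case (smooth_module_mult c f)
  have d: "c differentiable (at u)" "f differentiable (at u)" if "u \<in> S" for u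
    using smooth_module_smooth[OF S sm] smooth_module_mult.hyps smooth_on_differentiable that by blast+
  have "smooth_module S Z' f" by (rule smooth_module_mono[OF smooth_module_mult.hyps(2) Z(1)])
  then have "smooth_module S Z' (\<lambda>u. c u * partial_deriv i f u + partial_deriv i c u * f u)"
    by (intro smooth_module.smooth_module_add smooth_module.smooth_module_mult smooth_module_mult.hyps smooth_module_mult.IH smooth_on_partial_deriv)
  then show ?case by (rule smooth_module_cong) (simp add: partial_deriv_mult d)
next
  case (smooth_module_cong f g)
  have d: "f differentiable (at u)" if "u \<in> S" for u
    using smooth_module_smooth[OF S sm] smooth_module_cong.hyps(1) smooth_on_differentiable that by blast
  show ?case
    by (rule smooth_module.smooth_module_cong[OF smooth_module_cong.IH]) (rule partial_deriv_cong[OF S _ d smooth_module_cong.hyps(2)])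
qed

text \<open>Smooth coefficients are bounded on compact sets; this converts a linear system into a
  differential inequality.\<close>

lemma smooth_module_bound:
  assumes "finite Z" "compact K" "K \<subseteq> S" "smooth_module S Z f"
  shows "\<exists>C\<ge>0. \<forall>u\<in>K. \<bar>f u\<bar> \<le> C * (\<Sum>z\<in>Z. \<bar>z u\<bar>)"
  using assms(4)
proof (induction rule: smooth_module.induct)
  case (smooth_module_gen f)
  have "\<bar>f u\<bar> \<le> 1 * (\<Sum>z\<in>Z. \<bar>z u\<bar>)" for u
    using member_le_sum[of f Z "\<lambda>z. \<bar>z u\<bar>"] smooth_module_gen assms(1) by simp
  then show ?case by (intro exI[of _ 1]) simp
next
  case smooth_module_zero
  then show ?case by (intro exI[of _ 0]) simp
next
  case (smooth_module_add f g)
  then obtain C D where C: "C \<ge> 0" "\<forall>u\<in>K. \<bar>f u\<bar> \<le> C * (\<Sum>z\<in>Z. \<bar>z u\<bar>)"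
    and D: "D \<ge> 0" "\<forall>u\<in>K. \<bar>g u\<bar> \<le> D * (\<Sum>z\<in>Z. \<bar>z u\<bar>)" by auto
  have "\<bar>f u + g u\<bar> \<le> (C + D) * (\<Sum>z\<in>Z. \<bar>z u\<bar>)" if "u \<in> K" for u
    using C(2) D(2) that abs_triangle_ineq[of "f u" "g u"] by (fastforce simp: distrib_right)
  then show ?case using C(1) D(1) by (intro exI[of _ "C + D"]) simp
next
  case (smooth_module_mult c f)
  then obtain C where C: "C \<ge> 0" "\<forall>u\<in>K. \<bar>f u\<bar> \<le> C * (\<Sum>z\<in>Z. \<bar>z u\<bar>)" by auto
  have "continuous_on K c" using smooth_on_imp_continuous_on[OF smooth_module_mult.hyps(1)] assms(3) continuous_on_subset by blast
  then have "bounded (c ` K)" using assms(2) compact_continuous_image compact_imp_bounded by blast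
  then obtain B where B: "0 < B" "\<And>u. u \<in> K \<Longrightarrow> \<bar>c u\<bar> \<le> B" unfolding bounded_pos by auto
  have "\<bar>c u * f u\<bar> \<le> (B * C) * (\<Sum>z\<in>Z. \<bar>z u\<bar>)" if "u \<in> K" for u
  proof -
    have "\<bar>c u * f u\<bar> \<le> B * (C * (\<Sum>z\<in>Z. \<bar>z u\<bar>))"
      unfolding abs_mult using B C that by (intro mult_mono) auto
    then show ?thesis by simp
  qed
  then show ?case using B C by (intro exI[of _ "B * C"]) simp
next
  case (smooth_module_cong f g)
  then show ?case using assms(3) by (metis subsetD)
qed

text \<open>\<open>E t * exp (- K * t)\<close> is nonincreasing.\<close>

lemma gronwall_zero:
  fixes E E' :: "real \<Rightarrow> real"
  assumes der: "\<And>t. t \<in> {0..1} \<Longrightarrow> (E has_real_derivative E' t) (at t)"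
    and le: "\<And>t. t \<in> {0..1} \<Longrightarrow> E' t \<le> K * E t" and E: "E 0 = 0"
  shows "E 1 \<le> 0"
proof -
  let ?F = "\<lambda>t. E t * exp (- K * t)"
  have "?F 1 \<le> ?F 0"
  proof (rule DERIV_nonpos_imp_nonincreasing[of 0 1 ?F])
    fix t :: real assume "0 \<le> t" "t \<le> 1"
    then have t: "t \<in> {0..1}" by simp
    have "((\<lambda>t. exp (- K * t)) has_real_derivative (exp (- K * t) * (- K))) (at t)"
      by (auto intro!: derivative_eq_intros)
    from DERIV_mult[OF der[OF t] this]
    have "(?F has_real_derivative (E' t - K * E t) * exp (- K * t)) (at t)" by (simp add: algebra_simps)
    moreover have "(E' t - K * E t) * exp (- K * t) \<le> 0"
      using le[OF t] by (intro mult_nonpos_nonneg) auto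
    ultimately show "\<exists>y. (?F has_real_derivative y) (at t) \<and> y \<le> 0" by blast
  qed simp
  then have "E 1 * exp (- K) \<le> 0" using E by simp
  then show ?thesis by (simp add: mult_le_0_iff)
qed

text \<open>A closed linear system of first order: the energy \<open>\<Sum>z\<^sup>2\<close> satisfies Gronwall's inequality
  along segments.\<close>

lemma closed_system_zero:
  assumes S: "open S" "convex S" and Z: "finite Z" "\<And>z. z \<in> Z \<Longrightarrow> smooth_on S z"
    and closed: "\<And>z i. z \<in> Z \<Longrightarrow> smooth_module S Z (partial_deriv i z)"
    and p: "p \<in> S" "\<And>z. z \<in> Z \<Longrightarrow> z p = 0" and x: "x \<in> S"
  shows "\<forall>z\<in>Z. z x = 0"
proof -
  define d where "d = x - p"
  define \<gamma> where "\<gamma> t = p + t *\<^sub>R d" for t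
  let ?K = "\<gamma> ` {0..1}"
  have \<gamma>S: "\<gamma> t \<in> S" if "t \<in> {0..1}" for t
  proof -
    have "\<gamma> t = (1 - t) *\<^sub>R p + t *\<^sub>R x" by (simp add: \<gamma>_def d_def algebra_simps)
    then show ?thesis using convexD[OF S(2) p(1) x, of "1 - t" t] that by simp
  qed
  have KS: "?K \<subseteq> S" using \<gamma>S by blast
  have K: "compact ?K"
    by (intro compact_continuous_image compact_Icc) (auto simp: \<gamma>_def intro!: continuous_intros)
  have "smooth_module S Z (\<lambda>u. d $ 1 * partial_deriv 1 z u + d $ 2 * partial_deriv 2 z u)" if "z \<in> Z" for z
    by (intro smooth_module_add smooth_module_scale closed that)
  then have "\<forall>z\<in>Z. \<exists>C\<ge>0. \<forall>u\<in>?K. \<bar>d $ 1 * partial_deriv 1 z u + d $ 2 * partial_deriv 2 z u\<bar> \<le> C * (\<Sum>z\<in>Z. \<bar>z u\<bar>)"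
    using smooth_module_bound[OF Z(1) K KS] by blast
  from bchoice[OF this] obtain C where C: "\<And>z. z \<in> Z \<Longrightarrow> C z \<ge> 0"
    "\<And>z u. z \<in> Z \<Longrightarrow> u \<in> ?K \<Longrightarrow> \<bar>d $ 1 * partial_deriv 1 z u + d $ 2 * partial_deriv 2 z u\<bar> \<le> C z * (\<Sum>z\<in>Z. \<bar>z u\<bar>)"
    by blast
  define L where "L = (\<Sum>z\<in>Z. C z)"
  have CL: "C z \<le> L" if "z \<in> Z" for z unfolding L_def using member_le_sum[of z Z C] that C(1) Z(1) by simp
  define D where "D z t = d $ 1 * partial_deriv 1 z (\<gamma> t) + d $ 2 * partial_deriv 2 z (\<gamma> t)" for z t
  have D: "\<bar>D z t\<bar> \<le> L * (\<Sum>z\<in>Z. \<bar>z (\<gamma> t)\<bar>)" if "z \<in> Z" "t \<in> {0..1}" for z t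
  proof -
    have "\<bar>D z t\<bar> \<le> C z * (\<Sum>z\<in>Z. \<bar>z (\<gamma> t)\<bar>)" unfolding D_def using C(2)[OF that(1)] that(2) by blast
    also have "\<dots> \<le> L * (\<Sum>z\<in>Z. \<bar>z (\<gamma> t)\<bar>)" using CL[OF that(1)] by (intro mult_right_mono sum_nonneg) auto
    finally show ?thesis .
  qed
  define E where "E t = (\<Sum>z\<in>Z. (z (\<gamma> t))\<^sup>2)" for t
  have dz: "((\<lambda>t. z (\<gamma> t)) has_real_derivative D z t) (at t)" if z: "z \<in> Z" and t: "t \<in> {0..1}" for z t
  proof -
    have "((\<lambda>t. \<gamma> t) has_derivative (\<lambda>h. h *\<^sub>R d)) (at t)"
      unfolding \<gamma>_def by (auto intro!: derivative_eq_intros)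
    from has_derivative_compose[OF this smooth_on_has_derivative[OF Z(2)[OF z] \<gamma>S[OF t]]]
    have "((\<lambda>t. z (\<gamma> t)) has_derivative (\<lambda>h. h * D z t)) (at t)"
      unfolding frechet_derivative_partial[OF smooth_on_differentiable[OF Z(2)[OF z] \<gamma>S[OF t]]] D_def
      by (simp add: algebra_simps)
    then show ?thesis by (simp add: has_field_derivative_def mult.commute[of _ "D z t"])
  qed
  have "E 1 \<le> 0"
  \<comment> \<open>Each derivative is at most \<open>L\<close> times the sum of the absolute
    values; by Cauchy-Schwarz the square of this sum is at most \<open>card Z\<close> times the
    energy.\<close>
  proof (rule gronwall_zero[of E "\<lambda>t. \<Sum>z\<in>Z. 2 * z (\<gamma> t) * D z t" "2 * L * card Z"])
    show "E 0 = 0" unfolding E_def \<gamma>_def by (intro sum.neutral ballI) (simp add: p(2))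
    fix t :: real assume t: "t \<in> {0..1}"
    have "((\<lambda>t. (z (\<gamma> t))\<^sup>2) has_real_derivative 2 * z (\<gamma> t) * D z t) (at t)" if "z \<in> Z" for z
      using DERIV_power[OF dz[OF that t], of 2] by (simp add: mult_ac)
    then show "(E has_real_derivative (\<Sum>z\<in>Z. 2 * z (\<gamma> t) * D z t)) (at t)"
      unfolding E_def by (intro DERIV_sum)
    let ?s = "\<Sum>z\<in>Z. \<bar>z (\<gamma> t)\<bar>"
    have "(\<Sum>z\<in>Z. 2 * z (\<gamma> t) * D z t) \<le> (\<Sum>z\<in>Z. 2 * \<bar>z (\<gamma> t)\<bar> * (L * ?s))"
    proof (rule sum_mono)
      fix z assume z: "z \<in> Z"
      have "2 * z (\<gamma> t) * D z t \<le> \<bar>2 * z (\<gamma> t)\<bar> * \<bar>D z t\<bar>" by (metis abs_ge_self abs_mult)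
      also have "\<dots> \<le> \<bar>2 * z (\<gamma> t)\<bar> * (L * ?s)" using D[OF z t] by (intro mult_left_mono) auto
      finally show "2 * z (\<gamma> t) * D z t \<le> 2 * \<bar>z (\<gamma> t)\<bar> * (L * ?s)" by (simp add: abs_mult)
    qed
    also have "\<dots> = 2 * L * ?s\<^sup>2"
      by (simp add: power2_eq_square sum_distrib_left[symmetric] sum_distrib_right[symmetric] mult_ac)
    also have "\<dots> \<le> 2 * L * (E t * card Z)"
    proof (rule mult_left_mono)
      show "?s\<^sup>2 \<le> E t * card Z"
        unfolding E_def using sum_squared_le_sum_of_squares[of "\<lambda>z. \<bar>z (\<gamma> t)\<bar>" Z] by simp
      show "0 \<le> 2 * L" unfolding L_def using C(1) by (simp add: sum_nonneg)
    qed
    finally show "(\<Sum>z\<in>Z. 2 * z (\<gamma> t) * D z t) \<le> 2 * L * card Z * E t" by (simp add: mult_ac)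
  qed
  moreover have "E 1 = (\<Sum>z\<in>Z. (z x)\<^sup>2)" by (simp add: E_def \<gamma>_def d_def)
  ultimately have "(\<Sum>z\<in>Z. (z x)\<^sup>2) = 0" by (simp add: sum_nonneg order_antisym)
  then show ?thesis using Z(1) by (simp add: sum_nonneg_eq_0_iff)
qed

text \<open>Prolongation: with \<open>s = \<partial>\<^sub>1 b\<^sub>1\<^sub>2\<close>, \<open>t = \<partial>\<^sub>2 b\<^sub>1\<^sub>2\<close> and \<open>r = \<partial>\<^sub>2 s\<close> the Killing equation becomes a closed
  system of first order for \<open>b\<^sub>1\<^sub>1, b\<^sub>1\<^sub>2, b\<^sub>2\<^sub>2, s, t, r\<close>.\<close>

lemma killing_unique_continuation:
  assumes S: "open S" "convex S" "metric_on S G" "symmetric_on S b" "killing_on S G b"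
    and N: "open N" "N \<subseteq> S" "N \<noteq> {}" "\<And>u. u \<in> N \<Longrightarrow> b u = 0" and x: "x \<in> S"
  shows "b x = 0"
proof -
  define u where "u y = b y $ 1 $ 1" for y
  define v where "v y = b y $ 1 $ 2" for y
  define w where "w y = b y $ 2 $ 2" for y
  let ?s = "partial_deriv 1 v" and ?t = "partial_deriv 2 v"
  let ?r = "partial_deriv 2 ?s"
  let ?Z0 = "{u, v, w}" and ?Z1 = "{u, v, w, ?s, ?t}" and ?Z2 = "{u, v, w, ?s, ?t, ?r}"
  note smb = symmetric_onD(1)[OF S(4)]
  have sm: "smooth_on S u" "smooth_on S v" "smooth_on S w"
    unfolding u_def v_def w_def by (intro smooth_on_entry S(1) smb)+
  have sm2: "\<And>z. z \<in> ?Z2 \<Longrightarrow> smooth_on S z" using sm smooth_on_partial_deriv by blast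
  have sm1: "\<And>z. z \<in> ?Z1 \<Longrightarrow> smooth_on S z" and sm0: "\<And>z. z \<in> ?Z0 \<Longrightarrow> smooth_on S z" using sm2 by blast+
  let ?\<Gamma> = "\<lambda>k i j y. christoffel G y k i j"
  have sm\<Gamma>: "smooth_on S (?\<Gamma> k i j)" for k i j by (rule smooth_on_christoffel[OF S(1,3)])
  \<comment> \<open>The coefficients of the Killing equation: four relations among the six first
    derivatives of the components, which leave \<open>s\<close> and \<open>t\<close>
    undetermined.\<close>
  have K: "partial_deriv 1 u y = 2 * (?\<Gamma> 1 1 1 y * u y + ?\<Gamma> 2 1 1 y * v y)"
    "partial_deriv 2 w y = 2 * (?\<Gamma> 1 2 2 y * v y + ?\<Gamma> 2 2 2 y * w y)"
    "2 * ?s y + partial_deriv 2 u y = 2 * (2 * (?\<Gamma> 1 1 2 y * u y) + (2 * ?\<Gamma> 2 1 2 y + ?\<Gamma> 1 1 1 y) * v y + ?\<Gamma> 2 1 1 y * w y)"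
    "2 * ?t y + partial_deriv 1 w y = 2 * (?\<Gamma> 1 2 2 y * u y + (2 * ?\<Gamma> 1 1 2 y + ?\<Gamma> 2 2 2 y) * v y + 2 * (?\<Gamma> 2 1 2 y * w y))"
    if y: "y \<in> S" for y
  proof -
    have symb: "b y $ 2 $ 1 = b y $ 1 $ 2" using symmetric_onD(2)[OF S(4) y] .
    have pd: "partial_deriv i (\<lambda>u. b u $ 2 $ 1) y = partial_deriv i v y" for i
      using partial_deriv_sym[OF S(1,4) y] unfolding v_def .
    have ps: "?\<Gamma> k 2 1 y = ?\<Gamma> k 1 2 y" for k by (rule christoffel_sym[OF S(1) metric_onD(1)[OF S(3)] y])
    have eq: "dform b y z z z = 2 * form b y z (spray G y z)" for z using S(5) y unfolding killing_on_def by blast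
    have "p * p * p * (partial_deriv 1 u y - 2 * (?\<Gamma> 1 1 1 y * u y + ?\<Gamma> 2 1 1 y * v y))
      + p * p * q * (2 * ?s y + partial_deriv 2 u y - 2 * (2 * (?\<Gamma> 1 1 2 y * u y) + (2 * ?\<Gamma> 2 1 2 y + ?\<Gamma> 1 1 1 y) * v y + ?\<Gamma> 2 1 1 y * w y))
      + p * q * q * (2 * ?t y + partial_deriv 1 w y - 2 * (?\<Gamma> 1 2 2 y * u y + (2 * ?\<Gamma> 1 1 2 y + ?\<Gamma> 2 2 2 y) * v y + 2 * (?\<Gamma> 2 1 2 y * w y)))
      + q * q * q * (partial_deriv 2 w y - 2 * (?\<Gamma> 1 2 2 y * v y + ?\<Gamma> 2 2 2 y * w y)) = 0" for p q
    proof -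
      have fold: "(\<lambda>u. b u $ 1 $ 1) = u" "(\<lambda>u. b u $ 1 $ 2) = v" "(\<lambda>u. b u $ 2 $ 2) = w"
        "b y $ 1 $ 1 = u y" "b y $ 1 $ 2 = v y" "b y $ 2 $ 2 = w y" by (simp_all add: u_def v_def w_def fun_eq_iff)
      have "dform b y (vector [p, q]) (vector [p, q]) (vector [p, q]) - 2 * form b y (vector [p, q]) (spray G y (vector [p, q])) = 0"
        using eq by simp
      then show ?thesis
        unfolding dform_partial[OF S(1) smb y] form_expand spray_def sum_2 vec_lambda_beta vector_2 pd fold symb ps
        by (simp add: algebra_simps)
    qed
    note c = binary_cubic_zero[OF this]
    show "partial_deriv 1 u y = 2 * (?\<Gamma> 1 1 1 y * u y + ?\<Gamma> 2 1 1 y * v y)"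
      "partial_deriv 2 w y = 2 * (?\<Gamma> 1 2 2 y * v y + ?\<Gamma> 2 2 2 y * w y)"
      "2 * ?s y + partial_deriv 2 u y = 2 * (2 * (?\<Gamma> 1 1 2 y * u y) + (2 * ?\<Gamma> 2 1 2 y + ?\<Gamma> 1 1 1 y) * v y + ?\<Gamma> 2 1 1 y * w y)"
      "2 * ?t y + partial_deriv 1 w y = 2 * (?\<Gamma> 1 2 2 y * u y + (2 * ?\<Gamma> 1 1 2 y + ?\<Gamma> 2 2 2 y) * v y + 2 * (?\<Gamma> 2 1 2 y * w y))"
      using c by simp_all
  qed
  have g0: "smooth_module S ?Z0 u" "smooth_module S ?Z0 v" "smooth_module S ?Z0 w" by (rule smooth_module_gen, simp)+
  have sm2\<Gamma>: "smooth_on S (\<lambda>y. 2 * ?\<Gamma> k i j y + ?\<Gamma> k' i' j' y)" for k i j k' i' j'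
    by (intro smooth_on_add smooth_on_mult smooth_on_const sm\<Gamma> S(1))
  have M0: "smooth_module S ?Z0 (partial_deriv 1 u)" "smooth_module S ?Z0 (partial_deriv 2 w)"
    "smooth_module S ?Z0 (\<lambda>y. 2 * ?s y + partial_deriv 2 u y)" "smooth_module S ?Z0 (\<lambda>y. 2 * ?t y + partial_deriv 1 w y)"
  proof -
    have "smooth_module S ?Z0 (\<lambda>y. 2 * (?\<Gamma> 1 1 1 y * u y + ?\<Gamma> 2 1 1 y * v y))"
      by (intro smooth_module_scale smooth_module_add smooth_module_mult sm\<Gamma> g0)
    then show "smooth_module S ?Z0 (partial_deriv 1 u)" by (rule smooth_module_cong) (simp add: K)
    have "smooth_module S ?Z0 (\<lambda>y. 2 * (?\<Gamma> 1 2 2 y * v y + ?\<Gamma> 2 2 2 y * w y))"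
      by (intro smooth_module_scale smooth_module_add smooth_module_mult sm\<Gamma> g0)
    then show "smooth_module S ?Z0 (partial_deriv 2 w)" by (rule smooth_module_cong) (simp add: K)
    have "smooth_module S ?Z0 (\<lambda>y. 2 * (2 * (?\<Gamma> 1 1 2 y * u y) + (2 * ?\<Gamma> 2 1 2 y + ?\<Gamma> 1 1 1 y) * v y + ?\<Gamma> 2 1 1 y * w y))"
      by (intro smooth_module_scale smooth_module_add smooth_module_mult[OF sm\<Gamma>] smooth_module_mult[OF sm2\<Gamma>] g0)
    then show "smooth_module S ?Z0 (\<lambda>y. 2 * ?s y + partial_deriv 2 u y)" by (rule smooth_module_cong) (simp only: K)
    have "smooth_module S ?Z0 (\<lambda>y. 2 * (?\<Gamma> 1 2 2 y * u y + (2 * ?\<Gamma> 1 1 2 y + ?\<Gamma> 2 2 2 y) * v y + 2 * (?\<Gamma> 2 1 2 y * w y)))"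
      by (intro smooth_module_scale smooth_module_add smooth_module_mult[OF sm\<Gamma>] smooth_module_mult[OF sm2\<Gamma>] g0)
    then show "smooth_module S ?Z0 (\<lambda>y. 2 * ?t y + partial_deriv 1 w y)" by (rule smooth_module_cong) (simp only: K)
  qed
  have g1: "smooth_module S ?Z1 z" if "z \<in> ?Z1" for z using that by (rule smooth_module_gen)
  have g01: "smooth_module S ?Z1 z" if "z \<in> ?Z0" for z using that by (intro smooth_module_gen) blast
  have M01: "smooth_module S ?Z1 f" if "smooth_module S ?Z0 f" for f by (rule smooth_module_mono[OF that g01])
  have p2u: "smooth_module S ?Z1 (partial_deriv 2 u)"
    by (rule smooth_module_cong[OF smooth_module_diff[OF M01[OF M0(3)] smooth_module_scale[OF g1, of ?s 2]]]) auto
  have p1w: "smooth_module S ?Z1 (partial_deriv 1 w)"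
    by (rule smooth_module_cong[OF smooth_module_diff[OF M01[OF M0(4)] smooth_module_scale[OF g1, of ?t 2]]]) auto
  have d0: "smooth_module S ?Z1 (partial_deriv i z)" if "z \<in> ?Z0" for i z
    using exhaust_2[of i] that p2u p1w M01[OF M0(1)] M01[OF M0(2)] g1[of ?s] g1[of ?t] by auto
  have D0: "smooth_module S ?Z1 (partial_deriv i f)" if "smooth_module S ?Z0 f" for i f
    by (rule smooth_module_partial_deriv[OF S(1) sm0 g01 d0 that])
  have comm: "partial_deriv i (partial_deriv j f) y = partial_deriv j (partial_deriv i f) y"
    if "smooth_on S f" "y \<in> S" for i j f y by (rule partial_deriv_commute[OF S(1) that])
  have pdlin: "partial_deriv i (\<lambda>y. 2 * f y + h y) y = 2 * partial_deriv i f y + partial_deriv i h y"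
    if "smooth_on S f" "smooth_on S h" "y \<in> S" for i f h y
  proof -
    have d: "f differentiable (at y)" "h differentiable (at y)" using smooth_on_differentiable that by blast+
    have "(\<lambda>y. 2 * f y) differentiable (at y)" using d(1) by simp
    then show ?thesis using d
      by (simp add: partial_deriv_add) (simp add: partial_deriv_mult[of "\<lambda>y. 2"], simp add: partial_deriv_def)
  qed
  have smp: "smooth_on S (partial_deriv i f)" if "smooth_on S f" for i f using smooth_on_partial_deriv[OF that] .
  \<comment> \<open>The derivative of \<open>2 s + \<partial>\<^sub>2 u\<close> along the first
    coordinate contains the mixed derivative of \<open>u\<close>, which is also the derivative of
    the known \<open>\<partial>\<^sub>1 u\<close> along the second. Their difference is
    \<open>2 \<partial>\<^sub>1 s\<close>. The same argument with \<open>w\<close> gives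
    \<open>\<partial>\<^sub>2 t\<close>.\<close>
  have d1s: "smooth_module S ?Z1 (partial_deriv 1 ?s)"
  proof (rule smooth_module_cong[OF smooth_module_scale[OF smooth_module_diff[OF D0[OF M0(3), of 1] D0[OF M0(1), of 2]], of "1/2"]])
    show "1 / 2 * (partial_deriv 1 (\<lambda>y. 2 * ?s y + partial_deriv 2 u y) y - partial_deriv 2 (partial_deriv 1 u) y)
       = partial_deriv 1 ?s y" if "y \<in> S" for y
      using pdlin[OF smp[OF sm(2)] smp[OF sm(1)] that, of 1 1 2] comm[OF sm(1) that, of 1 2] by simp
  qed
  have d2t: "smooth_module S ?Z1 (partial_deriv 2 ?t)"
  proof (rule smooth_module_cong[OF smooth_module_scale[OF smooth_module_diff[OF D0[OF M0(4), of 2] D0[OF M0(2), of 1]], of "1/2"]])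
    show "1 / 2 * (partial_deriv 2 (\<lambda>y. 2 * ?t y + partial_deriv 1 w y) y - partial_deriv 1 (partial_deriv 2 w) y)
       = partial_deriv 2 ?t y" if "y \<in> S" for y
      using pdlin[OF smp[OF sm(2)] smp[OF sm(3)] that, of 2 2 1] comm[OF sm(3) that, of 1 2] by simp
  qed
  have g12: "smooth_module S ?Z2 z" if "z \<in> ?Z1" for z using that by (intro smooth_module_gen) blast
  have M12: "smooth_module S ?Z2 f" if "smooth_module S ?Z1 f" for f by (rule smooth_module_mono[OF that g12])
  have r: "smooth_module S ?Z2 ?r" by (rule smooth_module_gen) simp
  have d1t: "smooth_module S ?Z2 (partial_deriv 1 ?t)"
    by (rule smooth_module_cong[OF r]) (rule comm[OF sm(2)])
  have d1: "smooth_module S ?Z2 (partial_deriv i z)" if "z \<in> ?Z1" for i z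
    using exhaust_2[of i] that M12[OF d0] M12[OF d1s] M12[OF d2t] d1t r by auto
  have D1: "smooth_module S ?Z2 (partial_deriv i f)" if "smooth_module S ?Z1 f" for i f
    by (rule smooth_module_partial_deriv[OF S(1) sm1 g12 d1 that])
  \<comment> \<open>The system closes here: \<open>\<partial>\<^sub>1 r = \<partial>\<^sub>2
    (\<partial>\<^sub>1 s)\<close> and \<open>\<partial>\<^sub>2 r = \<partial>\<^sub>1
    (\<partial>\<^sub>2 t)\<close>, where the inner derivatives already lie in the module of
    \<open>?Z1\<close>. Six unknowns match the dimension six of the quadratic Killing tensors of a
    flat plane.\<close>
  have d1r: "smooth_module S ?Z2 (partial_deriv 1 ?r)"
    by (rule smooth_module_cong[OF D1[OF d1s, of 2]]) (rule comm[OF smp[OF sm(2)]])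
  have d2r: "smooth_module S ?Z2 (partial_deriv 2 ?r)"
  proof (rule smooth_module_cong[OF D1[OF d2t, of 1]])
    fix y assume y: "y \<in> S"
    have "partial_deriv 1 (partial_deriv 2 ?t) y = partial_deriv 2 (partial_deriv 1 ?t) y" by (rule comm[OF smp[OF sm(2)] y])
    also have "\<dots> = partial_deriv 2 ?r y"
      by (rule partial_deriv_cong[OF S(1) y smooth_on_differentiable[OF smp[OF smp[OF sm(2)]] y] comm[OF sm(2)]])
    finally show "partial_deriv 1 (partial_deriv 2 ?t) y = partial_deriv 2 ?r y" .
  qed
  have closed: "smooth_module S ?Z2 (partial_deriv i z)" if "z \<in> ?Z2" for i z
    using exhaust_2[of i] that d1 d1r d2r by blast
  obtain p where p: "p \<in> N" using N(3) by blast
  \<comment> \<open>On the open set \<open>N\<close> derivatives of vanishing functions vanish, so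
    any point of \<open>N\<close> provides zero initial data for all six unknowns.\<close>
  have pd0: "partial_deriv i f y = 0" if "\<And>y. y \<in> N \<Longrightarrow> f y = 0" "y \<in> N" for i f y
    using partial_deriv_cong[OF N(1) that(2), of "\<lambda>_. 0" f i] that(1) by (simp add: partial_deriv_def)
  have z0: "u y = 0" "v y = 0" "w y = 0" if "y \<in> N" for y using N(4)[OF that] by (simp_all add: u_def v_def w_def)
  have s0: "?s y = 0" "?t y = 0" if "y \<in> N" for y using pd0[of v y 1] pd0[of v y 2] z0(2) that by auto
  have r0: "?r y = 0" if "y \<in> N" for y using pd0[of ?s y 2] s0(1) that by auto
  have "\<forall>z\<in>?Z2. z x = 0"
  proof (rule closed_system_zero[OF S(1,2) _ sm2 closed _ _ x])
    show "p \<in> S" using p N(2) by blast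
    show "z p = 0" if "z \<in> ?Z2" for z using that z0[OF p] s0[OF p] r0[OF p] by blast
  qed auto
  then have "u x = 0" "v x = 0" "w x = 0" by blast+
  then show ?thesis using symmetric_onD(2)[OF S(4) x] by (simp add: vec_eq_iff forall_2 u_def v_def w_def)
qed

section \<open>Normal forms on a surface\<close>

definition in_normal_form :: "(real^2) set \<Rightarrow> (real^2 \<Rightarrow> real^2^2) \<Rightarrow> (real^2 \<Rightarrow> real^2^2) \<Rightarrow> bool" where
  "in_normal_form D G H \<longleftrightarrow> liouville_form 1 D G H \<or>
     (\<exists>\<epsilon>\<in>{1, -1}. liouville_form (-1) D G (\<lambda>u. \<epsilon> *\<^sub>R H u)) \<or>
     complex_liouville_form D G H \<or>
     (\<exists>\<epsilon>\<in>{1, -1}. jordan_block_form D G (\<lambda>u. \<epsilon> *\<^sub>R H u))"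

section \<open>From the local coframes to charts of the surface\<close>

lemma form_scale: "form (\<lambda>u. k *\<^sub>R G u) u v w = k * form G u v w"
  by (simp add: form_expand algebra_simps)

lemma form_eq_scale: "G u = k *\<^sub>R H u \<Longrightarrow> form G u v w = k * form H u v w"
  by (simp add: form_expand algebra_simps)

lemma chart_transfer:
  assumes M: "smooth_surface M A" and c: "c \<in> A" and D: "D \<subseteq> chart_img c" and bd: "box_diffeo D \<psi> \<eta> lo hi"
  obtains c' where "c' \<in> A" "chart_img c' = box lo hi" "\<And>u. u \<in> D \<Longrightarrow> chart_inv c u \<in> chart_dom c'"
    "\<And>g y v. surface_metric A g \<Longrightarrow> y \<in> box lo hi \<Longrightarrow> form (g c') y v v =
       form (g c) (\<eta> y) (frechet_derivative \<eta> (at y) v) (frechet_derivative \<eta> (at y) v)"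
proof -
  note d = box_diffeoD[OF bd]
  let ?c = "(chart_inv c ` D, \<psi> \<circ> coords c)"
  note nc = new_chart[OF M c D bd]
  show ?thesis
  proof (rule that[OF nc(1,2,3)])
    fix g y v assume g: "surface_metric A g" and y: "y \<in> box lo hi"
    show "form (g ?c) y v v = form (g c) (\<eta> y) (frechet_derivative \<eta> (at y) v) (frechet_derivative \<eta> (at y) v)"
      using nc(4)[OF g d(6)[OF y], of "frechet_derivative \<eta> (at y) v" "frechet_derivative \<eta> (at y) v"]
      unfolding box_diffeo_inverse_derivative[OF bd y] d(7)[OF y] by simp
  qed auto
qed

text \<open>With \<open>\<delta> = X Y\<close>, dividing
  \<open>b = (X - Y) (Y dx\<^sup>2 + s X dy\<^sup>2)\<close> by \<open>\<delta>\<^sup>2\<close>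
  gives exactly the second metric. Having \<open>b\<close> and \<open>\<epsilon>\<close> as
  parameters allows the use for both \<open>a\<close> and \<open>- a\<close>.\<close>

lemma liouville_chart:
  assumes M: "smooth_surface M A" and g: "surface_metric A g" "surface_metric A gbar" and c: "c \<in> A"
    and S: "open S" "S \<subseteq> chart_img c" "symmetric_on S b" "killing_on S (g c) b" and q: "q \<in> S"
    and sm: "smooth_on S X" "smooth_on S Y" and s: "s \<in> {1, -1}"
    and b0: "\<And>u. u \<in> S \<Longrightarrow> det (b u) \<noteq> 0"
    and rel: "\<And>u. u \<in> S \<Longrightarrow> \<epsilon> *\<^sub>R gbar c u = inverse ((det (b u) / det (g c u))\<^sup>2) *\<^sub>R b u"
    and XY: "\<And>u. u \<in> S \<Longrightarrow> X u \<noteq> Y u"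
      "\<And>u. u \<in> S \<Longrightarrow> mixed_det (g c) b u = (X u + Y u) * det (g c u)"
      "\<And>u. u \<in> S \<Longrightarrow> det (b u) = X u * Y u * det (g c u)"
    and pos: "0 < X q * form (g c) q w w - form b q w w" "0 < s * (form b q w' w' - Y q * form (g c) q w' w')"
  shows "\<exists>c'\<in>A. chart_inv c q \<in> chart_dom c' \<and>
    liouville_form s (chart_img c') (g c') (\<lambda>u. \<epsilon> *\<^sub>R gbar c' u)"
proof -
  have mG: "metric_on S (g c)" using surface_metric_on[OF g(1) c] S(2) metric_on_subset by blast
  obtain D \<psi> \<eta> lo hi Xf Yf where D: "D \<subseteq> S" "q \<in> D" and bd: "box_diffeo D \<psi> \<eta> lo hi"
    and f: "smooth_on ((\<lambda>u. u $ 1) ` box lo hi) Xf" "smooth_on ((\<lambda>u. u $ 2) ` box lo hi) Yf"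
    and Xf: "\<And>u. u \<in> D \<Longrightarrow> X u = Xf (\<psi> u $ 1)" and Yf: "\<And>u. u \<in> D \<Longrightarrow> Y u = Yf (\<psi> u $ 2)"
    and Gf: "\<And>u v. u \<in> D \<Longrightarrow> form (g c) u v v = (X u - Y u) *
       ((frechet_derivative \<psi> (at u) v $ 1)\<^sup>2 + s * (frechet_derivative \<psi> (at u) v $ 2)\<^sup>2)"
    and bf: "\<And>u v. u \<in> D \<Longrightarrow> form b u v v = (X u - Y u) *
       (Y u * (frechet_derivative \<psi> (at u) v $ 1)\<^sup>2 + s * X u * (frechet_derivative \<psi> (at u) v $ 2)\<^sup>2)"
    by (rule liouville_local[OF S(1) mG S(3,4) q sm s XY pos]; (assumption | (rule that; assumption)))
  note d = box_diffeoD[OF bd]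
  have DU: "D \<subseteq> chart_img c" using D(1) S(2) by blast
  obtain c' where c': "c' \<in> A" "chart_img c' = box lo hi" "\<And>u. u \<in> D \<Longrightarrow> chart_inv c u \<in> chart_dom c'"
    and tr: "\<And>g y v. surface_metric A g \<Longrightarrow> y \<in> box lo hi \<Longrightarrow> form (g c') y v v =
       form (g c) (\<eta> y) (frechet_derivative \<eta> (at y) v) (frechet_derivative \<eta> (at y) v)"
    by (rule chart_transfer[OF M c DU bd]) (rule that; assumption)
  have "liouville_form s (chart_img c') (g c') (\<lambda>u. \<epsilon> *\<^sub>R gbar c' u)"
    unfolding liouville_form_def c'(2) Let_def
  proof (rule exI[of _ Xf], rule exI[of _ Yf], intro conjI f ballI allI)
    fix y dx dy assume y: "y \<in> box lo hi"
    let ?u = "\<eta> y" and ?v = "vector [dx, dy] :: real^2"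
    let ?w = "frechet_derivative \<eta> (at y) ?v"
    have u: "?u \<in> D" and uS: "?u \<in> S" using d(6)[OF y] D(1) by auto
    note w = box_diffeo_inverse_derivative[OF bd y, of ?v]
    have X: "X ?u = Xf (y $ 1)" and Y: "Y ?u = Yf (y $ 2)" using Xf[OF u] Yf[OF u] d(7)[OF y] by simp_all
    show "ds2 (g c' y) dx dy = (Xf (y $ 1) - Yf (y $ 2)) * (dx\<^sup>2 + s * dy\<^sup>2)"
      unfolding ds2_form tr[OF g(1) y] Gf[OF u] w X Y by simp
    have dG: "det (g c ?u) \<noteq> 0" using metric_onD(4)[OF mG uS] .
    have XY0: "X ?u \<noteq> 0" "Y ?u \<noteq> 0" using b0[OF uS] XY(3)[OF uS] by auto
    have \<delta>: "det (b ?u) / det (g c ?u) = X ?u * Y ?u" using XY(3)[OF uS] dG by simp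
    have "ds2 (\<epsilon> *\<^sub>R gbar c' y) dx dy = \<epsilon> * form (gbar c) ?u ?w ?w"
      using ds2_form[of "\<lambda>y. \<epsilon> *\<^sub>R gbar c' y" y dx dy] unfolding form_scale tr[OF g(2) y] .
    also have "\<dots> = form (\<lambda>u. \<epsilon> *\<^sub>R gbar c u) ?u ?w ?w" unfolding form_scale ..
    also have "\<dots> = inverse ((X ?u * Y ?u)\<^sup>2) * form b ?u ?w ?w"
      by (rule form_eq_scale[where G="\<lambda>u. \<epsilon> *\<^sub>R gbar c u" and H=b and u="?u", OF rel[OF uS, unfolded \<delta>]])
    also have "\<dots> = inverse ((X ?u * Y ?u)\<^sup>2) * ((X ?u - Y ?u) * (Y ?u * dx\<^sup>2 + s * X ?u * dy\<^sup>2))"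
      unfolding bf[OF u] w by simp
    also have "\<dots> = (1 / Y ?u - 1 / X ?u) * (dx\<^sup>2 / X ?u + s * (dy\<^sup>2 / Y ?u))"
      using XY0 by (simp add: field_simps power2_eq_square)
    finally show "ds2 (\<epsilon> *\<^sub>R gbar c' y) dx dy = (1 / Yf (y $ 2) - 1 / Xf (y $ 1)) * (dx\<^sup>2 / Xf (y $ 1) + s * (dy\<^sup>2 / Yf (y $ 2)))"
      unfolding X Y .
  qed
  then show ?thesis using c'(1,3) D(2) by blast
qed

text \<open>Here \<open>\<delta>\<close> is the squared modulus of the eigenvalue \<open>h\<close>,
  the source of the denominators. Both signs of \<open>gbar\<close> are covered, as there is no sign
  condition on the tensor.\<close>

lemma complex_liouville_chart:
  assumes M: "smooth_surface M A" and g: "surface_metric A g" "surface_metric A gbar" and c: "c \<in> A"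
    and S: "open S" "S \<subseteq> chart_img c" "symmetric_on S a" "killing_on S (g c) a" and q: "q \<in> S"
    and sm: "smooth_on S R" "smooth_on S I"
    and rel: "\<And>u. u \<in> S \<Longrightarrow> gbar c u = inverse ((det (a u) / det (g c u))\<^sup>2) *\<^sub>R a u"
    and I: "\<And>u. u \<in> S \<Longrightarrow> I u \<noteq> 0"
    and mix: "\<And>u. u \<in> S \<Longrightarrow> mixed_det (g c) a u = 2 * R u * det (g c u)"
    and det: "\<And>u. u \<in> S \<Longrightarrow> det (a u) = ((R u)\<^sup>2 + (I u)\<^sup>2) * det (g c u)"
  shows "\<exists>c'\<in>A. chart_inv c q \<in> chart_dom c' \<and> complex_liouville_form (chart_img c') (g c') (gbar c')"
proof -
  have mG: "metric_on S (g c)" using surface_metric_on[OF g(1) c] S(2) metric_on_subset by blast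
  obtain D \<psi> \<eta> lo hi h where D: "D \<subseteq> S" "q \<in> D" and bd: "box_diffeo D \<psi> \<eta> lo hi"
    and holo: "h holomorphic_on (\<lambda>u. Complex (u $ 1) (u $ 2)) ` box lo hi"
    and h: "\<And>u. u \<in> D \<Longrightarrow> h (Complex (\<psi> u $ 1) (\<psi> u $ 2)) = Complex (R u) (I u)"
    and Gf: "\<And>u v. u \<in> D \<Longrightarrow> form (g c) u v v =
       2 * I u * (frechet_derivative \<psi> (at u) v $ 1) * (frechet_derivative \<psi> (at u) v $ 2)"
    and af: "\<And>u v. u \<in> D \<Longrightarrow> form a u v v =
       2 * R u * I u * (frechet_derivative \<psi> (at u) v $ 1) * (frechet_derivative \<psi> (at u) v $ 2)
       - (I u)\<^sup>2 * ((frechet_derivative \<psi> (at u) v $ 1)\<^sup>2 - (frechet_derivative \<psi> (at u) v $ 2)\<^sup>2)"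
    by (rule complex_liouville_local[OF S(1) mG S(3,4) q sm I mix det]; (assumption | (rule that; assumption)))
  note d = box_diffeoD[OF bd]
  have DU: "D \<subseteq> chart_img c" using D(1) S(2) by blast
  obtain c' where c': "c' \<in> A" "chart_img c' = box lo hi" "\<And>u. u \<in> D \<Longrightarrow> chart_inv c u \<in> chart_dom c'"
    and tr: "\<And>g y v. surface_metric A g \<Longrightarrow> y \<in> box lo hi \<Longrightarrow> form (g c') y v v =
       form (g c) (\<eta> y) (frechet_derivative \<eta> (at y) v) (frechet_derivative \<eta> (at y) v)"
    by (rule chart_transfer[OF M c DU bd]) (rule that; assumption)
  have "complex_liouville_form (chart_img c') (g c') (gbar c')"
    unfolding complex_liouville_form_def c'(2) Let_def
  proof (intro exI[of _ h] conjI holo ballI allI)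
    fix y dx dy assume y: "y \<in> box lo hi"
    let ?u = "\<eta> y" and ?v = "vector [dx, dy] :: real^2"
    let ?w = "frechet_derivative \<eta> (at y) ?v"
    have u: "?u \<in> D" and uS: "?u \<in> S" using d(6)[OF y] D(1) by auto
    note w = box_diffeo_inverse_derivative[OF bd y, of ?v]
    have hy: "h (Complex (y $ 1) (y $ 2)) = Complex (R ?u) (I ?u)" using h[OF u] d(7)[OF y] by simp
    show "ds2 (g c' y) dx dy = 2 * Im (h (Complex (y $ 1) (y $ 2))) * dx * dy"
      unfolding ds2_form tr[OF g(1) y] Gf[OF u] w hy by simp
    have dG: "det (g c ?u) \<noteq> 0" using metric_onD(4)[OF mG uS] .
    let ?n = "(I ?u)\<^sup>2 + (R ?u)\<^sup>2"
    have n0: "?n \<noteq> 0" using I[OF uS] by (simp add: sum_power2_eq_zero_iff)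
    have \<delta>: "det (a ?u) / det (g c ?u) = ?n" using det[OF uS] dG by simp
    have "ds2 (gbar c' y) dx dy = form (gbar c) ?u ?w ?w"
      unfolding ds2_form tr[OF g(2) y] ..
    also have "\<dots> = inverse (?n\<^sup>2) * form a ?u ?w ?w"
      by (rule form_eq_scale[where G="gbar c" and H=a and u="?u", OF rel[OF uS, unfolded \<delta>]])
    also have "\<dots> = inverse (?n\<^sup>2) * (2 * R ?u * I ?u * dx * dy - (I ?u)\<^sup>2 * (dx\<^sup>2 - dy\<^sup>2))"
      unfolding af[OF u] w by simp
    also have "\<dots> = - ((I ?u / ?n)\<^sup>2 * dx\<^sup>2) + 2 * (R ?u * I ?u / ?n\<^sup>2) * dx * dy + (I ?u / ?n)\<^sup>2 * dy\<^sup>2"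
      by (simp add: divide_inverse power_mult_distrib power_inverse algebra_simps)
    finally show "ds2 (gbar c' y) dx dy =
          - ((Im (h (Complex (y $ 1) (y $ 2))) / ((Im (h (Complex (y $ 1) (y $ 2))))\<^sup>2 + (Re (h (Complex (y $ 1) (y $ 2))))\<^sup>2))\<^sup>2 * dx\<^sup>2)
           + 2 * (Re (h (Complex (y $ 1) (y $ 2))) * Im (h (Complex (y $ 1) (y $ 2))) / ((Im (h (Complex (y $ 1) (y $ 2))))\<^sup>2 + (Re (h (Complex (y $ 1) (y $ 2))))\<^sup>2)\<^sup>2) * dx * dy
           + (Im (h (Complex (y $ 1) (y $ 2))) / ((Im (h (Complex (y $ 1) (y $ 2))))\<^sup>2 + (Re (h (Complex (y $ 1) (y $ 2))))\<^sup>2))\<^sup>2 * dy\<^sup>2"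
      unfolding hy complex.sel .
  qed
  then show ?thesis using c'(1,3) D(2) by blast
qed

lemma jordan_block_identity:
  fixes y W dx dy :: real
  shows "(- 2 * inverse ((y\<^sup>2)\<^sup>2)) * (W * (y * (dx * dy) - W / 2 * dy\<^sup>2))
    = W / y ^ 4 * (- 2 * y * dx * dy + W * dy\<^sup>2)"
proof -
  have y4: "inverse ((y\<^sup>2)\<^sup>2) = inverse (y ^ 4)" by simp
  have "(- 2 * i) * (W * (y * (dx * dy) - W / 2 * e)) = W * i * (- 2 * y * dx * dy + W * e)" for i e :: real
    by (simp add: field_simps)
  then show ?thesis unfolding y4 divide_inverse[of W "y ^ 4"] .
qed

text \<open>The factor \<open>-2\<close> below is what remains of the cube root: it turns the Killing tensor \<open>a\<close> of the
  pair into \<open>b = - (2 powr (1/3)) a\<close>, which is \<open>Y g - \<alpha>\<^sup>2 / 2\<close> in the coordinates of the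
  Jordan-block form.\<close>

lemma jordan_chart:
  assumes M: "smooth_surface M A" and g: "surface_metric A g" "surface_metric A gbar" and c: "c \<in> A"
    and S: "open S" "S \<subseteq> chart_img c" "symmetric_on S b" "killing_on S (g c) b" and q: "q \<in> S"
    and sm: "smooth_on S Y"
    and b0: "\<And>u. u \<in> S \<Longrightarrow> det (b u) \<noteq> 0"
    and rel: "\<And>u. u \<in> S \<Longrightarrow> \<epsilon> *\<^sub>R gbar c u = (- 2 * inverse ((det (b u) / det (g c u))\<^sup>2)) *\<^sub>R b u"
    and mix: "\<And>u. u \<in> S \<Longrightarrow> mixed_det (g c) b u = 2 * Y u * det (g c u)"
    and det: "\<And>u. u \<in> S \<Longrightarrow> det (b u) = (Y u)\<^sup>2 * det (g c u)"
    and pos: "0 < Y q * form (g c) q w w - form b q w w"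
  shows "\<exists>c'\<in>A. chart_inv c q \<in> chart_dom c' \<and> jordan_block_form (chart_img c') (g c') (\<lambda>u. \<epsilon> *\<^sub>R gbar c' u)"
proof -
  have mG: "metric_on S (g c)" using surface_metric_on[OF g(1) c] S(2) metric_on_subset by blast
  obtain D \<psi> \<eta> lo hi Yf where D: "D \<subseteq> S" "q \<in> D" and bd: "box_diffeo D \<psi> \<eta> lo hi"
    and f: "smooth_on ((\<lambda>u. u $ 2) ` box lo hi) Yf" and Yf: "\<And>u. u \<in> D \<Longrightarrow> Y u = Yf (\<psi> u $ 2)"
    and Gf: "\<And>u v. u \<in> D \<Longrightarrow> form (g c) u v v = (1 + \<psi> u $ 1 * deriv Yf (\<psi> u $ 2)) *
       (frechet_derivative \<psi> (at u) v $ 1) * (frechet_derivative \<psi> (at u) v $ 2)"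
    and bf: "\<And>u v. u \<in> D \<Longrightarrow> form b u v v = (1 + \<psi> u $ 1 * deriv Yf (\<psi> u $ 2)) *
       (Y u * ((frechet_derivative \<psi> (at u) v $ 1) * (frechet_derivative \<psi> (at u) v $ 2))
         - (1 + \<psi> u $ 1 * deriv Yf (\<psi> u $ 2)) / 2 * (frechet_derivative \<psi> (at u) v $ 2)\<^sup>2)"
    by (rule jordan_local[OF S(1) mG S(3,4) q sm mix det pos]; (assumption | (rule that; assumption)))
  note d = box_diffeoD[OF bd]
  have DU: "D \<subseteq> chart_img c" using D(1) S(2) by blast
  obtain c' where c': "c' \<in> A" "chart_img c' = box lo hi" "\<And>u. u \<in> D \<Longrightarrow> chart_inv c u \<in> chart_dom c'"
    and tr: "\<And>g y v. surface_metric A g \<Longrightarrow> y \<in> box lo hi \<Longrightarrow> form (g c') y v v =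
       form (g c) (\<eta> y) (frechet_derivative \<eta> (at y) v) (frechet_derivative \<eta> (at y) v)"
    by (rule chart_transfer[OF M c DU bd]) (rule that; assumption)
  have "jordan_block_form (chart_img c') (g c') (\<lambda>u. \<epsilon> *\<^sub>R gbar c' u)"
    unfolding jordan_block_form_def c'(2) Let_def
  proof (intro exI[of _ Yf] conjI f ballI allI)
    fix y dx dy assume y: "y \<in> box lo hi"
    let ?u = "\<eta> y" and ?v = "vector [dx, dy] :: real^2"
    let ?w = "frechet_derivative \<eta> (at y) ?v"
    have u: "?u \<in> D" and uS: "?u \<in> S" using d(6)[OF y] D(1) by auto
    note w = box_diffeo_inverse_derivative[OF bd y, of ?v]
    note \<psi>y = d(7)[OF y]
    have Y: "Y ?u = Yf (y $ 2)" using Yf[OF u] \<psi>y by simp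
    let ?W = "1 + y $ 1 * deriv Yf (y $ 2)"
    show "ds2 (g c' y) dx dy = ?W * dx * dy"
      unfolding ds2_form tr[OF g(1) y] Gf[OF u] w \<psi>y by simp
    have dG: "det (g c ?u) \<noteq> 0" using metric_onD(4)[OF mG uS] .
    have Y0: "Y ?u \<noteq> 0" using b0[OF uS] det[OF uS] by auto
    have \<delta>: "det (b ?u) / det (g c ?u) = (Y ?u)\<^sup>2" using det[OF uS] dG by simp
    have "ds2 (\<epsilon> *\<^sub>R gbar c' y) dx dy = \<epsilon> * form (gbar c) ?u ?w ?w"
      using ds2_form[of "\<lambda>y. \<epsilon> *\<^sub>R gbar c' y" y dx dy] unfolding form_scale tr[OF g(2) y] .
    also have "\<dots> = form (\<lambda>u. \<epsilon> *\<^sub>R gbar c u) ?u ?w ?w" unfolding form_scale ..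
    also have "\<dots> = (- 2 * inverse (((Y ?u)\<^sup>2)\<^sup>2)) * form b ?u ?w ?w"
      by (rule form_eq_scale[where G="\<lambda>u. \<epsilon> *\<^sub>R gbar c u" and H=b and u="?u", OF rel[OF uS, unfolded \<delta>]])
    also have "\<dots> = (- 2 * inverse (((Y ?u)\<^sup>2)\<^sup>2)) * (?W * (Y ?u * (dx * dy) - ?W / 2 * dy\<^sup>2))"
      unfolding bf[OF u] w \<psi>y vector_2 ..
    also have "\<dots> = ?W / Y ?u ^ 4 * (- 2 * Y ?u * dx * dy + ?W * dy\<^sup>2)"
      by (rule jordan_block_identity)
    finally show "ds2 (\<epsilon> *\<^sub>R gbar c' y) dx dy = ?W / Yf (y $ 2) ^ 4 * (- 2 * Yf (y $ 2) * dx * dy + ?W * dy\<^sup>2)"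
      unfolding Y .
  qed
  then show ?thesis using c'(1,3) D(2) by blast
qed

section \<open>The alternative in an open subset of a chart\<close>

lemma symmetric_matrix_eqI:
  fixes G a :: "real^2 \<Rightarrow> real^2^2"
  assumes "G u $ 2 $ 1 = G u $ 1 $ 2" "a u $ 2 $ 1 = a u $ 1 $ 2" "\<And>w. x * form G u w w = form a u w w"
  shows "a u = x *\<^sub>R G u"
proof -
  have "x * G u $ 1 $ 1 = a u $ 1 $ 1" "x * G u $ 2 $ 2 = a u $ 2 $ 2"
    using assms(3)[of "vector [1, 0]"] assms(3)[of "vector [0, 1]"] by (simp_all add: form_expand)
  moreover from this have "x * G u $ 1 $ 2 = a u $ 1 $ 2"
    using assms(3)[of "vector [1, 1]"] assms(1,2) by (simp add: form_expand algebra_simps)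
  ultimately show ?thesis using assms(1,2) by (simp add: vec_eq_iff forall_2)
qed

text \<open>Since \<open>g\<close> itself is conserved, the Killing equation for \<open>f g\<close>
  reduces to \<open>df(v) g(v, v) = 0\<close>. A linear form times a nondegenerate quadratic form is
  the zero cubic only if the linear form is zero.\<close>

lemma conformal_killing_constant:
  assumes B: "open B" "convex B" "metric_on B G" "symmetric_on B a" "killing_on B G a"
    and f: "smooth_on B f" and a: "\<And>u. u \<in> B \<Longrightarrow> a u = f u *\<^sub>R G u"
    and xy: "x \<in> B" "y \<in> B"
  shows "f x = f y"
proof (rule has_derivative_zero_unique[OF B(2) _ xy])
  fix u assume u: "u \<in> B"
  note G = metric_onD[OF B(3)]
  let ?f = "frechet_derivative f (at u)"
  note df = smooth_on_has_derivative[OF f u]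
  have fa: "form a u v w = f u * form G u v w" if "u \<in> B" for u v w
    unfolding form_def a[OF that] by (simp add: scaleR_matrix_vector_assoc[symmetric])
  have 0: "?f v * form G u v v = 0" for v
  proof -
    have "dform a u v v v = f u * dform G u v v v + ?f v * form G u v v"
      by (rule dform_eq_derivative[OF B(1) symmetric_onD(1)[OF B(4)] u fa])
        (auto intro: has_derivative_mult df has_derivative_form[OF B(1) G(2) u])
    moreover have "dform a u v v v = 2 * form a u v (spray G u v)" using B(5) u unfolding killing_on_def by blast
    moreover have "2 * form G u v (spray G u v) = dform G u v v v"
      using form_spray[OF B(1,3) u, of v v] form_sym[of G u, OF G(3)[OF u], of v] by simp
    ultimately show ?thesis unfolding fa[OF u] by (simp add: algebra_simps)
  qed
  let ?D1 = "partial_deriv 1 f u" and ?D2 = "partial_deriv 2 f u"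
  let ?g11 = "G u $ 1 $ 1" and ?g12 = "G u $ 1 $ 2" and ?g22 = "G u $ 2 $ 2"
  note fp = frechet_derivative_partial[OF smooth_on_differentiable[OF f u]]
  have "p * p * p * (?D1 * ?g11) + p * p * q * (2 * (?D1 * ?g12) + ?D2 * ?g11)
     + p * q * q * (?D1 * ?g22 + 2 * (?D2 * ?g12)) + q * q * q * (?D2 * ?g22) = 0" for p q
    using 0[of "vector [p, q]"] unfolding fp form_expand G(3)[OF u] vector_2 by (simp only: algebra_simps) simp?
  note c = binary_cubic_zero[OF this]
  have nz: "?g11 * ?g22 - ?g12\<^sup>2 \<noteq> 0" by (rule G(5)[OF u])
  have "?D1 = 0"
  proof (rule ccontr)
    assume D1: "?D1 \<noteq> 0"
    then have g11: "?g11 = 0" using c(1) by simp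
    then have "?g12 = 0" using c(2) D1 by simp
    then show False using g11 nz by simp
  qed
  moreover have "?D2 = 0"
  proof (rule ccontr)
    assume D2: "?D2 \<noteq> 0"
    then have g22: "?g22 = 0" using c(4) by simp
    then have "?g12 = 0" using c(3) D2 by simp
    then show False using g22 nz by simp
  qed
  ultimately have "?f = (\<lambda>h. 0)" unfolding fp by simp
  then show "(f has_derivative (\<lambda>h. 0)) (at u within B)" using df has_derivative_at_withinI by metis
qed

text \<open>For the density of the good points, one good point in every open \<open>V\<close> is
  enough. So a single point with nonzero discriminant settles the matter; otherwise the discriminant
  vanishes on all of \<open>V\<close>, which is what the Jordan-block case needs.\<close>

lemma normal_form_or_proportional:
  assumes M: "smooth_surface M A" and g: "surface_metric A g" "surface_metric A gbar" and c: "c \<in> A"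
    and a: "symmetric_on (chart_img c) a" "killing_on (chart_img c) (g c) a"
    and a0: "\<And>u. u \<in> chart_img c \<Longrightarrow> det (a u) \<noteq> 0"
    and rel: "\<And>u. u \<in> chart_img c \<Longrightarrow> gbar c u = inverse ((det (a u) / det (g c u))\<^sup>2) *\<^sub>R a u"
    and V: "open V" "V \<subseteq> chart_img c" "V \<noteq> {}"
  shows "(\<exists>q\<in>V. \<exists>c'\<in>A. chart_inv c q \<in> chart_dom c' \<and> in_normal_form (chart_img c') (g c') (gbar c')) \<or>
    (\<exists>N k. open N \<and> N \<subseteq> V \<and> N \<noteq> {} \<and> (\<forall>u\<in>N. a u = k *\<^sub>R g c u))"
proof -
  let ?G = "g c"
  have mG: "metric_on V ?G" using metric_on_subset[OF surface_metric_on[OF g(1) c] V(2)] .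
  note G = metric_onD[OF mG]
  have sa: "symmetric_on V a" and ka: "killing_on V ?G a" using symmetric_on_subset[OF a(1) V(2)] killing_on_subset[OF a(2) V(2)] .
  note sma = symmetric_onD(1)[OF sa]
  \<comment> \<open>Half the trace of \<open>g\<^sup>-\<^sup>1 a\<close>; the eigenvalues are
    \<open>T\<close> plus and minus the square root of \<open>disc\<close>, a quarter of the
    discriminant.\<close>
  define T where "T u = mixed_det ?G a u / (2 * det (?G u))" for u
  define disc where "disc u = (T u)\<^sup>2 - det (a u) / det (?G u)" for u
  have smT: "smooth_on V T"
    unfolding T_def mixed_det_def
    by (intro smooth_on_divide smooth_on_add smooth_on_diff smooth_on_mult smooth_on_const smooth_on_entry
        smooth_on_det V(1) G(2) sma) (use G(4) in auto)
  have smdisc: "smooth_on V disc"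
    unfolding disc_def by (intro smooth_on_divide smooth_on_diff smooth_on_power smT smooth_on_det V(1) G(2) sma G(4))
  have mix: "mixed_det ?G a u = 2 * T u * det (?G u)" if "u \<in> V" for u using G(4)[OF that] by (simp add: T_def)
  have dets: "det (a u) = ((T u)\<^sup>2 - disc u) * det (?G u)" if "u \<in> V" for u using G(4)[OF that] by (simp add: disc_def)
  have symG: "?G u $ 2 $ 1 = ?G u $ 1 $ 2" and syma: "a u $ 2 $ 1 = a u $ 1 $ 2" if "u \<in> V" for u
    using G(3)[OF that] symmetric_onD(2)[OF sa that] .
  have prop_T: "x = T u" if "u \<in> V" "a u = x *\<^sub>R ?G u" for x u
  proof -
    have "mixed_det ?G a u = 2 * x * det (?G u)"
      unfolding mixed_det_def that(2) det_2 symG[OF that(1)] by (simp add: algebra_simps)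
    then show ?thesis using G(4)[OF that(1)] by (simp add: T_def)
  qed
  have not_prop: "\<exists>w. x * form ?G u w w - form a u w w \<noteq> 0" if "u \<in> V" "x \<noteq> T u" for x u
  proof (rule ccontr)
    assume "\<nexists>w. x * form ?G u w w - form a u w w \<noteq> 0"
    then have "x * form ?G u w w = form a u w w" for w by (simp add: algebra_simps)
    from symmetric_matrix_eqI[of ?G u a x, OF symG[OF that(1)] syma[OF that(1)] this] show False using prop_T that by blast
  qed
  have relV: "gbar c u = inverse ((det (a u) / det (g c u))\<^sup>2) *\<^sub>R a u" and a0V: "det (a u) \<noteq> 0" if "u \<in> V" for u
    using rel a0 V(2) that by blast+
  have neg_det: "det (- M) = det M" for M :: "real^2^2" by (simp add: det_2)
  have sneg: "symmetric_on V (\<lambda>u. - a u)" and kneg: "killing_on V ?G (\<lambda>u. - a u)"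
    using killing_on_scale[OF V(1) sa ka, of "-1"] by simp_all
  have fneg: "form (\<lambda>u. - a u) u v w = - form a u v w" for u v w using form_scale[of "-1" a u v w] by simp
  consider (pos) q where "q \<in> V" "0 < disc q" | (neg) q where "q \<in> V" "disc q < 0" | (zero) "\<forall>q\<in>V. disc q = 0"
    by (metis linorder_neqE_linordered_idom)
  then show ?thesis
  proof cases
    case pos
    let ?S = "{u \<in> V. 0 < disc u}"
    have S: "open ?S" by (rule open_positive[OF V(1) smdisc])
    have SV: "?S \<subseteq> V" and qS: "q \<in> ?S" using pos by auto
    then have SU: "?S \<subseteq> chart_img c" using V(2) by blast
    define r where "r u = sqrt (disc u)" for u
    have r: "0 < r u" "(r u)\<^sup>2 = disc u" if "u \<in> ?S" for u using that by (auto simp: r_def)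
    have smr: "smooth_on ?S r" unfolding r_def by (rule smooth_on_sqrt[OF S smooth_on_subset[OF smdisc SV]]) auto
    have smTS: "smooth_on ?S T" by (rule smooth_on_subset[OF smT SV])
    have smX: "smooth_on ?S (\<lambda>u. T u + r u)" "smooth_on ?S (\<lambda>u. T u - r u)"
      "smooth_on ?S (\<lambda>u. - T u + r u)" "smooth_on ?S (\<lambda>u. - T u - r u)"
      by (intro smooth_on_add smooth_on_diff smooth_on_uminus smTS smr S)+
    note S0 = symmetric_on_subset[OF sa SV] killing_on_subset[OF ka SV]
    note S1 = symmetric_on_subset[OF sneg SV] killing_on_subset[OF kneg SV]
    have ne: "T u + r u \<noteq> T u - r u" "T u - r u \<noteq> T u + r u" "- T u + r u \<noteq> - T u - r u" if "u \<in> ?S" for u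
      using r(1)[OF that] by auto
    have tr: "mixed_det ?G a u = (T u + r u + (T u - r u)) * det (?G u)" "mixed_det ?G a u = (T u - r u + (T u + r u)) * det (?G u)"
      "mixed_det ?G (\<lambda>u. - a u) u = (- T u + r u + (- T u - r u)) * det (?G u)" if "u \<in> ?S" for u
      using mix[of u] that by (simp_all add: mixed_det_def)
    have dt: "det (a u) = (T u + r u) * (T u - r u) * det (?G u)" "det (a u) = (T u - r u) * (T u + r u) * det (?G u)"
      "det (- a u) = (- T u + r u) * (- T u - r u) * det (?G u)" if "u \<in> ?S" for u
    proof -
      have "(T u + r u) * (T u - r u) = (T u)\<^sup>2 - disc u" unfolding r(2)[OF that, symmetric] by (simp add: power2_eq_square algebra_simps)
      then show 1: "det (a u) = (T u + r u) * (T u - r u) * det (?G u)" using dets[of u] that by simp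
      then show "det (a u) = (T u - r u) * (T u + r u) * det (?G u)" by (simp add: mult_ac)
      show "det (- a u) = (- T u + r u) * (- T u - r u) * det (?G u)" unfolding neg_det 1 by (simp add: algebra_simps)
    qed
    have rel1: "1 *\<^sub>R gbar c u = inverse ((det (a u) / det (g c u))\<^sup>2) *\<^sub>R a u"
      "-1 *\<^sub>R gbar c u = inverse ((det (- a u) / det (g c u))\<^sup>2) *\<^sub>R - a u" if "u \<in> ?S" for u
      using relV[of u] that unfolding neg_det by simp_all
    have nz: "det (a u) \<noteq> 0" "det (- a u) \<noteq> 0" if "u \<in> ?S" for u using a0V[of u] that unfolding neg_det by simp_all
    obtain w where w: "(T q + r q) * form ?G q w w - form a q w w \<noteq> 0"
      using not_prop[OF pos(1), of "T q + r q"] r(1)[OF qS] by auto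
    obtain w' where w': "(T q - r q) * form ?G q w' w' - form a q w' w' \<noteq> 0"
      using not_prop[OF pos(1), of "T q - r q"] r(1)[OF qS] by auto
    \<comment> \<open>Values of the rank one forms \<open>X g - a\<close> and \<open>a - Y g\<close>
      for \<open>X = T + r\<close>, \<open>Y = T - r\<close>. Their sum is \<open>2 r g\<close>, so
      equal signs mean that \<open>g\<close> is definite and opposite signs that it is
      indefinite.\<close>
    let ?Q1 = "(T q + r q) * form ?G q w w - form a q w w"
    let ?Q2 = "form a q w' w' - (T q - r q) * form ?G q w' w'"
    have "\<exists>c'\<in>A. chart_inv c q \<in> chart_dom c' \<and> in_normal_form (chart_img c') (g c') (gbar c')"
    proof (cases "0 < ?Q1")
      case Q1: True
      define s :: real where "s = (if 0 < ?Q2 then 1 else -1)"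
      have s: "s \<in> {1, -1}" and Q2: "0 < s * ?Q2" using w' by (auto simp: s_def)
      have "\<exists>c'\<in>A. chart_inv c q \<in> chart_dom c' \<and> liouville_form s (chart_img c') (g c') (\<lambda>u. 1 *\<^sub>R gbar c' u)"
        by (rule liouville_chart[OF M g c S SU S0 qS smX(1,2) s nz(1) rel1(1) ne(1) tr(1) dt(1) Q1 Q2])
      then show ?thesis using s unfolding in_normal_form_def by (auto simp del: scaleR_one) (auto)
    next
      case Q1: False
      show ?thesis
      proof (cases "0 < ?Q2")
        case Q2: False
        \<comment> \<open>Both forms negative: exchanging \<open>X\<close> and \<open>Y\<close>
          reverses both signs, so the form with \<open>s = 1\<close> results without changing
          \<open>gbar\<close>.\<close>
        have p1: "0 < (T q - r q) * form ?G q w' w' - form a q w' w'" using Q2 w' by auto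
        have p2: "0 < 1 * (form a q w w - (T q + r q) * form ?G q w w)" using Q1 w by auto
        have "\<exists>c'\<in>A. chart_inv c q \<in> chart_dom c' \<and> liouville_form 1 (chart_img c') (g c') (\<lambda>u. 1 *\<^sub>R gbar c' u)"
          by (rule liouville_chart[OF M g c S SU S0 qS smX(2,1) _ nz(1) rel1(1) ne(2) tr(2) dt(2) p1 p2]) simp
        then show ?thesis unfolding in_normal_form_def by auto
      next
        case Q2: True
        \<comment> \<open>Here an exchange of \<open>X\<close> and \<open>Y\<close> keeps the first
          form negative. Passing to \<open>- a\<close>, with eigenvalues \<open>- T + r\<close> and
          \<open>- T - r\<close>, repairs the signs at the price of
          \<open>\<epsilon> = -1\<close>.\<close>
        have p1: "0 < (- T q + r q) * form ?G q w' w' - form (\<lambda>u. - a u) q w' w'"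
          using Q2 unfolding fneg by (simp add: algebra_simps)
        have p2: "0 < -1 * (form (\<lambda>u. - a u) q w w - (- T q - r q) * form ?G q w w)"
          using Q1 w unfolding fneg by (auto simp: algebra_simps)
        have "\<exists>c'\<in>A. chart_inv c q \<in> chart_dom c' \<and> liouville_form (-1) (chart_img c') (g c') (\<lambda>u. -1 *\<^sub>R gbar c' u)"
          by (rule liouville_chart[OF M g c S SU S1 qS smX(3,4) _ nz(2) rel1(2) ne(3) tr(3) dt(3) p1 p2]) simp
        then show ?thesis unfolding in_normal_form_def by blast
      qed
    qed
    then show ?thesis using pos(1) by blast
  next
    case neg
    let ?S = "{u \<in> V. 0 < - disc u}"
    have S: "open ?S" by (rule open_positive[OF V(1) smooth_on_uminus[OF V(1) smdisc]])
    have SV: "?S \<subseteq> V" and qS: "q \<in> ?S" using neg by auto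
    then have SU: "?S \<subseteq> chart_img c" using V(2) by blast
    define r where "r u = sqrt (- disc u)" for u
    have r: "r u \<noteq> 0" "(r u)\<^sup>2 = - disc u" if "u \<in> ?S" for u using that by (auto simp: r_def)
    have smr: "smooth_on ?S r"
      unfolding r_def by (rule smooth_on_sqrt[OF S smooth_on_uminus[OF S smooth_on_subset[OF smdisc SV]]]) auto
    have "\<exists>c'\<in>A. chart_inv c q \<in> chart_dom c' \<and> complex_liouville_form (chart_img c') (g c') (gbar c')"
    proof (rule complex_liouville_chart[OF M g c S SU symmetric_on_subset[OF sa SV] killing_on_subset[OF ka SV] qS
          smooth_on_subset[OF smT SV] smr])
      fix u assume u: "u \<in> ?S"
      then have uV: "u \<in> V" by blast
      show "gbar c u = inverse ((det (a u) / det (g c u))\<^sup>2) *\<^sub>R a u" by (rule relV[OF uV])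
      show "r u \<noteq> 0" by (rule r(1)[OF u])
      show "mixed_det (g c) a u = 2 * T u * det (g c u)" by (rule mix[OF uV])
      show "det (a u) = ((T u)\<^sup>2 + (r u)\<^sup>2) * det (g c u)" unfolding r(2)[OF u] using dets[OF uV] by simp
    qed
    then show ?thesis using neg(1) unfolding in_normal_form_def by blast
  next
    case zero
    show ?thesis
    proof (cases "\<exists>q\<in>V. \<exists>w. T q * form ?G q w w - form a q w w \<noteq> 0")
      case True
      then obtain q w where q: "q \<in> V" and w: "T q * form ?G q w w - form a q w w \<noteq> 0" by blast
      \<comment> \<open>Chosen so that \<open>k (T g - a)\<close>, the rank one form of the rescaled
        tensor \<open>b = k a\<close>, is positive at \<open>w\<close>.\<close>
      define \<epsilon> :: real where "\<epsilon> = (if 0 < T q * form ?G q w w - form a q w w then -1 else 1)"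
      have \<epsilon>: "\<epsilon> \<in> {1, -1}" "\<epsilon> * \<epsilon> = 1" and \<epsilon>pos: "0 < - \<epsilon> * (T q * form ?G q w w - form a q w w)"
        using w by (auto simp: \<epsilon>_def)
      define l :: real where "l = root 3 2"
      have l: "0 < l" "l ^ 3 = 2" unfolding l_def by (simp, rule odd_real_root_pow) simp
      \<comment> \<open>Scaling by \<open>k\<close> multiplies the quotient of determinants by
        \<open>k\<^sup>2\<close>, so \<open>\<epsilon> gbar = - 2 b / \<delta>\<^sup>2\<close>, with
        \<open>\<delta>\<close> belonging to \<open>b\<close>, amounts to
        \<open>k ^ 3 = - 2 \<epsilon>\<close>.\<close>
      define k where "k = - l * \<epsilon>"
      have k3: "k * k = l * l" using \<epsilon>(2) by (simp add: k_def algebra_simps)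
      have k0: "k \<noteq> 0" using k3 l(1) by auto
      let ?b = "\<lambda>u. k *\<^sub>R a u"
      note kb = killing_on_scale[OF V(1) sa ka, of k]
      have detb: "det (k *\<^sub>R M) = k * k * det M" for M :: "real^2^2" by (simp add: det_2 algebra_simps)
      have "\<exists>c'\<in>A. chart_inv c q \<in> chart_dom c' \<and> jordan_block_form (chart_img c') (g c') (\<lambda>u. \<epsilon> *\<^sub>R gbar c' u)"
      proof (rule jordan_chart[OF M g c V(1,2) kb q, of "\<lambda>u. k * T u" \<epsilon> w])
        show "smooth_on V (\<lambda>u. k * T u)" by (intro smooth_on_mult smooth_on_const smT V(1))
        show "0 < k * T q * form (g c) q w w - form ?b q w w"
        proof -
          have "k * T q * form (g c) q w w - form ?b q w w = l * (- \<epsilon> * (T q * form ?G q w w - form a q w w))"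
            unfolding form_scale k_def by (simp add: algebra_simps)
          then show ?thesis using mult_pos_pos[OF l(1) \<epsilon>pos] by simp
        qed
        fix u assume u: "u \<in> V"
        show "det (k *\<^sub>R a u) \<noteq> 0" unfolding detb using a0V[OF u] k0 by simp
        show "mixed_det (g c) ?b u = 2 * (k * T u) * det (g c u)"
          using arg_cong[OF mix[OF u], of "\<lambda>x. k * x"] by (simp add: mixed_det_def algebra_simps)
        show "det (k *\<^sub>R a u) = (k * T u)\<^sup>2 * det (g c u)"
          unfolding detb using dets[OF u] zero u by (simp add: power2_eq_square)
        have "- 2 * inverse ((k * k * det (a u) / det (g c u))\<^sup>2) * k = \<epsilon> * inverse ((det (a u) / det (g c u))\<^sup>2)"
        proof -
          have l4: "(l * l)\<^sup>2 = 2 * l" using l(2) by (simp add: power2_eq_square power3_eq_cube mult_ac)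
          define z where "z = det (a u) / det (g c u)"
          have "(k * k * det (a u) / det (g c u))\<^sup>2 = (l * l * z)\<^sup>2" unfolding k3 z_def by simp
          also have "\<dots> = 2 * l * z\<^sup>2" unfolding power_mult_distrib[of "l * l" z] l4 ..
          finally have "- 2 * inverse ((k * k * det (a u) / det (g c u))\<^sup>2) * k = - 2 * inverse (2 * l * z\<^sup>2) * k" by simp
          also have "\<dots> = (inverse l * l) * (\<epsilon> * inverse (z\<^sup>2))" by (simp add: k_def mult_ac)
          also have "inverse l * l = 1" using l(1) by simp
          finally show ?thesis by (simp add: z_def)
        qed
        then show "\<epsilon> *\<^sub>R gbar c u = (- 2 * inverse ((det (k *\<^sub>R a u) / det (g c u))\<^sup>2)) *\<^sub>R k *\<^sub>R a u"
          unfolding detb relV[OF u] scaleR_scaleR by simp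
      qed
      then show ?thesis using \<epsilon>(1) q unfolding in_normal_form_def by blast
    next
      case False
      have aT: "a u = T u *\<^sub>R ?G u" if "u \<in> V" for u
        by (rule symmetric_matrix_eqI[of ?G u a "T u", OF symG[OF that] syma[OF that]]) (use False that in auto)
      obtain q where q: "q \<in> V" using V(3) by blast
      then obtain e where e: "0 < e" "ball q e \<subseteq> V" using V(1) open_contains_ball by blast
      have "T u = T q" if "u \<in> ball q e" for u
        by (rule conformal_killing_constant[OF open_ball convex_ball metric_on_subset[OF mG e(2)] symmetric_on_subset[OF sa e(2)]
              killing_on_subset[OF ka e(2)] smooth_on_subset[OF smT e(2)] aT])
          (use that e in auto)
      then have "\<forall>u\<in>ball q e. a u = T q *\<^sub>R ?G u" using aT e(2) by (metis subsetD)
      moreover have "ball q e \<noteq> {}" using e(1) by simp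
      ultimately show ?thesis using e(2) open_ball by blast
    qed
  qed
qed

section \<open>Proportionality spreads over the connected surface\<close>

lemma proportional_transfer:
  assumes M: "smooth_surface M A" and g: "surface_metric A g" "surface_metric A gbar" and c: "c \<in> A" "c' \<in> A"
    and p: "p \<in> chart_dom c" "p \<in> chart_dom c'" and k: "gbar c (coords c p) = k *\<^sub>R g c (coords c p)"
  shows "gbar c' (coords c' p) = k *\<^sub>R g c' (coords c' p)"
proof -
  let ?u = "coords c' p"
  have u: "?u \<in> coords c' ` (chart_dom c' \<inter> chart_dom c)" using p by blast
  have \<phi>: "transition c' c ?u = coords c p"
    using topological_chartD(6)[OF smooth_surfaceD(3)[OF M c(2)] p(2)] by (simp add: transition_def)
  have "form (gbar c') ?u v w = k * form (g c') ?u v w" for v w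
    unfolding metric_transform(1)[OF M g(1) c(2,1) u] metric_transform(1)[OF M g(2) c(2,1) u] \<phi>
    by (rule form_eq_scale[where G="gbar c" and H="g c" and u="coords c p", OF k])
  from this[of "axis _ 1" "axis _ 1"] show ?thesis by (simp add: form_axis vec_eq_iff)
qed

lemma killing_on_diff_metric:
  assumes "open S" "metric_on S G" "symmetric_on S a" "killing_on S G a"
  shows "symmetric_on S (\<lambda>u. 1 *\<^sub>R a u - k *\<^sub>R G u)" "killing_on S G (\<lambda>u. 1 *\<^sub>R a u - k *\<^sub>R G u)"
proof -
  note G = metric_onD[OF assms(2)]
  show s: "symmetric_on S (\<lambda>u. 1 *\<^sub>R a u - k *\<^sub>R G u)"
    by (intro symmetric_on_combination assms(1,3) G(1) smooth_on_const)
  show "killing_on S G (\<lambda>u. 1 *\<^sub>R a u - k *\<^sub>R G u)"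
    unfolding killing_on_def
  proof (intro ballI allI)
    fix u v assume u: "u \<in> S"
    have "dform (\<lambda>u. 1 *\<^sub>R a u - k *\<^sub>R G u) u v v v = 1 * dform a u v v v - k * dform G u v v v"
      by (rule dform_eq_derivative[OF assms(1) symmetric_onD(1)[OF s] u form_combination])
        (intro has_derivative_diff has_derivative_mult_right has_derivative_form[OF assms(1) _ u] G(2) symmetric_onD(1)[OF assms(3)])
    moreover have "dform a u v v v = 2 * form a u v (spray G u v)" using assms(4) u unfolding killing_on_def by blast
    moreover have "dform G u v v v = 2 * form G u v (spray G u v)"
      using form_spray[OF assms(1,2) u, of v v] form_sym[of G u, OF G(3)[OF u], of v] by simp
    ultimately show "dform (\<lambda>u. 1 *\<^sub>R a u - k *\<^sub>R G u) u v v v = 2 * form (\<lambda>u. 1 *\<^sub>R a u - k *\<^sub>R G u) u v (spray G u v)"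
      unfolding form_combination by (simp add: algebra_simps)
  qed
qed

lemma det_scale2: "det (k *\<^sub>R M) = k\<^sup>2 * det M" for M :: "real^2^2"
  by (simp add: det_2 power2_eq_square algebra_simps)

text \<open>Proportionality of \<open>H\<close> and \<open>G\<close> with a constant factor is
  equivalent to that of \<open>a\<close> and \<open>G\<close>, and \<open>a - m G\<close> is a
  Killing tensor to which unique continuation applies.\<close>

lemma proportional_continuation:
  assumes U: "open U" "metric_on U G" "metric_on U H"
    and par: "\<And>u v. u \<in> U \<Longrightarrow> parallel (spray H u v - spray G u v) v"
    and B: "open B" "convex B" "B \<subseteq> U" and N: "open N" "N \<subseteq> B" "N \<noteq> {}"
    and k: "\<And>u. u \<in> N \<Longrightarrow> H u = k *\<^sub>R G u" and x: "x \<in> B"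
  shows "H x = k *\<^sub>R G x"
proof -
  note G = metric_onD[OF U(2)]
  define a where "a u = inverse ((root 3 (det (H u) / det (G u)))\<^sup>2) *\<^sub>R H u" for u
  note kp0 = killing_from_projective[OF U par, folded a_def]
  have kp: "symmetric_on U a" "killing_on U G a" "\<And>u. u \<in> U \<Longrightarrow> H u = inverse ((det (a u) / det (G u))\<^sup>2) *\<^sub>R a u"
    by (rule kp0; assumption)+
  \<comment> \<open>The factor that \<open>a\<close> inherits from \<open>H = k G\<close>, where the
    quotient of determinants is \<open>k\<^sup>2\<close>.\<close>
  define m where "m = inverse ((root 3 (k\<^sup>2))\<^sup>2) * k"
  have mG: "metric_on B G" and sa: "symmetric_on B a" and ka: "killing_on B G a"
    using metric_on_subset[OF U(2) B(3)] symmetric_on_subset[OF kp(1) B(3)] killing_on_subset[OF kp(2) B(3)] .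
  have aN: "a u = m *\<^sub>R G u" if "u \<in> N" for u
  proof -
    have "det (G u) \<noteq> 0" using G(4) that N(2) B(3) by blast
    then have "det (H u) / det (G u) = k\<^sup>2" unfolding k[OF that] det_scale2 by simp
    then show ?thesis unfolding a_def m_def using k[OF that] by simp
  qed
  have "1 *\<^sub>R a u - m *\<^sub>R G u = 0" if "u \<in> B" for u
    by (rule killing_unique_continuation[OF B(1,2) mG killing_on_diff_metric[OF B(1) mG sa ka] N _ that])
      (simp add: aN)
  then have aB: "a u = m *\<^sub>R G u" if "u \<in> B" for u using that by simp
  have HB: "H u = (inverse ((m\<^sup>2)\<^sup>2) * m) *\<^sub>R G u" if u: "u \<in> B" for u
  proof -
    have uU: "u \<in> U" using u B(3) by blast
    have "det (a u) / det (G u) = m\<^sup>2" using G(4)[OF uU] unfolding aB[OF u] det_scale2 by simp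
    with kp(3)[OF uU] show ?thesis unfolding aB[OF u] by simp
  qed
  obtain y where y: "y \<in> N" using N(3) by blast
  have "G y \<noteq> 0"
  proof
    assume "G y = 0"
    then have "det (G y) = 0" by (simp add: det_2)
    then show False using G(4) y N(2) B(3) by blast
  qed
  \<comment> \<open>The constant on \<open>B\<close> is recognized as \<open>k\<close> at a point of
    \<open>N\<close>, where the Gram matrix is nonzero.\<close>
  then have "inverse ((m\<^sup>2)\<^sup>2) * m = k" using HB[of y] k[OF y] y N(2) by auto
  then show ?thesis using HB[OF x] by simp
qed

text \<open>The interior of the set where the proportionality holds is closed in \<open>M\<close>: a
  coordinate ball around a limit point meets it, and balls are convex, so
  \<open>proportional_continuation\<close> fills the ball.\<close>

lemma proportional_everywhere:
  assumes M: "smooth_surface M A" and g: "surface_metric A g" "surface_metric A gbar"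
    and P: "projectively_equivalent A g gbar"
    and c: "c \<in> A" and N: "open N" "N \<subseteq> chart_img c" "N \<noteq> {}"
    and k: "\<And>u. u \<in> N \<Longrightarrow> gbar c u = k *\<^sub>R g c u"
  shows "\<forall>c\<in>A. \<forall>u\<in>chart_img c. gbar c u = k *\<^sub>R g c u"
proof -
  define Q where "Q = {p \<in> M. \<forall>c\<in>A. p \<in> chart_dom c \<longrightarrow> gbar c (coords c p) = k *\<^sub>R g c (coords c p)}"
  have QI: "chart_inv c ` N \<subseteq> interior Q"
    if c: "c \<in> A" and N: "open N" "N \<subseteq> chart_img c" and k: "\<And>u. u \<in> N \<Longrightarrow> gbar c u = k *\<^sub>R g c u" for c N
  proof -
    note tc = topological_chartD[OF smooth_surfaceD(3)[OF M c]]
    have op: "open (chart_dom c \<inter> coords c -` N)" by (rule continuous_open_preimage[OF tc(7,1) N(1)])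
    have "chart_dom c \<inter> coords c -` N \<subseteq> Q"
      unfolding Q_def using smooth_surfaceD(4)[OF M c] proportional_transfer[OF M g c] k by blast
    then have "chart_dom c \<inter> coords c -` N \<subseteq> interior Q" using op by (rule interior_maximal)
    moreover have "chart_inv c ` N \<subseteq> chart_dom c \<inter> coords c -` N" using tc(3,4) N(2) by auto
    ultimately show ?thesis by blast
  qed
  let ?U = "interior Q"
  have UM: "?U \<subseteq> M" using interior_subset[of Q] unfolding Q_def by blast
  have ne: "?U \<noteq> {}" using QI[OF c N(1,2) k] N(3) by blast
  have cl: "p \<in> ?U" if p: "p \<in> M" "p \<in> closure ?U" for p
  proof -
    obtain c where c: "c \<in> A" "p \<in> chart_dom c" using p(1) smooth_surfaceD(2)[OF M] by blast
    note tc = topological_chartD[OF smooth_surfaceD(3)[OF M c(1)]]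
    obtain e where e: "0 < e" "ball (coords c p) e \<subseteq> chart_img c" using tc(2) tc(5)[OF c(2)] open_contains_ball by blast
    let ?B = "ball (coords c p) e"
    let ?O = "chart_dom c \<inter> coords c -` ?B"
    have O: "open ?O" by (rule continuous_open_preimage[OF tc(7,1) open_ball])
    have "p \<in> ?O" using c(2) e(1) by simp
    then have "?O \<inter> ?U \<noteq> {}" using p(2) O closure_iff_nhds_not_empty by blast
    then obtain p' where p': "p' \<in> ?O" "p' \<in> ?U" by blast
    let ?N = "coords c ` (chart_dom c \<inter> (?O \<inter> ?U))"
    have N: "open ?N" by (rule open_coords_image[OF smooth_surfaceD(3)[OF M c(1)] open_Int[OF O open_interior]])
    have NB: "?N \<subseteq> ?B" by blast
    have Nne: "?N \<noteq> {}" using p' by blast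
    have Nk: "gbar c u = k *\<^sub>R g c u" if "u \<in> ?N" for u
      using that interior_subset[of Q] c(1) unfolding Q_def by blast
    have "gbar c u = k *\<^sub>R g c u" if "u \<in> ?B" for u
      by (rule proportional_continuation[OF tc(2) surface_metric_on[OF g(1) c(1)] surface_metric_on[OF g(2) c(1)]
            projectively_equivalent_sprays[OF M g P c(1)] open_ball convex_ball e(2) N NB Nne Nk that])
    from QI[OF c(1) open_ball e(2) this] have "chart_inv c (coords c p) \<in> ?U" using e(1) by auto
    then show ?thesis using tc(6)[OF c(2)] by simp
  qed
  have "openin (top_of_set M) ?U" unfolding openin_open by (rule exI[of _ ?U]) (use UM in auto)
  moreover have "closedin (top_of_set M) ?U"
  proof -
    have "?U = M \<inter> closure ?U" using UM closure_subset[of ?U] cl by blast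
    then show ?thesis using closedin_closed_Int[OF closed_closure] by metis
  qed
  ultimately have "?U = M" using smooth_surfaceD(1)[OF M] ne unfolding connected_clopen by blast
  then have MQ: "M \<subseteq> Q" using interior_subset by blast
  show ?thesis
  proof (intro ballI)
    fix c u assume c: "c \<in> A" and u: "u \<in> chart_img c"
    note tc = topological_chartD[OF smooth_surfaceD(3)[OF M c]]
    have "chart_inv c u \<in> Q" using MQ smooth_surfaceD(4)[OF M c] tc(3)[OF u] by blast
    then have "gbar c (coords c (chart_inv c u)) = k *\<^sub>R g c (coords c (chart_inv c u))"
      unfolding Q_def using c tc(3)[OF u] by blast
    then show "gbar c u = k *\<^sub>R g c u" unfolding tc(4)[OF u] .
  qed
qed

theorem theoremA:
  fixes M :: "'a::{t2_space, second_countable_topology} set"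
    and A :: "'a chart set"
    and g gbar :: "'a chart \<Rightarrow> real ^ 2 \<Rightarrow> real ^ 2 ^ 2"
  assumes "smooth_surface M A"
    and "surface_metric A g" and "surface_metric A gbar"
    and "projectively_equivalent A g gbar"
    and "\<And>k :: real. \<not> (\<forall>c\<in>A. \<forall>u\<in>chart_img c. gbar c u = k *\<^sub>R g c u)"
  shows "\<exists>W. open W \<and> W \<subseteq> M \<and> M \<subseteq> closure W \<and>
    (\<forall>p\<in>W. \<exists>c\<in>A. p \<in> chart_dom c \<and>
      (liouville_form 1 (chart_img c) (g c) (gbar c) \<or>
       (\<exists>\<epsilon>\<in>{1, -1}. liouville_form (-1) (chart_img c) (g c) (\<lambda>u. \<epsilon> *\<^sub>R gbar c u)) \<or>
       complex_liouville_form (chart_img c) (g c) (gbar c) \<or>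
       (\<exists>\<epsilon>\<in>{1, -1}. jordan_block_form (chart_img c) (g c) (\<lambda>u. \<epsilon> *\<^sub>R gbar c u))))"
proof -
  note M = assms(1) and g = assms(2,3) and P = assms(4)
  \<comment> \<open>"Almost every" becomes open and dense: the good set is the union of all charts
    in normal form, so that only density remains to be shown.\<close>
  define C where "C = {c \<in> A. in_normal_form (chart_img c) (g c) (gbar c)}"
  let ?W = "\<Union>c\<in>C. chart_dom c"
  have CA: "C \<subseteq> A" unfolding C_def by blast
  have open_W: "open ?W" using CA topological_chartD(1)[OF smooth_surfaceD(3)[OF M]] by blast
  have WM: "?W \<subseteq> M" using CA smooth_surfaceD(4)[OF M] by blast
  have "p \<in> closure ?W" if p: "p \<in> M" for p
  proof (rule ccontr)
    assume np: "p \<notin> closure ?W"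
    obtain c where c: "c \<in> A" "p \<in> chart_dom c" using p smooth_surfaceD(2)[OF M] by blast
    note tc0 = smooth_surfaceD(3)[OF M c(1)]
    note tc = topological_chartD[OF tc0]
    let ?G = "g c" and ?H = "gbar c" and ?U = "chart_img c"
    note mG = surface_metric_on[OF g(1) c(1)] and mH = surface_metric_on[OF g(2) c(1)]
    define a where "a u = inverse ((root 3 (det (?H u) / det (?G u)))\<^sup>2) *\<^sub>R ?H u" for u
    note kp0 = killing_from_projective[OF tc(2) mG mH projectively_equivalent_sprays[OF M g P c(1)], folded a_def]
    have kp: "symmetric_on ?U a" "killing_on ?U ?G a" "\<And>u. u \<in> ?U \<Longrightarrow> det (a u) \<noteq> 0"
      "\<And>u. u \<in> ?U \<Longrightarrow> ?H u = inverse ((det (a u) / det (?G u))\<^sup>2) *\<^sub>R a u"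
      by (rule kp0; assumption)+
    \<comment> \<open>An open set of coordinates of points away from all good charts; there the
      alternative leaves only constant proportionality, which spreads to all of \<open>M\<close> and
      contradicts the assumption.\<close>
    let ?V = "coords c ` (chart_dom c \<inter> - closure ?W)"
    have V: "open ?V" by (rule open_coords_image[OF tc0]) (rule open_Compl[OF closed_closure])
    have VU: "?V \<subseteq> ?U" using tc(5) by blast
    have Vne: "?V \<noteq> {}" using np c(2) by blast
    have disj: "chart_inv c q \<notin> ?W" if "q \<in> ?V" for q
      using that tc(6) closure_subset[of ?W] by force
    have "\<not> (\<exists>q\<in>?V. \<exists>c'\<in>A. chart_inv c q \<in> chart_dom c' \<and> in_normal_form (chart_img c') (g c') (gbar c'))"
      using disj unfolding C_def by blast
    then obtain N k where N: "open N" "N \<subseteq> ?V" "N \<noteq> {}" and k: "\<And>u. u \<in> N \<Longrightarrow> a u = k *\<^sub>R ?G u"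
      using normal_form_or_proportional[OF M g c(1) kp(1,2,3,4) V VU Vne] by blast
    have NU: "N \<subseteq> ?U" using N(2) VU by blast
    have "?H u = (inverse ((k\<^sup>2)\<^sup>2) * k) *\<^sub>R ?G u" if u: "u \<in> N" for u
    proof -
      have uU: "u \<in> ?U" using u NU by blast
      have "det (a u) / det (?G u) = k\<^sup>2" using metric_onD(4)[OF mG uU] unfolding k[OF u] det_scale2 by simp
      with kp(4)[OF uU] show ?thesis unfolding k[OF u] by simp
    qed
    from proportional_everywhere[OF M g P c(1) N(1) NU N(3) this] assms(5) show False by blast
  qed
  then have "M \<subseteq> closure ?W" by blast
  moreover have "\<forall>p\<in>?W. \<exists>c\<in>A. p \<in> chart_dom c \<and> in_normal_form (chart_img c) (g c) (gbar c)"
    unfolding C_def by blast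
  ultimately show ?thesis
    using open_W WM unfolding in_normal_form_def by (intro exI[of _ ?W] conjI)
qed

end
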